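(* Let $\alpha \approx 2.956$ be Otter's tree constant, i.e. the constant $\alpha>0$ such that the number of pairwise non-isomorphic (unlabelled) trees on $n$ vertices is $(1+o(1))\,C n^{-5/2}\alpha^n$ for an absolute constant $C>0$. For every $0<\varepsilon<\alpha$, there exist constants $d_0=d_0(\varepsilon)$ and $C=C(\varepsilon)$ such that the following holds (for all sufficiently large $n$): if $G$ is an $(n,d,\lambda)$-graph with $d\ge d_0$ and $d/\lambda\ge C$, then the number of distinct unlabelled spanning trees of $G$ is at least $(\alpha-\varepsilon)^n$.
   Context: An $(n,d,\lambda)$-graph is a $d$-regular graph on $n$ vertices whose adjacency matrix eigenvalues $d=\lambda_1\ge\lambda_2\ge\cdots\ge\lambda_n$ satisfy $\max\{\lambda_2,|\lambda_n|\}\le\lambda$. The number of distinct unlabelled spanning trees of $G$ is the number of isomorphism classes of spanning trees of $G$, where two trees $T,T'$ are isomorphic if there is a bijection $\sigma:V(T)\to V(T')$ with $\{u,v\}\in E(T)$ iff $\{\sigma(u),\sigma(v)\}\in E(T')$. Throughout the paper $n$ is assumed sufficiently large. *)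

theory Defs
  imports "Jordan_Normal_Form.Char_Poly" "HOL-Computational_Algebra.Polynomial"
    "HOL-Library.Multiset" "HOL-Library.Landau_Symbols"
begin

text \<open>Simple graphs on the vertex set {0..<n}; edges are 2-element sets.\<close>

definition simple_graph_on :: "nat \<Rightarrow> nat set set \<Rightarrow> bool" where
  "simple_graph_on n E \<longleftrightarrow> (\<forall>e\<in>E. \<exists>u v. e = {u, v} \<and> u \<noteq> v \<and> u < n \<and> v < n)"

definition regular_graph :: "nat \<Rightarrow> nat \<Rightarrow> nat set set \<Rightarrow> bool" where
  "regular_graph n d E \<longleftrightarrow> (\<forall>v<n. card {u. u < n \<and> {u, v} \<in> E} = d)"

definition adj_matrix :: "nat \<Rightarrow> nat set set \<Rightarrow> real mat" where
  "adj_matrix n E = mat n n (\<lambda>(i, j). if {i, j} \<in> E then 1 else 0)"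

text \<open>Eigenvalues with multiplicity, in non-increasing order
  (lambda_1 is element 0, lambda_n is element n-1).\<close>
definition adj_eigenvalues :: "nat \<Rightarrow> nat set set \<Rightarrow> real list" where
  "adj_eigenvalues n E = rev (sorted_list_of_multiset (proots (char_poly (adj_matrix n E))))"

definition ndl_graph :: "nat \<Rightarrow> nat \<Rightarrow> real \<Rightarrow> nat set set \<Rightarrow> bool" where
  "ndl_graph n d lam E \<longleftrightarrow> simple_graph_on n E \<and> regular_graph n d E \<and>
     max (adj_eigenvalues n E ! 1) \<bar>adj_eigenvalues n E ! (n - 1)\<bar> \<le> lam"

definition connected_on :: "nat \<Rightarrow> nat set set \<Rightarrow> bool" where
  "connected_on n T \<longleftrightarrow>
     (\<forall>u<n. \<forall>v<n. (u, v) \<in> {(a, b). {a, b} \<in> T}\<^sup>*)"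

definition has_cycle :: "nat set set \<Rightarrow> bool" where
  "has_cycle T \<longleftrightarrow> (\<exists>vs. length vs \<ge> 3 \<and> distinct vs \<and>
     (\<forall>i < length vs - 1. {vs ! i, vs ! (i + 1)} \<in> T) \<and> {last vs, hd vs} \<in> T)"

definition is_tree_on :: "nat \<Rightarrow> nat set set \<Rightarrow> bool" where
  "is_tree_on n T \<longleftrightarrow> simple_graph_on n T \<and> connected_on n T \<and> \<not> has_cycle T"

definition spanning_tree :: "nat \<Rightarrow> nat set set \<Rightarrow> nat set set \<Rightarrow> bool" where
  "spanning_tree n E T \<longleftrightarrow> T \<subseteq> E \<and> is_tree_on n T"

definition graph_iso :: "nat \<Rightarrow> nat set set \<Rightarrow> nat set set \<Rightarrow> bool" where
  "graph_iso n T T' \<longleftrightarrow> (\<exists>\<sigma>. bij_betw \<sigma> {..<n} {..<n} \<and>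
     (\<forall>u<n. \<forall>v<n. {u, v} \<in> T \<longleftrightarrow> {\<sigma> u, \<sigma> v} \<in> T'))"

definition iso_rel :: "nat \<Rightarrow> (nat set set \<times> nat set set) set" where
  "iso_rel n = {(T, T'). graph_iso n T T'}"

definition num_unlabelled_spanning_trees :: "nat \<Rightarrow> nat set set \<Rightarrow> nat" where
  "num_unlabelled_spanning_trees n E = card ({T. spanning_tree n E T} // iso_rel n)"

definition num_unlabelled_trees :: "nat \<Rightarrow> nat" where
  "num_unlabelled_trees n = card ({T. is_tree_on n T} // iso_rel n)"

definition otter_alpha :: real where
  "otter_alpha = (THE \<alpha>. \<alpha> > 0 \<and> (\<exists>C>0. (\<lambda>n. real (num_unlabelled_trees n))
      \<sim>[at_top] (\<lambda>n. C * real n powr (-5/2) * \<alpha> ^ n)))"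

end

theory Submission
  imports Defs "HOL-Complex_Analysis.Complex_Analysis" "HOL-Real_Asymp.Real_Asymp"
    "Jordan_Normal_Form.Schur_Decomposition"
begin

text \<open>
  The constant is defined by a description operator, so Otter's asymptotics has to be established for it
  to mean anything. With R the generating function of rooted trees and g x = x exp (sum of R (x^k) / k over k at least 2),
  Polya's equation reads R = W o g, where W = sum of n^(n-1) y^n / n! satisfies W = y exp W.
  Counting unrooted trees by their centroids gives the generating function R - R^2/2 + R (x^2)/2,
  whose main part is U o g with U = sum of n^(n-2) y^n / n!. The radius of convergence of g exceeds the
  point where g takes the critical value 1/e, so the coefficients of the powers of g, suitably scaled, are
  the distributions of a random walk with exponential tails; the renewal theorem and Chernoff bounds
  turn the Stirling decay j^(-5/2) of the coefficients of U into n^(-5/2).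

  For the lower bound fix k such that there are nearly alpha^k rooted trees with k vertices. Stringing q of them
  along a path gives a different tree with kq vertices for each sequence, of bounded degree. By
  Haxell's extension argument a graph whose small sets expand and whose large sets are joined by edges
  contains every such tree on almost all of its vertices, and it is connected, so that the tree
  extends to a spanning tree. A spanning tree arises from at most n (n choose kq) rooted trees,
  which costs only a factor close to 1 per vertex. The expansion follows from the bound on the
  nontrivial eigenvalues, obtained from traces of powers of the adjacency matrix.
\<close>

section \<open>Rooted trees\<close>

text \<open>Hence only almost spanning trees are prescribed and the rest of the spanning tree is
  arbitrary; the price is that a spanning tree may contain many embedded trees. Cutting the tree
  into blocks of k vertices is what reconciles a degree bound depending on k alone with a growth
  rate close to alpha.

  In the analytic half the weight j^(-5/2) is nearly constant where the walk can reach n, namely for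
  j near n / mean. So only the total probability of ever hitting n matters, and this is what the
  renewal theorem controls.

  The spectral half works with powers of the adjacency matrix alone. Bessel's inequality for the
  rows of A^k cancels the contribution d^(2k) of the constant vector to the trace of A^(2k) exactly;
  what is left is lam^(2k) up to a factor of order n, and that factor disappears by letting k
  grow.\<close>

datatype rtree = Node (kids: "rtree multiset")

primrec sz :: "rtree \<Rightarrow> nat" where
  "sz (Node M) = Suc (sum_mset (image_mset sz M))"

definition msz :: "rtree multiset \<Rightarrow> nat" where
  "msz M = sum_mset (image_mset sz M)"

lemma sz_Node [simp]: "sz (Node M) = Suc (msz M)"
  by (simp add: msz_def)

declare sz.simps [simp del]

lemma msz_simps [simp]: "msz {#} = 0" "msz (add_mset t M) = sz t + msz M" "msz (M + N) = msz M + msz N"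
  by (simp_all add: msz_def)

lemma sz_pos [simp]: "0 < sz t"
  by (cases t) simp

lemma sz_neq_0 [simp]: "sz t \<noteq> 0"
  by (cases t) simp

lemma sz_kid_less: "s \<in># M \<Longrightarrow> sz s < sz (Node M)"
  by (metis insert_DiffM less_Suc_eq_le le_add1 msz_simps(2) sz_Node)

text \<open>Hanging branches from the root one at a time turns multiset trees into a binary
  structure. The relation \<open>rep\<close> and the embedding \<open>embed_below\<close> follow the
  same decomposition.\<close>

lemma rtree_join_induct [case_names single join]:
  assumes "P (Node {#})" "\<And>s M. P s \<Longrightarrow> P (Node M) \<Longrightarrow> P (Node (add_mset s M))"
  shows "P t"
proof (induction t)
  case (Node M)
  then show ?case
    by (induction M) (auto intro: assms)
qed

definition rtrees :: "nat \<Rightarrow> rtree set" where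
  "rtrees n = {t. sz t = n}"

definition rcount :: "nat \<Rightarrow> nat" where
  "rcount n = card (rtrees n)"

lemma rtrees_0 [simp]: "rtrees 0 = {}"
  by (auto simp: rtrees_def)

lemma rtrees_1 [simp]: "rtrees (Suc 0) = {Node {#}}"
proof -
  have "t = Node {#}" if "sz t = Suc 0" for t
  proof (cases t)
    case (Node M)
    then show ?thesis using that by (cases M) auto
  qed
  then show ?thesis by (auto simp: rtrees_def)
qed

text \<open>The binary decomposition as a map. Every tree with at least two vertices lies in its
  image, which bounds \<open>rcount\<close> from above; on pairs whose first tree is at least as
  large as the second it is injective, which \<open>card_keys\<close> exploits.\<close>

definition rjoin :: "rtree \<times> rtree \<Rightarrow> rtree" where
  "rjoin = (\<lambda>(s, t). Node (add_mset s (kids t)))"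

lemma sz_rjoin [simp]: "sz (rjoin (s, t)) = sz s + sz t"
  by (cases t) (simp add: rjoin_def)

lemma rtrees_subset:
  assumes "n \<ge> 2"
  shows "rtrees n \<subseteq> rjoin ` (\<Union>i\<in>{1..<n}. rtrees i \<times> rtrees (n - i))"
proof
  fix t assume "t \<in> rtrees n"
  then have n: "sz t = n" by (simp add: rtrees_def)
  obtain M where M: "t = Node M" by (cases t)
  then obtain s N where sN: "M = add_mset s N"
    using n assms by (cases M) auto
  have "t = rjoin (s, Node N)" by (simp add: rjoin_def M sN)
  moreover have "(s, Node N) \<in> (\<Union>i\<in>{1..<n}. rtrees i \<times> rtrees (n - i))"
    using n M sN by (auto simp: rtrees_def Suc_le_eq)
  ultimately show "t \<in> rjoin ` (\<Union>i\<in>{1..<n}. rtrees i \<times> rtrees (n - i))" by blast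
qed

lemma finite_rtrees [simp]: "finite (rtrees n)"
proof (induction n rule: less_induct)
  case (less n)
  consider "n = 0" | "n = 1" | "n \<ge> 2" by linarith
  then show ?case
  proof cases
    case 3
    have "finite (rtrees i \<times> rtrees (n - i))" if "i \<in> {1..<n}" for i
      using less that by auto
    then show ?thesis
      by (intro finite_subset[OF rtrees_subset[OF 3]]) blast
  qed auto
qed

lemma rcount_0 [simp]: "rcount 0 = 0" and rcount_1 [simp]: "rcount (Suc 0) = 1"
  by (simp_all add: rcount_def)

text \<open>The Catalan numbers satisfy this convolution with equality, so \<open>rcount\<close> has
  growth rate at most 4.\<close>

lemma rcount_le:
  assumes "n \<ge> 2"
  shows "rcount n \<le> (\<Sum>i\<in>{1..<n}. rcount i * rcount (n - i))"
proof -
  have "rcount n \<le> card (rjoin ` (\<Union>i\<in>{1..<n}. rtrees i \<times> rtrees (n - i)))"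
    unfolding rcount_def by (intro card_mono rtrees_subset assms) auto
  also have "\<dots> \<le> card (\<Union>i\<in>{1..<n}. rtrees i \<times> rtrees (n - i))"
    by (intro card_image_le) auto
  also have "\<dots> \<le> (\<Sum>i\<in>{1..<n}. card (rtrees i \<times> rtrees (n - i)))"
    by (intro card_UN_le) auto
  also have "\<dots> = (\<Sum>i\<in>{1..<n}. rcount i * rcount (n - i))"
    by (simp add: rcount_def card_cartesian_product)
  finally show ?thesis .
qed

lemma rcount_Suc_ge: "rcount (Suc n) \<ge> rcount n"
proof -
  have "inj_on (\<lambda>t. Node {#t#}) (rtrees n)" by (auto simp: inj_on_def)
  then show ?thesis unfolding rcount_def
    by (rule card_inj_on_le) (use finite_rtrees[of "Suc n"] in \<open>auto simp: rtrees_def\<close>)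
qed

text \<open>Trees whose root has one child and trees whose root has a leaf and one further child are
  disjoint families. The resulting growth keeps the radius of convergence below 1.\<close>

lemma rcount_Suc_Suc_ge: "rcount (Suc (Suc n)) \<ge> 2 * rcount n"
proof -
  let ?A = "(\<lambda>t. Node {#t#}) ` rtrees (Suc n)" and ?B = "(\<lambda>t. Node {#t, Node {#}#}) ` rtrees n"
  have A: "card ?A = rcount (Suc n)" unfolding rcount_def
    by (intro card_image) (auto simp: inj_on_def)
  have B: "card ?B = rcount n" unfolding rcount_def
    by (intro card_image) (auto simp: inj_on_def add_eq_conv_ex)
  have "rcount (Suc n) + rcount n = card (?A \<union> ?B)"
    by (subst card_Un_disjoint) (auto simp: A B)
  also have "\<dots> \<le> rcount (Suc (Suc n))"
    unfolding rcount_def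
    by (intro card_mono) (use finite_rtrees[of "Suc (Suc n)"] in \<open>auto simp: rtrees_def\<close>)
  finally show ?thesis using rcount_Suc_ge[of n] by simp
qed

lemma rcount_pos: "n \<ge> 1 \<Longrightarrow> rcount n \<ge> 1"
proof (induction n rule: dec_induct)
  case (step n) then show ?case using rcount_Suc_ge[of n] by linarith
qed simp

lemma rcount_exp_ge: "rcount (Suc (2 * n)) \<ge> 2 ^ n"
proof (induction n)
  case (Suc n) then show ?case using rcount_Suc_Suc_ge[of "Suc (2 * n)"] by simp
qed simp

text \<open>The fixed point of the map taking x to 1/4 + x * x is 1/2.\<close>
lemma rcount_quarter_sum_le: "(\<Sum>n\<le>N. real (rcount n) * (1/4) ^ n) \<le> 1/2"
proof (induction N)
  case (Suc N)
  let ?a = "\<lambda>n. real (rcount n) * (1/4) ^ n"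
  have le: "?a n \<le> (if n = 1 then 1/4 else 0) + (\<Sum>i\<le>n. ?a i * ?a (n - i))" for n
  proof -
    consider "n = 0" | "n = 1" | "n \<ge> 2" by linarith
    then show ?thesis
    proof cases
      case 3
      have "real (rcount n) \<le> (\<Sum>i\<in>{1..<n}. real (rcount i) * real (rcount (n - i)))"
        using rcount_le[OF 3] by (metis (mono_tags, lifting) of_nat_le_iff of_nat_mult of_nat_sum sum.cong)
      also have "\<dots> = (\<Sum>i\<le>n. real (rcount i) * real (rcount (n - i)))"
        by (rule sum.mono_neutral_left) (auto simp: not_le less_Suc_eq)
      finally have "?a n \<le> (\<Sum>i\<le>n. real (rcount i) * real (rcount (n - i))) * (1/4)^n"
        by (simp add: mult_right_mono)
      also have "\<dots> = (\<Sum>i\<le>n. ?a i * ?a (n - i))"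
        unfolding sum_distrib_right
      proof (rule sum.cong)
        fix i assume "i \<in> {..n}"
        then have "(1/4::real)^n = (1/4)^i * (1/4)^(n-i)" by (simp add: power_add[symmetric])
        then show "real (rcount i) * real (rcount (n - i)) * (1/4)^n = ?a i * ?a (n - i)" by simp
      qed simp
      finally show ?thesis using 3 by simp
    qed auto
  qed
  have "(\<Sum>n\<le>Suc N. ?a n) \<le> (\<Sum>n\<le>Suc N. (if n = 1 then 1/4 else 0) + (\<Sum>i\<le>n. ?a i * ?a (n - i)))"
    by (intro sum_mono le)
  also have "\<dots> = 1/4 + (\<Sum>n\<le>Suc N. \<Sum>i\<le>n. ?a i * ?a (n - i))"
    by (simp add: sum.distrib)
  also have "(\<Sum>n\<le>Suc N. \<Sum>i\<le>n. ?a i * ?a (n - i)) = (\<Sum>(i,j)\<in>{(i,j). i + j \<le> Suc N}. ?a i * ?a j)"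
    by (rule sum.triangle_reindex_eq[symmetric])
  \<comment> \<open>Since \<open>rcount 0 = 0\<close>, both indices may be taken positive; then
    neither exceeds \<open>N\<close>, and the induction hypothesis applies to both factors.\<close>
  also have "\<dots> = (\<Sum>(i,j)\<in>{(i,j). i + j \<le> Suc N \<and> i > 0 \<and> j > 0}. ?a i * ?a j)"
  proof (rule sum.mono_neutral_right)
    show "finite {(i, j). i + j \<le> Suc N}"
      by (rule finite_subset[of _ "{..Suc N} \<times> {..Suc N}"]) auto
  qed (auto intro!: Nat.gr0I)
  also have "\<dots> \<le> (\<Sum>(i,j)\<in>{..N} \<times> {..N}. ?a i * ?a j)"
    by (intro sum_mono2) auto
  also have "\<dots> = (\<Sum>n\<le>N. ?a n) * (\<Sum>n\<le>N. ?a n)"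
    by (simp add: sum_product sum.cartesian_product)
  also have "\<dots> \<le> (1/2) * (1/2)"
    by (intro mult_mono Suc sum_nonneg) auto
  finally show ?case by simp
qed simp

section \<open>Forests, and the recurrence behind Polya's equation\<close>

definition mforests :: "nat \<Rightarrow> rtree multiset set" where
  "mforests n = {M. msz M = n}"

lemma bij_Node_mforests: "bij_betw Node (mforests n) (rtrees (Suc n))"
proof (rule bij_betwI')
  fix t assume "t \<in> rtrees (Suc n)"
  then show "\<exists>M\<in>mforests n. t = Node M" by (cases t) (auto simp: rtrees_def mforests_def)
qed (auto simp: mforests_def rtrees_def)

lemma card_mforests: "card (mforests n) = rcount (Suc n)"
  using bij_betw_same_card[OF bij_Node_mforests] by (simp add: rcount_def)

lemma finite_mforests [simp]: "finite (mforests n)"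
  using bij_betw_finite[OF bij_Node_mforests] by simp

lemma msz_replicate [simp]: "msz (replicate_mset j t) = j * sz t"
  by (simp add: msz_def)

lemma msz_eq_sum: "msz M = (\<Sum>t\<in>set_mset M. count M t * sz t)"
proof (induction M)
  case (add s M)
  have "(\<Sum>t\<in>set_mset (add_mset s M). count (add_mset s M) t * sz t)
      = (\<Sum>t\<in>insert s (set_mset M). count M t * sz t + (if t = s then sz t else 0))"
    by (intro sum.cong) auto
  also have "\<dots> = (\<Sum>t\<in>insert s (set_mset M). count M t * sz t) + sz s"
    by (simp add: sum.distrib)
  also have "(\<Sum>t\<in>insert s (set_mset M). count M t * sz t) = (\<Sum>t\<in>set_mset M. count M t * sz t)"
    by (intro sum.mono_neutral_right) (auto simp: not_in_iff)
  finally show ?case using add by simp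
qed simp

text \<open>Double count the triples of a forest, a tree t and a number j not exceeding the multiplicity of t
  in the forest: removing j copies of t is a bijection.\<close>
lemma rcount_recurrence:
  "n * rcount (Suc n) = (\<Sum>k=1..n. (\<Sum>d | d dvd k. d * rcount d) * rcount (Suc (n - k)))"
proof -
  let ?A = "SIGMA M:mforests n. SIGMA t:set_mset M. {1..count M t}"
  \<comment> \<open>\<open>k\<close> stands for the total size \<open>j * sz t\<close> of the
    removed copies and \<open>d\<close> for the size of one copy, so \<open>k div d\<close> recovers
    \<open>j\<close>.\<close>
  define D where "D = (SIGMA k:{1..n}. {d. d dvd k})"
  let ?B = "SIGMA kd:D. rtrees (snd kd) \<times> mforests (n - fst kd)"
  have finD: "finite D" unfolding D_def
    by (intro finite_SigmaI) (auto intro!: finite_divisors_nat)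
  have "n * rcount (Suc n) = (\<Sum>M\<in>mforests n. msz M)"
    by (simp add: card_mforests[symmetric] mforests_def mult.commute)
  also have "\<dots> = (\<Sum>M\<in>mforests n. \<Sum>t\<in>set_mset M. \<Sum>j=1..count M t. sz t)"
    by (intro sum.cong refl) (subst msz_eq_sum, simp)
  also have "\<dots> = (\<Sum>M\<in>mforests n. \<Sum>(t,j)\<in>(SIGMA t:set_mset M. {1..count M t}). sz t)"
    by (intro sum.cong refl sum.Sigma) auto
  also have "\<dots> = (\<Sum>(M,t,j)\<in>?A. sz t)"
    by (subst sum.Sigma) (auto simp: split_def)
  also have "\<dots> = (\<Sum>((k,d),t,N)\<in>?B. d)"
  proof (rule sum.reindex_bij_witness)
    let ?i = "\<lambda>((k,d),t,N). (N + replicate_mset (k div d) t, t, k div d)"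
    let ?j = "\<lambda>(M,t,j). ((j * sz t, sz t), t, M - replicate_mset j t)"
    fix a assume a: "a \<in> ?A"
    obtain M t j where [simp]: "a = (M,t,j)" by (cases a)
    have sub: "replicate_mset j t \<subseteq># M"
      using a by (auto simp: subseteq_mset_def)
    then have M: "M = (M - replicate_mset j t) + replicate_mset j t" by simp
    have "msz M = msz (M - replicate_mset j t) + j * sz t"
      by (subst M) (simp only: msz_simps msz_replicate)
    moreover have "msz M = n" using a by (auto simp: mforests_def)
    ultimately have n: "msz (M - replicate_mset j t) + j * sz t = n" by simp
    show "?i (?j a) = a" using sub by simp
    show "?j a \<in> ?B" using a n by (auto simp: D_def rtrees_def mforests_def Suc_le_eq)
    show "(case ?j a of (x, xa) \<Rightarrow> (case x of (k, d) \<Rightarrow> \<lambda>(t, N). d) xa) = (case a of (M, t, j) \<Rightarrow> sz t)" by simp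
  next
    let ?i = "\<lambda>((k,d),t,N). (N + replicate_mset (k div d) t, t, k div d)"
    let ?j = "\<lambda>(M,t,j). ((j * sz t, sz t), t, M - replicate_mset j t)"
    fix b assume b: "b \<in> ?B"
    obtain k d t N where [simp]: "b = ((k,d),t,N)" by (metis prod.exhaust)
    have "d dvd k" "d = sz t" "k \<ge> 1" "k \<le> n" "msz N = n - k"
      using b by (auto simp: D_def rtrees_def mforests_def)
    moreover from this have "k div d \<ge> 1"
      by (metis One_nat_def Suc_leI dvd_div_eq_0_iff gr0I not_one_le_zero)
    ultimately show "?i b \<in> ?A" "?j (?i b) = b"
      by (auto simp: mforests_def in_replicate_mset)
  qed
  also have "\<dots> = (\<Sum>(k,d)\<in>D. \<Sum>(t,N)\<in>rtrees d \<times> mforests (n - k). d)"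
    using finD by (subst sum.Sigma[symmetric]) (auto simp: split_def)
  also have "\<dots> = (\<Sum>(k,d)\<in>D. d * rcount d * rcount (Suc (n - k)))"
    by (simp add: split_def card_cartesian_product card_mforests rcount_def[symmetric] mult_ac)
  also have "\<dots> = (\<Sum>k=1..n. \<Sum>d | d dvd k. d * rcount d * rcount (Suc (n - k)))"
    unfolding D_def by (subst sum.Sigma) (auto intro!: finite_divisors_nat)
  finally show ?thesis by (simp add: sum_distrib_right)
qed

section \<open>Centroids\<close>

text \<open>As \<open>Node M\<close> has \<open>Suc (msz M)\<close> vertices, the inequality says
  that every branch has strictly fewer than half of them: the root is the unique centroid.\<close>

definition light_forest :: "rtree multiset \<Rightarrow> bool" where
  "light_forest M \<longleftrightarrow> (\<forall>s\<in>#M. 2 * sz s \<le> msz M)"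

text \<open>The canonical form of the unrooted tree underlying a rooted one: the tree rooted at its centroid,
  or the two halves if an edge splits it evenly. Rule heavy moves the root towards the centroid.\<close>
inductive key :: "rtree \<Rightarrow> rtree multiset \<Rightarrow> bool" where
  light: "light_forest M \<Longrightarrow> key (Node M) {#Node M#}"
| half: "sz s = Suc (msz M) \<Longrightarrow> key (Node (add_mset s M)) {#s, Node M#}"
| heavy: "msz M < msz N \<Longrightarrow> key (Node (add_mset (Node M) N)) k \<Longrightarrow> key (Node (add_mset (Node N) M)) k"

lemma msz_member_le: "s \<in># M \<Longrightarrow> sz s \<le> msz M"
  using sz_kid_less[of s M] by simp

text \<open>If the two branches differed, each would occur among the remaining branches of the
  other, and each would be smaller than the other.\<close>

lemma big_branch_unique:
  assumes "add_mset s M = add_mset s' M'" "msz M < sz s" "msz M' < sz s'"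
  shows "s = s'" "M = M'"
proof -
  show *: "s = s'"
  proof (rule ccontr)
    assume "s \<noteq> s'"
    then have "s' \<in># M" "s \<in># M'" using assms(1) by (metis insert_noteq_member)+
    then have "sz s' \<le> msz M" "sz s \<le> msz M'" by (simp_all add: msz_member_le)
    then show False using assms(2,3) by linarith
  qed
  show "M = M'" using assms(1) * by simp
qed

lemma light_not_big: "light_forest (add_mset s M) \<Longrightarrow> sz s \<le> msz M"
  by (simp add: light_forest_def)

lemma key_light:
  assumes "key (Node L) k" and "light_forest L"
  shows "k = {#Node L#}"
proof (rule key.cases[OF assms(1)])
  fix s M assume *: "Node L = Node (add_mset s M)" "sz s = Suc (msz M)"
  then have L_eq: "L = add_mset s M" by simp
  have "sz s \<le> msz M" using assms(2) L_eq light_not_big by blast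
  then show ?thesis using *(2) by linarith
next
  fix N M assume *: "Node L = Node (add_mset (Node N) M)" "msz M < msz N"
  then have L_eq: "L = add_mset (Node N) M" by simp
  have "sz (Node N) \<le> msz M" using assms(2) L_eq light_not_big by blast
  then show ?thesis using *(2) by simp
qed simp

lemma key_big:
  assumes "key (Node (add_mset s M)) k" "msz M < sz s"
  shows "if sz s = Suc (msz M) then k = {#s, Node M#} else key (Node (add_mset (Node M) (kids s))) k"
proof (rule key.cases[OF assms(1)])
  fix L assume L: "Node (add_mset s M) = Node L" "light_forest L"
  then have L_eq: "L = add_mset s M" by simp
  have "sz s \<le> msz M" using L(2) L_eq light_not_big by blast
  then show ?thesis using assms(2) by linarith
next
  fix s' M' assume *: "Node (add_mset s M) = Node (add_mset s' M')" "k = {#s', Node M'#}" "sz s' = Suc (msz M')"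
  then have eq: "add_mset s M = add_mset s' M'" and lt: "msz M' < sz s'" by simp_all
  have "s = s'" "M = M'" using big_branch_unique[OF eq assms(2) lt] .
  then show ?thesis using *(2,3) by simp
next
  fix M' N k' assume *: "Node (add_mset s M) = Node (add_mset (Node N) M')" "k = k'" "msz M' < msz N"
    "key (Node (add_mset (Node M') N)) k'"
  then have eq: "add_mset s M = add_mset (Node N) M'" and lt: "msz M' < sz (Node N)" by simp_all
  have "s = Node N" "M = M'" using big_branch_unique[OF eq assms(2) lt] .
  then show ?thesis using *(2-4) by simp
qed

lemma key_fun: "key t k \<Longrightarrow> key t k' \<Longrightarrow> k = k'"
proof (induction arbitrary: k' rule: key.induct)
  case (light M)
  show ?case by (rule key_light[OF light(2) light(1), symmetric])
next
  case (half s M)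
  have lt: "msz M < sz s" using half(1) by simp
  show ?case using key_big[OF half(2) lt] half(1) by simp
next
  case (heavy M N k)
  have lt: "msz M < sz (Node N)" using heavy(1) by simp
  have "key (Node (add_mset (Node M) N)) k'" using key_big[OF heavy(4) lt] heavy(1) by simp
  then show ?case by (rule heavy.IH)
qed

lemma branch_cases:
  obtains (light) "light_forest M"
  | (big) s N where "M = add_mset s N" "msz N < sz s"
proof (cases "light_forest M")
  case True
  then show ?thesis by (rule light)
next
  case False
  then obtain s where s: "s \<in># M" "msz M < 2 * sz s" by (auto simp: light_forest_def not_le)
  define N where "N = M - {#s#}"
  have M: "M = add_mset s N" using s(1) by (simp add: N_def)
  show ?thesis
  proof (rule big[OF M])
    show "msz N < sz s" using s(2) unfolding M by simp
  qed
qed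

text \<open>Moving the root into the heavy branch terminates: the side just left is too light to be
  the next heavy branch, so the next one lies inside the previous one and is strictly
  smaller.\<close>

lemma key_total: "\<exists>k. key t k"
proof -
  have heavy_key: "\<exists>k. key (Node (add_mset (Node N) M)) k" if "msz M < msz N" for M N
    using that
  proof (induction "msz N" arbitrary: M N rule: less_induct)
    case less
    have "\<exists>k. key (Node (add_mset (Node M) N)) k"
    proof (cases "add_mset (Node M) N" rule: branch_cases)
      case light
      then show ?thesis using key.light by blast
    next
      case (big s L)
      then obtain S where S: "s = Node S" by (cases s)
      have "s \<noteq> Node M"
      proof
        assume *: "s = Node M"
        then have "N = L" using big(1) by simp
        then show False using less.prems big(2) * by simp
      qed
      then have "s \<in># N" using big by (metis insert_noteq_member)
      then have *: "msz S < msz N" using msz_member_le[of s N] S by simp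
      show ?thesis
      proof (cases "sz s = Suc (msz L)")
        case True
        then show ?thesis using key.half big by metis
      next
        case False
        then have "msz L < msz S" using big S by simp
        then show ?thesis using less.hyps[OF *] big S by simp
      qed
    qed
    then show ?case using key.heavy less.prems by blast
  qed
  obtain M where M: "t = Node M" by (cases t)
  show ?thesis
  proof (cases M rule: branch_cases)
    case light
    then show ?thesis using key.light M by blast
  next
    case (big s N)
    then obtain S where S: "s = Node S" by (cases s)
    show ?thesis
    proof (cases "sz s = Suc (msz N)")
      case True
      then show ?thesis using key.half big M by metis
    next
      case False
      then show ?thesis using heavy_key[of N S] big S M by simp
    qed
  qed
qed

text \<open>The two rootings at the ends of an edge have the same key. If the sides differ in size,
  rule \<open>heavy\<close> derives one rooting from the other; if they agree, rule
  \<open>half\<close> gives both the same multiset of two halves.\<close>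

lemma key_reroot:
  assumes "key (Node (add_mset (Node N) M)) k"
  shows "key (Node (add_mset (Node M) N)) k"
proof -
  obtain k' where k': "key (Node (add_mset (Node M) N)) k'" using key_total by blast
  consider "msz M < msz N" | "msz N < msz M" | "msz N = msz M" by linarith
  then show ?thesis
  proof cases
    case 1
    then show ?thesis using key.heavy[OF 1 k'] key_fun assms k' by blast
  next
    case 2
    then show ?thesis using key.heavy[OF 2 assms] by simp
  next
    case 3
    have "key (Node (add_mset (Node N) M)) {#Node N, Node M#}"
      by (rule key.half) (simp only: sz_Node 3)
    then have k: "k = {#Node N, Node M#}" using assms key_fun by blast
    have "key (Node (add_mset (Node M) N)) {#Node M, Node N#}"
      by (rule key.half) (simp only: sz_Node 3)
    moreover have "{#Node M, Node N#} = {#Node N, Node M#}" by (rule add_mset_commute)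
    ultimately show ?thesis using k by metis
  qed
qed

definition light_trees :: "nat \<Rightarrow> rtree set" where
  "light_trees n = {t \<in> rtrees n. light_forest (kids t)}"

definition half_pairs :: "nat \<Rightarrow> rtree multiset set" where
  "half_pairs n = {{#s, t#} | s t. sz s = sz t \<and> sz s + sz t = n}"

definition keys :: "nat \<Rightarrow> rtree multiset set" where
  "keys n = (\<lambda>t. {#t#}) ` light_trees n \<union> half_pairs n"

lemma light_in_keys: "light_forest M \<Longrightarrow> {#Node M#} \<in> keys (sz (Node M))"
  by (simp add: keys_def light_trees_def rtrees_def)

lemma half_in_keys: "sz s = sz t \<Longrightarrow> {#s, t#} \<in> keys (sz s + sz t)"
  unfolding keys_def half_pairs_def by blast

lemma key_in_keys: "key t k \<Longrightarrow> k \<in> keys (sz t)"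
proof (induction rule: key.induct)
  case (light M)
  then show ?case by (rule light_in_keys)
next
  case (half s M)
  have "sz s = sz (Node M)" using half by simp
  from half_in_keys[OF this] show ?case by simp
next
  case (heavy M N k)
  have "sz (Node (add_mset (Node M) N)) = sz (Node (add_mset (Node N) M))" by simp
  with heavy.IH show ?case by metis
qed

lemma keys_realized:
  assumes "k \<in> keys n"
  shows "\<exists>t. sz t = n \<and> key t k"
  using assms unfolding keys_def
proof
  assume "k \<in> (\<lambda>t. {#t#}) ` light_trees n"
  then obtain t where t: "k = {#t#}" "sz t = n" "light_forest (kids t)"
    by (auto simp: light_trees_def rtrees_def)
  have "key (Node (kids t)) {#Node (kids t)#}" using t(3) by (rule key.light)
  then show ?thesis using t by (intro exI[of _ t]) simp
next
  assume "k \<in> half_pairs n"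
  then obtain s t where st: "k = {#s, t#}" "sz s = sz t" "sz s + sz t = n"
    by (auto simp: half_pairs_def)
  obtain M where M: "t = Node M" by (cases t)
  have "key (Node (add_mset s M)) {#s, Node M#}" using st(2) M by (intro key.half) simp
  moreover have "sz (Node (add_mset s M)) = n" using st(3) M by simp
  ultimately show ?thesis using st(1) M by blast
qed

lemma card_pair_multisets:
  "finite A \<Longrightarrow> 2 * card {{#s, t#} | s t. s \<in> A \<and> t \<in> A} = card A * card A + card A"
proof (induction rule: finite_induct)
  case (insert a A)
  let ?Q = "\<lambda>A. {{#s, t#} | s t. s \<in> A \<and> t \<in> A}"
  have eq: "?Q (insert a A) = ?Q A \<union> (\<lambda>t. {#a, t#}) ` insert a A"
    by (auto simp: add_mset_commute)
  have "?Q A = (\<lambda>(s,t). {#s, t#}) ` (A \<times> A)" by auto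
  then have fin: "finite (?Q A)" using insert by simp
  have "?Q A \<inter> (\<lambda>t. {#a, t#}) ` insert a A = {}"
    using insert by (auto simp: add_eq_conv_ex)
  then have "card (?Q (insert a A)) = card (?Q A) + card ((\<lambda>t. {#a, t#}) ` insert a A)"
    unfolding eq using fin insert by (intro card_Un_disjoint) auto
  also have "card ((\<lambda>t. {#a, t#}) ` insert a A) = Suc (card A)"
    using insert by (subst card_image) (auto simp: inj_on_def)
  finally show ?case using insert by (simp add: algebra_simps)
qed simp

text \<open>Otter's formula. A rooted tree fails to be light exactly when \<open>rjoin\<close> makes
  it from a pair whose first tree is at least as large as the second, and then from one such pair
  only. By symmetry twice the number of these pairs is the number of all ordered pairs plus that of
  the ties. The unordered pairs of equal size, which are the keys with a central edge, compensate
  for the ties up to the last summand.\<close>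

lemma card_keys:
  "2 * card (keys n) + (\<Sum>i\<le>n. rcount i * rcount (n - i)) =
     2 * rcount n + (if even n then rcount (n div 2) else 0)"
proof -
  define S where "S = {(s, t). sz s + sz t = n}"
  have S_eq: "S = (\<Union>i\<le>n. rtrees i \<times> rtrees (n - i))" by (auto simp: S_def rtrees_def)
  have finS: "finite S" unfolding S_eq by auto
  have card_S: "card S = (\<Sum>i\<le>n. rcount i * rcount (n - i))"
  proof -
    have "card S = (\<Sum>i\<le>n. card (rtrees i \<times> rtrees (n - i)))"
      unfolding S_eq
    proof (rule card_UN_disjoint)
      show "\<forall>i\<in>{..n}. \<forall>j\<in>{..n}. i \<noteq> j \<longrightarrow> rtrees i \<times> rtrees (n - i) \<inter> rtrees j \<times> rtrees (n - j) = {}"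
        by (auto simp: rtrees_def)
    qed auto
    then show ?thesis by (simp add: rcount_def card_cartesian_product)
  qed
  define G where "G = {(s, t). sz s + sz t = n \<and> sz s > sz t}"
  define L where "L = {(s, t). sz s + sz t = n \<and> sz s < sz t}"
  define Q where "Q = {(s, t). sz s + sz t = n \<and> sz s = sz t}"
  have fin: "finite G" "finite L" "finite Q"
    by (auto simp: G_def L_def Q_def S_def intro!: finite_subset[OF _ finS])
  have "S = (G \<union> Q) \<union> L" by (auto simp: S_def G_def Q_def L_def)
  then have "card S = card (G \<union> Q) + card L"
    using fin by (auto simp: G_def Q_def L_def intro!: card_Un_disjoint)
  moreover have GQ: "card (G \<union> Q) = card G + card Q"
    using fin by (intro card_Un_disjoint) (auto simp: G_def Q_def)
  moreover have "card L = card G"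
  proof -
    have "L = prod.swap ` G" by (auto simp: L_def G_def image_iff)
    then show ?thesis by (simp add: card_image)
  qed
  ultimately have 1: "card S + card Q = 2 * card (G \<union> Q)" by simp
  have "rtrees n - light_trees n = rjoin ` (G \<union> Q)"
  proof (intro equalityI subsetI)
    fix t assume t: "t \<in> rtrees n - light_trees n"
    then obtain M where M: "t = Node M" by (cases t)
    show "t \<in> rjoin ` (G \<union> Q)"
    proof (cases M rule: branch_cases)
      case light
      then show ?thesis using t M by (auto simp: light_trees_def)
    next
      case (big s N)
      then have "t = rjoin (s, Node N)" by (simp add: M rjoin_def)
      moreover have "(s, Node N) \<in> G \<union> Q"
        using t M big by (auto simp: rtrees_def G_def Q_def)
      ultimately show ?thesis by blast
    qed
  next
    fix t assume "t \<in> rjoin ` (G \<union> Q)"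
    then obtain s M where *: "t = rjoin (s, Node M)" "(s, Node M) \<in> G \<union> Q"
      by (metis imageE prod.exhaust rtree.collapse)
    have "\<not> sz s \<le> msz M" using * by (auto simp: G_def Q_def)
    then have "t \<notin> light_trees n" using light_not_big[of s M] * by (auto simp: light_trees_def rjoin_def)
    then show "t \<in> rtrees n - light_trees n" using * by (auto simp: rtrees_def G_def Q_def)
  qed
  moreover have "inj_on rjoin (G \<union> Q)"
  proof (rule inj_onI, clarify)
    fix s t s' t' assume *: "(s, t) \<in> G \<union> Q" "(s', t') \<in> G \<union> Q" "rjoin (s, t) = rjoin (s', t')"
    obtain M where M: "t = Node M" by (cases t)
    obtain M' where M': "t' = Node M'" by (cases t')
    have "add_mset s M = add_mset s' M'" using *(3) by (simp add: rjoin_def M M')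
    moreover have "msz M < sz s" "msz M' < sz s'" using *(1,2) by (auto simp: G_def Q_def M M')
    ultimately show "s = s' \<and> t = t'" using big_branch_unique M M' by metis
  qed
  ultimately have "card (rtrees n - light_trees n) = card (G \<union> Q)"
    by (metis card_image)
  moreover have sub: "light_trees n \<subseteq> rtrees n" by (auto simp: light_trees_def)
  ultimately have 2: "rcount n = card (light_trees n) + card (G \<union> Q)"
    unfolding rcount_def by (metis card_Diff_subset card_mono finite_rtrees finite_subset le_add_diff_inverse)
  have 3: "card Q = (if even n then rcount (n div 2) * rcount (n div 2) else 0)
        \<and> 2 * card (half_pairs n) = (if even n then rcount (n div 2) * rcount (n div 2) + rcount (n div 2) else 0)
        \<and> finite (half_pairs n)"
  proof (cases "even n")
    case True
    have "Q = rtrees (n div 2) \<times> rtrees (n div 2)"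
      using True by (auto simp: Q_def rtrees_def)
    moreover have hp: "half_pairs n = {{#s, t#} | s t. s \<in> rtrees (n div 2) \<and> t \<in> rtrees (n div 2)}"
      using True unfolding half_pairs_def rtrees_def by (auto, force+)
    moreover have "half_pairs n = (\<lambda>(s,t). {#s, t#}) ` (rtrees (n div 2) \<times> rtrees (n div 2))"
      unfolding hp by auto
    then have "finite (half_pairs n)" by simp
    ultimately show ?thesis using True card_pair_multisets[of "rtrees (n div 2)"]
      by (simp add: rcount_def card_cartesian_product)
  next
    case False
    then have "Q = {}" "half_pairs n = {}" by (auto simp: Q_def half_pairs_def)
    then show ?thesis using False by simp
  qed
  have "card (keys n) = card ((\<lambda>t. {#t#}) ` light_trees n) + card (half_pairs n)"
    unfolding keys_def using 3 finite_subset[OF sub]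
    by (intro card_Un_disjoint) (auto simp: half_pairs_def)
  also have "card ((\<lambda>t. {#t#}) ` light_trees n) = card (light_trees n)"
    by (rule card_image) (auto simp: inj_on_def)
  finally show ?thesis using 1 2 3 unfolding card_S[symmetric] by auto
qed

section \<open>Trees as graphs\<close>

text \<open>The tree with vertex set V and edge set F, rooted at v, has shape t.\<close>
inductive rep :: "'a set \<Rightarrow> 'a set set \<Rightarrow> 'a \<Rightarrow> rtree \<Rightarrow> bool" where
  rep_single: "rep {v} {} v (Node {#})"
| rep_join: "rep V1 F1 v (Node M) \<Longrightarrow> rep V2 F2 w s \<Longrightarrow> V1 \<inter> V2 = {} \<Longrightarrow>
    rep (V1 \<union> V2) (insert {v, w} (F1 \<union> F2)) v (Node (add_mset s M))"

lemma rep_root: "rep V F v t \<Longrightarrow> v \<in> V"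
  by (induction rule: rep.induct) auto

lemma rep_finite: "rep V F v t \<Longrightarrow> finite V"
  by (induction rule: rep.induct) auto

lemma rep_card: "rep V F v t \<Longrightarrow> card V = sz t"
proof (induction rule: rep.induct)
  case (rep_join V1 F1 v M V2 F2 w s)
  then have "card (V1 \<union> V2) = card V1 + card V2"
    by (intro card_Un_disjoint) (auto dest: rep_finite)
  then show ?case using rep_join by simp
qed simp

lemma rep_edges: "rep V F v t \<Longrightarrow> e \<in> F \<Longrightarrow> \<exists>a b. e = {a, b} \<and> a \<noteq> b \<and> a \<in> V \<and> b \<in> V"
proof (induction arbitrary: e rule: rep.induct)
  case (rep_join V1 F1 v M V2 F2 w s)
  have vw: "v \<in> V1" "w \<in> V2" using rep_root[OF rep_join.hyps(1)] rep_root[OF rep_join.hyps(2)] by auto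
  then have "v \<noteq> w" using rep_join(3) by auto
  from rep_join.prems consider "e = {v, w}" | "e \<in> F1" | "e \<in> F2" by auto
  then show ?case
  proof cases
    case 1 then show ?thesis using vw \<open>v \<noteq> w\<close> by auto
  next
    case 2 then show ?thesis using rep_join.IH(1) by blast
  next
    case 3 then show ?thesis using rep_join.IH(2) by blast
  qed
qed simp

lemma rep_edge_subset: "rep V F v t \<Longrightarrow> e \<in> F \<Longrightarrow> e \<subseteq> V"
  using rep_edges[of V F v t e] by auto

lemma rep_edgeD:
  assumes "rep V F v t" "{a, b} \<in> F"
  shows "a \<in> V \<and> b \<in> V \<and> a \<noteq> b"
proof -
  obtain c d where cd: "{a, b} = {c, d}" "c \<noteq> d" "c \<in> V" "d \<in> V"
    using rep_edges[OF assms] by blast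
  then consider "a = c" "b = d" | "a = d" "b = c" by (meson doubleton_eq_iff)
  then show ?thesis using cd(2-4) by cases simp_all
qed

text \<open>A derivation of \<open>rep\<close> attaches the branches in some order; any branch of
  the given shape can be moved to the last place.\<close>

lemma rep_split_child:
  assumes "rep V F v (Node (add_mset s M))"
  shows "\<exists>V1 F1 V2 F2 w. rep V1 F1 v (Node M) \<and> rep V2 F2 w s \<and> V1 \<inter> V2 = {} \<and>
    V = V1 \<union> V2 \<and> F = insert {v, w} (F1 \<union> F2)"
proof -
  have "\<exists>V1 F1 V2 F2 w. rep V1 F1 v (Node M) \<and> rep V2 F2 w s \<and> V1 \<inter> V2 = {} \<and>
    V = V1 \<union> V2 \<and> F = insert {v, w} (F1 \<union> F2)"
    if "rep V F v t" "t = Node (add_mset s M)" for t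
    using that
  proof (induction arbitrary: M rule: rep.induct)
    case (rep_join V1 F1 v M0 V2 F2 w s0)
    show ?case
    proof (cases "s = s0")
      case True
      then have "M = M0" using rep_join.prems by simp
      then show ?thesis using rep_join.hyps True by blast
    next
      case False
      then obtain M' where M': "M0 = add_mset s M'" "M = add_mset s0 M'"
        using rep_join.prems by (auto simp: add_eq_conv_ex)
      then obtain V11 F11 V12 F12 w' where *: "rep V11 F11 v (Node M')" "rep V12 F12 w' s"
          "V11 \<inter> V12 = {}" "V1 = V11 \<union> V12" "F1 = insert {v, w'} (F11 \<union> F12)"
        using rep_join.IH(1)[of M'] by auto
      have "rep (V11 \<union> V2) (insert {v, w} (F11 \<union> F2)) v (Node (add_mset s0 M'))"
        using * rep_join.hyps by (intro rep.rep_join) auto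
      moreover have "(V11 \<union> V2) \<inter> V12 = {}" "V1 \<union> V2 = V11 \<union> V2 \<union> V12"
        "insert {v, w} (F1 \<union> F2) = insert {v, w'} (insert {v, w} (F11 \<union> F2) \<union> F12)"
        using * rep_join.hyps by auto
      ultimately show ?thesis using *(2) M'(2) by metis
    qed
  qed simp
  then show ?thesis using assms by simp
qed

text \<open>The same rearrangement with the edge at the root prescribed instead of the shape of the
  branch.\<close>

lemma rep_split_edge:
  assumes "rep V F v t" "{v, w} \<in> F"
  shows "\<exists>V1 F1 V2 F2 s M. t = Node (add_mset s M) \<and> rep V1 F1 v (Node M) \<and> rep V2 F2 w s \<and>
    V1 \<inter> V2 = {} \<and> V = V1 \<union> V2 \<and> F = insert {v, w} (F1 \<union> F2)"
  using assms
proof (induction rule: rep.induct)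
  case (rep_join V1 F1 v M0 V2 F2 w0 s0)
  show ?case
  proof (cases "w = w0")
    case True
    then show ?thesis using rep_join.hyps by blast
  next
    case False
    have "v \<in> V1" using rep_join.hyps rep_root by metis
    then have "v \<notin> V2" using rep_join.hyps by auto
    then have "{v, w} \<notin> F2" using rep_edgeD[OF rep_join.hyps(2)] by blast
    moreover have "{v, w} \<noteq> {v, w0}" using False by (metis doubleton_eq_iff)
    ultimately have "{v, w} \<in> F1" using rep_join.prems by simp
    then obtain V11 F11 V12 F12 s M' where *: "Node M0 = Node (add_mset s M')" "rep V11 F11 v (Node M')" "rep V12 F12 w s"
          "V11 \<inter> V12 = {}" "V1 = V11 \<union> V12" "F1 = insert {v, w} (F11 \<union> F12)"
      using rep_join.IH(1) by metis
    have "rep (V11 \<union> V2) (insert {v, w0} (F11 \<union> F2)) v (Node (add_mset s0 M'))"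
      using * rep_join.hyps by (intro rep.rep_join) auto
    moreover have "(V11 \<union> V2) \<inter> V12 = {}" "V1 \<union> V2 = V11 \<union> V2 \<union> V12"
        "insert {v, w0} (F1 \<union> F2) = insert {v, w} (insert {v, w0} (F11 \<union> F2) \<union> F12)"
        "Node (add_mset s0 M0) = Node (add_mset s (add_mset s0 M'))"
      using * rep_join.hyps by auto
    ultimately show ?thesis using *(3) by metis
  qed
qed simp

text \<open>Connectedness of the tree, in a form that serves as an induction principle for
  properties passing along edges.\<close>

lemma rep_closed:
  assumes "rep V F v t" "v \<in> C" "\<And>a b. {a, b} \<in> F \<Longrightarrow> a \<in> C \<Longrightarrow> b \<in> C"
  shows "V \<subseteq> C"
  using assms
proof (induction rule: rep.induct)
  case (rep_join V1 F1 v M V2 F2 w s)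
  have "w \<in> C" using rep_join.prems(1) rep_join.prems(2)[of v w] by simp
  have "V1 \<subseteq> C" using rep_join.prems by (intro rep_join.IH(1)) auto
  moreover have "V2 \<subseteq> C" using \<open>w \<in> C\<close> rep_join.prems(2) by (intro rep_join.IH(2)) auto
  ultimately show ?case by simp
qed simp

text \<open>The joining edge meets both vertex sets, so the two edge sets can be read off from their
  union once the vertex sets are known.\<close>

lemma rep_edges_restrict:
  assumes "rep V1 F1 v t" "rep V2 F2 w s" "V1 \<inter> V2 = {}"
  shows "F1 = {e \<in> insert {v, w} (F1 \<union> F2). e \<subseteq> V1}" "F2 = {e \<in> insert {v, w} (F1 \<union> F2). e \<subseteq> V2}"
proof -
  have v: "v \<in> V1" "w \<in> V2" using rep_root[OF assms(1)] rep_root[OF assms(2)] by auto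
  have 1: "e \<subseteq> V1 \<and> \<not> e \<subseteq> V2" if "e \<in> F1" for e
    using rep_edges[OF assms(1) that] assms(3) by auto
  have 2: "e \<subseteq> V2 \<and> \<not> e \<subseteq> V1" if "e \<in> F2" for e
    using rep_edges[OF assms(2) that] assms(3) by auto
  have 3: "\<not> {v, w} \<subseteq> V1" "\<not> {v, w} \<subseteq> V2" using v assms(3) by auto
  show "F1 = {e \<in> insert {v, w} (F1 \<union> F2). e \<subseteq> V1}"
    using 1 2 3(1) by (intro subset_antisym subsetI) (simp, metis (no_types, lifting) Un_iff insert_iff mem_Collect_eq)
  show "F2 = {e \<in> insert {v, w} (F1 \<union> F2). e \<subseteq> V2}"
    using 1 2 3(2) by (intro subset_antisym subsetI) (simp, metis (no_types, lifting) Un_iff insert_iff mem_Collect_eq)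
qed

text \<open>The branch at \<open>w\<close> is the component of \<open>w\<close> after deleting the
  edge to \<open>v\<close>, which does not depend on the derivation. Using the lemma in both
  directions gives equality.\<close>

lemma rep_branch_subset:
  assumes "rep V1 F1 v t" "rep V2 F2 w s" "V1 \<inter> V2 = {}"
    and "rep V1' F1' v t'" "rep V2' F2' w s'" "V1' \<inter> V2' = {}"
    and "insert {v, w} (F1 \<union> F2) = insert {v, w} (F1' \<union> F2')"
  shows "V2 \<subseteq> V2'"
proof (rule rep_closed[OF assms(2)])
  show "w \<in> V2'" using assms(5) by (rule rep_root)
  fix a b assume ab: "{a, b} \<in> F2" "a \<in> V2'"
  have "v \<notin> V2" using assms(1,3) rep_root by fast
  moreover have "a \<in> V2" "b \<in> V2" using rep_edgeD[OF assms(2) ab(1)] by simp_all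
  ultimately have "v \<notin> {a, b}" by auto
  then have "{a, b} \<noteq> {v, w}" by (metis insertI1)
  moreover have "{a, b} \<in> insert {v, w} (F1' \<union> F2')"
    unfolding assms(7)[symmetric] using ab(1) by simp
  ultimately have "{a, b} \<in> F1' \<or> {a, b} \<in> F2'" by simp
  moreover have "{a, b} \<notin> F1'" using rep_edgeD[OF assms(4)] ab(2) assms(6) by blast
  ultimately show "b \<in> V2'" using rep_edgeD[OF assms(5)] by blast
qed

text \<open>Split both derivations at the same edge at the root: the branch beyond it has the same
  vertices in both, hence the same edges, and the induction hypotheses identify the shapes.\<close>

lemma rep_unique:
  assumes "rep V F v t" "rep V F v t'"
  shows "t = t'"
  using assms
proof (induction arbitrary: t' rule: rep.induct)
  case (rep_single v)
  obtain M where M: "t' = Node M" by (cases t')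
  have "card {v} = sz t'" using rep_single by (rule rep_card)
  then show ?case by (cases M) (simp_all add: M)
next
  case (rep_join V1 F1 v M V2 F2 w s)
  obtain V1' F1' V2' F2' s' M' where *: "t' = Node (add_mset s' M')" "rep V1' F1' v (Node M')"
    "rep V2' F2' w s'" "V1' \<inter> V2' = {}" "V1 \<union> V2 = V1' \<union> V2'"
    "insert {v, w} (F1 \<union> F2) = insert {v, w} (F1' \<union> F2')"
    using rep_split_edge[OF rep_join.prems, of w] by auto
  have V2: "V2 = V2'"
    using rep_branch_subset[OF rep_join.hyps *(2-4) *(6)] rep_branch_subset[OF *(2-4) rep_join.hyps *(6)[symmetric]]
    by simp
  then have V1: "V1 = V1'" using *(4,5) rep_join.hyps(3) by blast
  have F1: "F1 = F1'" using rep_edges_restrict(1)[OF rep_join.hyps] rep_edges_restrict(1)[OF *(2-4)] *(6) V1 by simp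
  have F2: "F2 = F2'" using rep_edges_restrict(2)[OF rep_join.hyps] rep_edges_restrict(2)[OF *(2-4)] *(6) V2 by simp
  have "Node M = Node M'" using *(2) V1 F1 by (intro rep_join.IH(1)) simp
  moreover have "s = s'" using *(3) V2 F2 by (intro rep_join.IH(2)) simp
  ultimately show ?case using *(1) by simp
qed

lemma rep_image:
  assumes "rep V F v t" "inj_on f V"
  shows "rep (f ` V) ((`) f ` F) (f v) t"
  using assms
proof (induction rule: rep.induct)
  case (rep_single v)
  then show ?case by (simp add: rep.rep_single)
next
  case (rep_join V1 F1 v M V2 F2 w s)
  have "inj_on f V1" "inj_on f V2" using rep_join.prems by (auto simp: inj_on_Un)
  moreover have "f ` V1 \<inter> f ` V2 = {}"
    using rep_join.prems rep_join.hyps(3) by (metis image_empty inj_on_image_Int sup_ge1 sup_ge2)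
  ultimately have "rep (f ` V1 \<union> f ` V2) (insert {f v, f w} ((`) f ` F1 \<union> (`) f ` F2)) (f v) (Node (add_mset s M))"
    using rep_join.IH by (intro rep.rep_join) auto
  then show ?case by (simp add: image_Un)
qed

lemma rep_single_iff: "rep V F v (Node {#}) \<longleftrightarrow> V = {v} \<and> F = {}"
proof
  assume "rep V F v (Node {#})"
  then show "V = {v} \<and> F = {}" by cases auto
qed (auto intro: rep.rep_single)

lemma rep_iso:
  assumes "rep V F v t" "rep V' F' v' t"
  shows "\<exists>f. bij_betw f V V' \<and> f v = v' \<and> F' = (`) f ` F"
  using assms
proof (induction arbitrary: V' F' v' rule: rep.induct)
  case (rep_single v)
  then show ?case by (intro exI[of _ "\<lambda>_. v'"]) (auto simp: rep_single_iff bij_betw_def)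
next
  case (rep_join V1 F1 v M V2 F2 w s)
  obtain V1' F1' V2' F2' w' where *: "rep V1' F1' v' (Node M)" "rep V2' F2' w' s" "V1' \<inter> V2' = {}"
    "V' = V1' \<union> V2'" "F' = insert {v', w'} (F1' \<union> F2')"
    using rep_split_child[OF rep_join.prems] by metis
  obtain f where f: "bij_betw f V1 V1'" "f v = v'" "F1' = (`) f ` F1" using rep_join.IH(1)[OF *(1)] by blast
  obtain g where g: "bij_betw g V2 V2'" "g w = w'" "F2' = (`) g ` F2" using rep_join.IH(2)[OF *(2)] by blast
  define h where "h x = (if x \<in> V1 then f x else g x)" for x
  have v: "v \<in> V1" "w \<in> V2" using rep_root[OF rep_join.hyps(1)] rep_root[OF rep_join.hyps(2)] by auto
  have h1: "h x = f x" if "x \<in> V1" for x using that by (simp add: h_def)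
  have h2: "h x = g x" if "x \<in> V2" for x using that rep_join.hyps(3) by (auto simp: h_def)
  have "bij_betw h V1 V1'" "bij_betw h V2 V2'"
    using f(1) g(1) h1 h2 bij_betw_cong[of V1 h f V1'] bij_betw_cong[of V2 h g V2'] by auto
  then have "bij_betw h (V1 \<union> V2) (V1' \<union> V2')" using *(3) by (rule bij_betw_combine)
  moreover have "h ` e = f ` e" if "e \<in> F1" for e
    using rep_edge_subset[OF rep_join.hyps(1) that] h1 by (intro image_cong) auto
  moreover have "h ` e = g ` e" if "e \<in> F2" for e
    using rep_edge_subset[OF rep_join.hyps(2) that] h2 by (intro image_cong) auto
  ultimately have "bij_betw h (V1 \<union> V2) V' \<and> h v = v' \<and> F' = (`) h ` insert {v, w} (F1 \<union> F2)"
    using v h1 h2 *(4,5) f g by (simp add: image_Un cong: image_cong)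
  then show ?case by blast
qed

lemma rep_leaf:
  assumes "rep V F v t" "x \<in> V" "y \<notin> V"
  shows "\<exists>t'. rep (insert y V) (insert {x, y} F) v t'"
  using assms
proof (induction rule: rep.induct)
  case (rep_single v)
  have "rep ({v} \<union> {y}) (insert {v, y} ({} \<union> {})) v (Node (add_mset (Node {#}) {#}))"
    using rep_single by (intro rep.rep_join rep.rep_single) auto
  then show ?case using rep_single by (auto simp: insert_commute)
next
  case (rep_join V1 F1 v M V2 F2 w s)
  show ?case
  proof (cases "x \<in> V1")
    case True
    then obtain t' where "rep (insert y V1) (insert {x, y} F1) v t'" using rep_join by auto
    then obtain M' where "rep (insert y V1) (insert {x, y} F1) v (Node M')" by (cases t') auto
    then have "rep (insert y V1 \<union> V2) (insert {v, w} (insert {x, y} F1 \<union> F2)) v (Node (add_mset s M'))"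
      using rep_join by (intro rep.rep_join) auto
    then show ?thesis by (auto simp: insert_commute)
  next
    case False
    then obtain s' where "rep (insert y V2) (insert {x, y} F2) w s'" using rep_join by auto
    then have "rep (V1 \<union> insert y V2) (insert {v, w} (F1 \<union> insert {x, y} F2)) v (Node (add_mset s' M))"
      using rep_join by (intro rep.rep_join) auto
    then show ?thesis by (auto simp: insert_commute)
  qed
qed

lemma rep_exists:
  assumes "finite V" "card V = sz t" "v \<in> V"
  shows "\<exists>F. rep V F v t"
  using assms
proof (induction t arbitrary: V v rule: rtree_join_induct)
  case single
  then have "V = {v}" by (auto simp: card_1_singleton_iff)
  then show ?case using rep.rep_single[of v] by auto
next
  case (join s M)
  have "sz s \<le> card (V - {v})" using join.prems by simp
  then obtain V2 where V2: "V2 \<subseteq> V - {v}" "card V2 = sz s" "finite V2" by (rule obtain_subset_with_card_n)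
  then have "V2 \<noteq> {}" using sz_pos[of s] by auto
  then obtain w where w: "w \<in> V2" by blast
  obtain F2 where F2: "rep V2 F2 w s" using join.IH(1)[OF V2(3,2) w] by blast
  have "card (V - V2) = sz (Node M)"
    using V2 join.prems by (subst card_Diff_subset) auto
  then obtain F1 where F1: "rep (V - V2) F1 v (Node M)"
    using join.IH(2)[of "V - V2" v] join.prems V2 by blast
  have "rep ((V - V2) \<union> V2) (insert {v, w} (F1 \<union> F2)) v (Node (add_mset s M))"
    using F1 F2 by (intro rep.rep_join) auto
  moreover have "(V - V2) \<union> V2 = V" using V2 by auto
  ultimately show ?case by metis
qed

lemma rep_swap_root:
  assumes "rep V F v (Node (add_mset (Node N) M))"
  shows "\<exists>w. rep V F w (Node (add_mset (Node M) N))"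
proof -
  obtain V1 F1 V2 F2 w where *: "rep V1 F1 v (Node M)" "rep V2 F2 w (Node N)" "V1 \<inter> V2 = {}"
    "V = V1 \<union> V2" "F = insert {v, w} (F1 \<union> F2)"
    using rep_split_child[OF assms] by metis
  have "rep (V2 \<union> V1) (insert {w, v} (F2 \<union> F1)) w (Node (add_mset (Node M) N))"
    using * by (intro rep.rep_join) auto
  moreover have "V2 \<union> V1 = V" "insert {w, v} (F2 \<union> F1) = F"
    using * by auto
  ultimately show ?thesis by metis
qed

lemma rep_key_neighbour:
  assumes "rep V F v t" "key t k" "{v, w} \<in> F"
  shows "\<exists>t'. rep V F w t' \<and> key t' k"
proof -
  obtain V1 F1 V2 F2 s M where *: "t = Node (add_mset s M)" "rep V1 F1 v (Node M)" "rep V2 F2 w s"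
    "V1 \<inter> V2 = {}" "V = V1 \<union> V2" "F = insert {v, w} (F1 \<union> F2)"
    using rep_split_edge[OF assms(1,3)] by metis
  obtain N where N: "s = Node N" by (cases s)
  have "rep (V2 \<union> V1) (insert {w, v} (F2 \<union> F1)) w (Node (add_mset (Node M) N))"
    using * N by (intro rep.rep_join) auto
  moreover have "V2 \<union> V1 = V" "insert {w, v} (F2 \<union> F1) = F"
    using * by auto
  moreover have "key (Node (add_mset (Node M) N)) k"
    using assms(2) key_reroot *(1) N by simp
  ultimately show ?thesis by metis
qed

text \<open>The key is an invariant of the unrooted tree: it is preserved along each edge by
  \<open>key_reroot\<close>, and the tree is connected.\<close>

lemma rep_key_any_root:
  assumes "rep V F v t" "key t k" "w \<in> V"
  shows "\<exists>t'. rep V F w t' \<and> key t' k"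
proof -
  have "V \<subseteq> {w. \<exists>t'. rep V F w t' \<and> key t' k}"
  proof (rule rep_closed[OF assms(1)])
    show "v \<in> {w. \<exists>t'. rep V F w t' \<and> key t' k}" using assms(1,2) by auto
    fix a b assume "{a, b} \<in> F" "a \<in> {w. \<exists>t'. rep V F w t' \<and> key t' k}"
    then show "b \<in> {w. \<exists>t'. rep V F w t' \<and> key t' k}" using rep_key_neighbour[of V F a _ k b] by auto
  qed
  then show ?thesis using assms(3) by blast
qed

text \<open>Following the rules towards the centroid leads to a root at which the key can be read
  off directly.\<close>

lemma rep_key_normal:
  assumes "key t k" "rep V F v t"
  shows "\<exists>v t. rep V F v t \<and> (k = {#t#} \<or> (\<exists>s M. t = Node (add_mset s M) \<and> k = {#s, Node M#}))"
  using assms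
proof (induction arbitrary: v rule: key.induct)
  case (heavy M N k)
  then obtain w where "rep V F w (Node (add_mset (Node M) N))"
    using rep_swap_root[of V F v N M] by auto
  then show ?case by (rule heavy.IH)
qed blast+

lemma rep_key_iso:
  assumes "rep V F v t" "rep V' F' v' t'" "key t k" "key t' k"
  shows "\<exists>f. bij_betw f V V' \<and> F' = (`) f ` F"
proof -
  obtain w u where w: "rep V F w u" "k = {#u#} \<or> (\<exists>s M. u = Node (add_mset s M) \<and> k = {#s, Node M#})"
    using rep_key_normal[OF assms(3,1)] by blast
  obtain w' u' where w': "rep V' F' w' u'" "k = {#u'#} \<or> (\<exists>s M. u' = Node (add_mset s M) \<and> k = {#s, Node M#})"
    using rep_key_normal[OF assms(4,2)] by blast
  have "\<exists>w'. rep V' F' w' u"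
    using w(2)
  proof
    assume k: "k = {#u#}"
    then have "u' = u" using w'(2) by auto
    then show ?thesis using w'(1) by blast
  next
    assume "\<exists>s M. u = Node (add_mset s M) \<and> k = {#s, Node M#}"
    then obtain s M where u: "u = Node (add_mset s M)" "k = {#s, Node M#}" by blast
    then obtain s' M' where u': "u' = Node (add_mset s' M')" "k = {#s', Node M'#}" using w'(2) by auto
    have "{#s, Node M#} = {#s', Node M'#}" using u(2) u'(2) by metis
    \<comment> \<open>The unordered halves may match crosswise; then the second tree is rerooted
      across its central edge.\<close>
    then consider "s = s'" "M = M'" | "s = Node M'" "s' = Node M"
      by (auto simp: add_eq_conv_ex)
    then show ?thesis
    proof cases
      case 1
      then show ?thesis using u u' w'(1) by blast
    next
      case 2
      then show ?thesis using rep_swap_root[of V' F' w' M M'] u(1) u'(1) w'(1) by simp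
    qed
  qed
  then obtain w'' where "rep V' F' w'' u" by blast
  from rep_iso[OF w(1) this] show ?thesis by blast
qed

text \<open>This excludes cycles, since every vertex of a cycle has two neighbours on it.\<close>
lemma rep_core:
  assumes "rep V F v t" "S \<subseteq> V"
    and "\<And>x. x \<in> S \<Longrightarrow> x \<noteq> v \<Longrightarrow> \<exists>a\<in>S. \<exists>b\<in>S. a \<noteq> b \<and> {x, a} \<in> F \<and> {x, b} \<in> F"
  shows "S \<subseteq> {v}"
  using assms
proof (induction arbitrary: S rule: rep.induct)
  case (rep_join V1 F1 v M V2 F2 w s)
  have v: "v \<in> V1" "w \<in> V2" using rep_root[OF rep_join.hyps(1)] rep_root[OF rep_join.hyps(2)] by auto
  let ?F = "insert {v, w} (F1 \<union> F2)"
  have in2: "{x, a} \<in> F2 \<or> (x = w \<and> a = v)" if "{x, a} \<in> ?F" "x \<in> V2" for x a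
  proof -
    have "{x, a} \<notin> F1" using that(2) rep_edgeD[OF rep_join.hyps(1)] rep_join.hyps(3) by blast
    then have "{x, a} = {v, w} \<or> {x, a} \<in> F2" using that(1) by simp
    then show ?thesis using that(2) v rep_join.hyps(3) by (metis doubleton_eq_iff disjoint_iff)
  qed
  have in1: "{x, a} \<in> F1 \<or> (x = v \<and> a = w)" if "{x, a} \<in> ?F" "x \<in> V1" for x a
  proof -
    have "{x, a} \<notin> F2" using that(2) rep_edgeD[OF rep_join.hyps(2)] rep_join.hyps(3) by blast
    then have "{x, a} = {v, w} \<or> {x, a} \<in> F1" using that(1) by simp
    then show ?thesis using that(2) v rep_join.hyps(3) by (metis doubleton_eq_iff disjoint_iff)
  qed
  have S2: "S \<inter> V2 \<subseteq> {w}"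
  proof (rule rep_join.IH(2))
    fix x assume x: "x \<in> S \<inter> V2" "x \<noteq> w"
    then have "x \<noteq> v" using v rep_join.hyps(3) by auto
    then obtain a b where ab: "a \<in> S" "b \<in> S" "a \<noteq> b" "{x, a} \<in> ?F" "{x, b} \<in> ?F"
      using rep_join.prems(2) x by blast
    have F2: "{x, a} \<in> F2" "{x, b} \<in> F2" using in2[OF ab(4)] in2[OF ab(5)] x by simp_all
    then have "a \<in> V2" "b \<in> V2" using rep_edgeD[OF rep_join.hyps(2)] by blast+
    then show "\<exists>a\<in>S \<inter> V2. \<exists>b\<in>S \<inter> V2. a \<noteq> b \<and> {x, a} \<in> F2 \<and> {x, b} \<in> F2"
      using F2 ab(1-3) by auto
  qed simp
  \<comment> \<open>Apart from \<open>w\<close> itself the branch contains nothing of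
    \<open>S\<close>, so the only possible neighbour of \<open>w\<close> in \<open>S\<close> is
    \<open>v\<close>, one too few.\<close>
  have "w \<notin> S"
  proof
    assume w: "w \<in> S"
    have "w \<noteq> v" using v rep_join.hyps(3) by auto
    then obtain a b where ab: "a \<in> S" "b \<in> S" "a \<noteq> b" "{w, a} \<in> ?F" "{w, b} \<in> ?F"
      using rep_join.prems(2)[OF w] by blast
    have only_v: "c = v" if "c \<in> S" "{w, c} \<in> ?F" for c
    proof (rule ccontr)
      assume "c \<noteq> v"
      then have "{w, c} \<in> F2" using in2[OF that(2) v(2)] by blast
      then have "c \<in> V2" "c \<noteq> w" using rep_edgeD[OF rep_join.hyps(2)] by blast+
      then show False using S2 that(1) by blast
    qed
    show False using only_v[OF ab(1,4)] only_v[OF ab(2,5)] ab(3) by simp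
  qed
  then have S1: "S \<subseteq> V1" using S2 rep_join.prems(1) by auto
  show ?case
  proof (rule rep_join.IH(1)[OF S1])
    fix x assume x: "x \<in> S" "x \<noteq> v"
    then obtain a b where ab: "a \<in> S" "b \<in> S" "a \<noteq> b" "{x, a} \<in> ?F" "{x, b} \<in> ?F"
      using rep_join.prems(2) by blast
    have "x \<in> V1" using x(1) S1 by auto
    then have "{x, a} \<in> F1" "{x, b} \<in> F1" using in1[OF ab(4)] in1[OF ab(5)] x(2) by simp_all
    then show "\<exists>a\<in>S. \<exists>b\<in>S. a \<noteq> b \<and> {x, a} \<in> F1 \<and> {x, b} \<in> F1"
      using ab(1-3) by auto
  qed
qed simp

lemma has_cycle_core:
  assumes "has_cycle T"
  shows "\<exists>S. S \<noteq> {} \<and> (\<forall>x\<in>S. \<exists>a\<in>S. \<exists>b\<in>S. a \<noteq> b \<and> {x, a} \<in> T \<and> {x, b} \<in> T)"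
proof -
  obtain vs where vs: "length vs \<ge> 3" "distinct vs"
    "\<And>i. i < length vs - 1 \<Longrightarrow> {vs ! i, vs ! (i + 1)} \<in> T" "{last vs, hd vs} \<in> T"
    using assms unfolding has_cycle_def by blast
  define L where "L = length vs"
  have L: "L \<ge> 3" using vs(1) by (simp add: L_def)
  define p where "p i = (if i = 0 then L - 1 else i - 1)" for i
  define s where "s i = (if i = L - 1 then 0 else i + 1)" for i
  have s_edge: "{vs ! i, vs ! s i} \<in> T" if "i < L" for i
  proof (cases "i = L - 1")
    case True
    have "vs \<noteq> []" using vs(1) by auto
    then have "last vs = vs ! (L - 1)" "hd vs = vs ! 0" by (simp_all add: L_def last_conv_nth hd_conv_nth)
    then show ?thesis using vs(4) True by (simp add: s_def)
  next
    case False
    then show ?thesis using vs(3)[of i] that by (simp add: s_def L_def)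
  qed
  have p_edge: "{vs ! i, vs ! p i} \<in> T" if "i < L" for i
  proof -
    have "p i < L" "s (p i) = i" using that L by (auto simp: p_def s_def)
    then show ?thesis using s_edge[of "p i"] by (simp add: insert_commute)
  qed
  have "\<exists>a\<in>set vs. \<exists>b\<in>set vs. a \<noteq> b \<and> {x, a} \<in> T \<and> {x, b} \<in> T" if x: "x \<in> set vs" for x
  proof -
    obtain i where "i < length vs" "vs ! i = x" using x by (auto simp: in_set_conv_nth)
    then have i: "i < L" "x = vs ! i" by (simp_all add: L_def)
    have sp: "s i < L" "p i < L" "s i \<noteq> p i" using i(1) L by (auto simp: p_def s_def)
    then have "vs ! s i \<noteq> vs ! p i" using vs(2) by (simp add: L_def nth_eq_iff_index_eq)
    moreover have "vs ! s i \<in> set vs" "vs ! p i \<in> set vs" using sp by (simp_all add: L_def)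
    ultimately show ?thesis using s_edge[OF i(1)] p_edge[OF i(1)] i(2) by blast
  qed
  moreover have "set vs \<noteq> {}" using vs(1) by auto
  ultimately show ?thesis by blast
qed

lemma rep_acyclic:
  assumes "rep V F v t"
  shows "\<not> has_cycle F"
proof
  assume "has_cycle F"
  then obtain S where S: "S \<noteq> {}" "\<And>x. x \<in> S \<Longrightarrow> \<exists>a\<in>S. \<exists>b\<in>S. a \<noteq> b \<and> {x, a} \<in> F \<and> {x, b} \<in> F"
    using has_cycle_core by meson
  have "S \<subseteq> V"
  proof
    fix x assume "x \<in> S"
    from S(2)[OF this] obtain a where "{x, a} \<in> F" by blast
    then show "x \<in> V" using rep_edgeD[OF assms] by blast
  qed
  then have "S \<subseteq> {v}" using S(2) by (rule rep_core[OF assms])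
  then show False using S by blast
qed

lemma rep_tree:
  assumes "rep {..<n} F v t"
  shows "is_tree_on n F"
proof -
  let ?R = "{(a, b). {a, b} \<in> F}"
  have sub: "{..<n} \<subseteq> {x. (v, x) \<in> ?R\<^sup>*}"
  proof (rule rep_closed[OF assms])
    fix a b assume ab: "{a, b} \<in> F" "a \<in> {x. (v, x) \<in> ?R\<^sup>*}"
    then have "(v, a) \<in> ?R\<^sup>*" "(a, b) \<in> ?R" by auto
    then show "b \<in> {x. (v, x) \<in> ?R\<^sup>*}" by (auto intro: rtrancl_into_rtrancl)
  qed simp
  have "sym ?R" by (auto simp: sym_def insert_commute)
  then have symR: "sym (?R\<^sup>*)" by (rule sym_rtrancl)
  have "(u, w) \<in> ?R\<^sup>*" if "u < n" "w < n" for u w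
  proof -
    have "(v, u) \<in> ?R\<^sup>*" "(v, w) \<in> ?R\<^sup>*" using sub that by auto
    then show ?thesis using symD[OF symR] by (meson rtrancl_trans)
  qed
  then have "connected_on n F" by (simp add: connected_on_def)
  moreover have "simple_graph_on n F"
    using rep_edges[OF assms] unfolding simple_graph_on_def by (meson lessThan_iff)
  ultimately show ?thesis using rep_acyclic[OF assms] by (simp add: is_tree_on_def)
qed

text \<open>The hypothesis on cuts is connectedness of the ambient graph. The last conjunct says
  that the original tree is induced by the larger one on \<open>W\<close>; through it an embedded
  tree is later recovered from a spanning tree and a vertex set.\<close>

lemma rep_grow:
  assumes "rep W F v t" "W \<subseteq> V" "finite V"
    and "\<And>X. v \<in> X \<Longrightarrow> X \<subset> V \<Longrightarrow> \<exists>x\<in>X. \<exists>y\<in>V - X. {x, y} \<in> E"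
  shows "\<exists>F' t'. rep V F' v t' \<and> F' \<subseteq> F \<union> E \<and> {e \<in> F'. e \<subseteq> W} = F"
  using assms(1,2)
proof (induction "card (V - W)" arbitrary: W F t)
  case 0
  then have "W = V" using assms(3) by auto
  then show ?case using 0 rep_edge_subset[of V F v t] by (intro exI[of _ F] exI[of _ t]) blast
next
  case (Suc k)
  have "W \<noteq> V" using Suc.hyps(2) by auto
  then have "W \<subset> V" using Suc.prems by auto
  then obtain x y where xy: "x \<in> W" "y \<in> V" "y \<notin> W" "{x, y} \<in> E"
    using assms(4)[of W] rep_root[OF Suc.prems(1)] by blast
  obtain t1 where t1: "rep (insert y W) (insert {x, y} F) v t1"
    using rep_leaf[OF Suc.prems(1) xy(1,3)] by blast
  have "V - W = insert y (V - insert y W)" using xy by auto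
  then have "k = card (V - insert y W)"
    using Suc.hyps(2) assms(3) by (metis Diff_iff card_insert_disjoint finite_Diff insertI1 nat.inject)
  then obtain F' t' where F': "rep V F' v t'" "F' \<subseteq> insert {x, y} F \<union> E" "{e \<in> F'. e \<subseteq> insert y W} = insert {x, y} F"
    using Suc.hyps(1)[OF _ t1] Suc.prems xy by blast
  have "{e \<in> F'. e \<subseteq> W} = {e \<in> insert {x, y} F. e \<subseteq> W}"
    unfolding F'(3)[symmetric] by auto
  also have "\<dots> = F" using xy(3) rep_edge_subset[OF Suc.prems(1)] by auto
  finally show ?case using F'(1,2) xy(4) by (intro exI[of _ F'] exI[of _ t']) auto
qed

section \<open>From connected acyclic graphs back to rooted trees\<close>

lemma simple_path:
  assumes "(a, b) \<in> {(x, y). {x, y} \<in> F}\<^sup>*"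
  shows "\<exists>vs. vs \<noteq> [] \<and> distinct vs \<and> hd vs = a \<and> last vs = b \<and> (\<forall>i < length vs - 1. {vs ! i, vs ! (i + 1)} \<in> F)"
  using assms
proof (induction rule: rtrancl_induct)
  case base
  show ?case by (intro exI[of _ "[a]"]) auto
next
  case (step y z)
  then obtain vs where vs: "vs \<noteq> []" "distinct vs" "hd vs = a" "last vs = y"
    "\<forall>i < length vs - 1. {vs ! i, vs ! (i + 1)} \<in> F" by blast
  show ?case
  proof (cases "z \<in> set vs")
    \<comment> \<open>A vertex already on the path: cut the path off there.\<close>
    case True
    then obtain i where i: "i < length vs" "vs ! i = z" by (auto simp: in_set_conv_nth)
    let ?ws = "take (Suc i) vs"
    have "last ?ws = z" using i by (simp add: take_Suc_conv_app_nth)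
    moreover have "?ws \<noteq> []" "distinct ?ws" "hd ?ws = a" using vs by auto
    moreover have "\<forall>j < length ?ws - 1. {?ws ! j, ?ws ! (j + 1)} \<in> F" using vs(5) i by auto
    ultimately show ?thesis by blast
  next
    case False
    let ?ws = "vs @ [z]"
    have "{?ws ! j, ?ws ! (j + 1)} \<in> F" if "j < length ?ws - 1" for j
    proof (cases "j < length vs - 1")
      case True
      then have "j < length vs" "Suc j < length vs" by simp_all
      then show ?thesis using vs(5) True by (simp add: nth_append)
    next
      case False
      then have "j = length vs - 1" using that vs(1) by auto
      then have "?ws ! j = y" "?ws ! (j + 1) = z" using vs(1,4) by (auto simp: nth_append last_conv_nth)
      then show ?thesis using step.hyps(2) by simp
    qed
    moreover have "?ws \<noteq> []" "distinct ?ws" "hd ?ws = a" "last ?ws = z" using vs False by auto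
    ultimately show ?thesis by blast
  qed
qed

lemma has_cycle_add_edge:
  assumes "(a, b) \<in> {(x, y). {x, y} \<in> F}\<^sup>*" "{a, b} \<notin> F" "a \<noteq> b" "F \<subseteq> T" "{a, b} \<in> T"
  shows "has_cycle T"
proof -
  obtain vs where vs: "vs \<noteq> []" "distinct vs" "hd vs = a" "last vs = b"
    "\<And>i. i < length vs - 1 \<Longrightarrow> {vs ! i, vs ! (i + 1)} \<in> F"
    using simple_path[OF assms(1)] by blast
  have ab: "vs ! 0 = a" "vs ! (length vs - 1) = b" using vs by (simp_all add: hd_conv_nth last_conv_nth)
  have "length vs \<noteq> 0" using vs(1) by simp
  moreover have "length vs \<noteq> 1" using ab assms(3) by auto
  moreover have "length vs \<noteq> 2"
  proof
    assume 2: "length vs = 2"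
    then show False using vs(5)[of 0] ab assms(2) by simp
  qed
  ultimately have "length vs \<ge> 3" by linarith
  moreover have "{last vs, hd vs} \<in> T" using vs(3,4) assms(5) by (simp add: insert_commute)
  ultimately show ?thesis unfolding has_cycle_def using vs(2,5) assms(4) by (intro exI[of _ vs]) blast
qed

text \<open>Grow a spanning tree inside \<open>T\<close> from the vertex 0. An edge of
  \<open>T\<close> outside it would close a cycle, so it is all of \<open>T\<close>.\<close>

lemma tree_rep:
  assumes "is_tree_on n T" "n \<ge> 1"
  shows "\<exists>t. rep {..<n} T 0 t"
proof -
  have simple: "simple_graph_on n T" and con: "connected_on n T" and acyc: "\<not> has_cycle T"
    using assms(1) by (auto simp: is_tree_on_def)
  have edge: "a < n \<and> b < n \<and> a \<noteq> b" if ab: "{a, b} \<in> T" for a b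
  proof -
    obtain u v where "{a, b} = {u, v}" "u \<noteq> v" "u < n" "v < n"
      using simple ab unfolding simple_graph_on_def by blast
    then show ?thesis by (metis doubleton_eq_iff)
  qed
  have ex: "\<exists>x\<in>X. \<exists>y\<in>{..<n} - X. {x, y} \<in> T" if X: "0 \<in> X" "X \<subset> {..<n}" for X
  proof (rule ccontr)
    assume no: "\<not> ?thesis"
    obtain z where z: "z < n" "z \<notin> X" using X by auto
    have "(0, z) \<in> {(a, b). {a, b} \<in> T}\<^sup>*" using con z assms(2) by (simp add: connected_on_def)
    then have "z \<in> X"
    proof (induction rule: rtrancl_induct)
      case (step y z)
      then show ?case using no edge[of y z] by auto
    qed (rule X)
    then show False using z by simp
  qed
  have "{0} \<subseteq> {..<n}" using assms(2) by auto
  then obtain F t where F: "rep {..<n} F 0 t" "F \<subseteq> {} \<union> T"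
    using rep_grow[OF rep.rep_single[of 0] _ _ ex] by blast
  have "connected_on n F" using rep_tree[OF F(1)] by (simp add: is_tree_on_def)
  have "T \<subseteq> F"
  proof (rule ccontr)
    assume "\<not> T \<subseteq> F"
    then obtain e where e: "e \<in> T" "e \<notin> F" by blast
    then obtain a b where ab: "e = {a, b}" "a < n" "b < n" "a \<noteq> b"
      using simple unfolding simple_graph_on_def by blast
    have "(a, b) \<in> {(x, y). {x, y} \<in> F}\<^sup>*"
      using \<open>connected_on n F\<close> ab by (simp add: connected_on_def)
    then have "has_cycle T"
      using e ab F(2) by (intro has_cycle_add_edge[of a b F T]) auto
    then show False using acyc by simp
  qed
  then have "F = T" using F(2) by auto
  then show ?thesis using F(1) by blast
qed

section \<open>Isomorphism classes and the key as a complete invariant\<close>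

lemma graph_iso_image:
  assumes "bij_betw f {..<n} {..<n}" "simple_graph_on n T" "T' = (`) f ` T"
  shows "graph_iso n T T'"
proof -
  have inj: "inj_on f {..<n}" using assms(1) by (rule bij_betw_imp_inj_on)
  have "{u, v} \<in> T" if "u < n" "v < n" "{f u, f v} \<in> T'" for u v
  proof -
    obtain e where e: "e \<in> T" "{f u, f v} = f ` e" using \<open>{f u, f v} \<in> T'\<close> assms(3) by blast
    obtain a b where "e = {a, b}" "a < n" "b < n"
      using e assms(2) unfolding simple_graph_on_def by blast
    then have "f ` {u, v} = f ` e" "{u, v} \<subseteq> {..<n}" "e \<subseteq> {..<n}" using e that by auto
    then have "{u, v} = e" using inj_on_image_eq_iff[OF inj] by blast
    then show ?thesis using e by simp
  qed
  moreover have "{f u, f v} \<in> T'" if "{u, v} \<in> T" for u v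
  proof -
    have "f ` {u, v} \<in> T'" unfolding assms(3) using that by (rule imageI)
    then show ?thesis by simp
  qed
  ultimately show ?thesis unfolding graph_iso_def using assms(1) by blast
qed

lemma graph_iso_imageD:
  assumes "graph_iso n T T'" "simple_graph_on n T" "simple_graph_on n T'"
  obtains f where "bij_betw f {..<n} {..<n}" "T' = (`) f ` T"
proof -
  obtain f where f: "bij_betw f {..<n} {..<n}" "\<And>u v. u < n \<Longrightarrow> v < n \<Longrightarrow> {u, v} \<in> T \<longleftrightarrow> {f u, f v} \<in> T'"
    using assms(1) unfolding graph_iso_def by blast
  have "T' = (`) f ` T"
  proof (intro equalityI subsetI)
    fix e assume e: "e \<in> T'"
    then obtain a b where ab: "e = {a, b}" "a < n" "b < n"
      using assms(3) unfolding simple_graph_on_def by blast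
    then obtain u v where uv: "u < n" "v < n" "a = f u" "b = f v"
      using f(1) by (metis bij_betw_def imageE lessThan_iff)
    then have "{u, v} \<in> T" using f(2) e ab by simp
    then have "f ` {u, v} \<in> (`) f ` T" by (rule imageI)
    then show "e \<in> (`) f ` T" using uv ab by simp
  next
    fix e assume "e \<in> (`) f ` T"
    then obtain e' where e': "e' \<in> T" "e = f ` e'" by blast
    then obtain a b where ab: "e' = {a, b}" "a < n" "b < n"
      using assms(2) unfolding simple_graph_on_def by blast
    then show "e \<in> T'" using e' f(2) by simp
  qed
  then show ?thesis using that f(1) by blast
qed

lemma graph_iso_refl: "graph_iso n T T"
  unfolding graph_iso_def by (intro exI[of _ id]) auto

lemma graph_iso_sym:
  assumes "graph_iso n T T'"
  shows "graph_iso n T' T"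
proof -
  obtain f where f: "bij_betw f {..<n} {..<n}" "\<And>u v. u < n \<Longrightarrow> v < n \<Longrightarrow> {u, v} \<in> T \<longleftrightarrow> {f u, f v} \<in> T'"
    using assms unfolding graph_iso_def by blast
  define g where "g = the_inv_into {..<n} f"
  have g: "bij_betw g {..<n} {..<n}" unfolding g_def using f(1) by (rule bij_betw_the_inv_into)
  have fg: "g u < n \<and> f (g u) = u" if "u < n" for u
    using that f(1) g unfolding g_def
    by (metis bij_betw_def bij_betwE f_the_inv_into_f_bij_betw lessThan_iff)
  have "{u, v} \<in> T' \<longleftrightarrow> {g u, g v} \<in> T" if "u < n" "v < n" for u v
    using fg[OF that(1)] fg[OF that(2)] f(2)[of "g u" "g v"] by simp
  then show ?thesis unfolding graph_iso_def using g by blast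
qed

lemma graph_iso_trans:
  assumes "graph_iso n T T'" "graph_iso n T' T''"
  shows "graph_iso n T T''"
proof -
  obtain f where f: "bij_betw f {..<n} {..<n}" "\<And>u v. u < n \<Longrightarrow> v < n \<Longrightarrow> {u, v} \<in> T \<longleftrightarrow> {f u, f v} \<in> T'"
    using assms unfolding graph_iso_def by blast
  obtain g where g: "bij_betw g {..<n} {..<n}" "\<And>u v. u < n \<Longrightarrow> v < n \<Longrightarrow> {u, v} \<in> T' \<longleftrightarrow> {g u, g v} \<in> T''"
    using assms unfolding graph_iso_def by blast
  have "f u < n" if "u < n" for u using f(1) that bij_betwE by blast
  then have "{u, v} \<in> T \<longleftrightarrow> {(g \<circ> f) u, (g \<circ> f) v} \<in> T''" if "u < n" "v < n" for u v
    using f(2)[OF that] g(2)[of "f u" "f v"] that by simp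
  then show ?thesis unfolding graph_iso_def using bij_betw_trans[OF f(1) g(1)] by blast
qed

lemma equiv_iso_rel: "equiv UNIV (iso_rel n)"
  unfolding iso_rel_def
proof (rule equivI)
  show "sym {(T, T'). graph_iso n T T'}" by (rule symI) (auto intro: graph_iso_sym)
  show "trans {(T, T'). graph_iso n T T'}" by (rule transI) (auto intro: graph_iso_trans)
qed (auto simp: refl_on_def graph_iso_refl)

definition tree_key :: "nat \<Rightarrow> nat set set \<Rightarrow> rtree multiset" where
  "tree_key n T = (SOME k. \<exists>v t. rep {..<n} T v t \<and> key t k)"

lemma tree_key_unique:
  assumes "rep {..<n} T v t" "key t k" "rep {..<n} T v' t'" "key t' k'"
  shows "k = k'"
proof -
  obtain t'' where "rep {..<n} T v' t''" "key t'' k"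
    using rep_key_any_root[OF assms(1,2) rep_root[OF assms(3)]] by blast
  then show ?thesis using rep_unique[OF assms(3)] key_fun assms(4) by blast
qed

lemma tree_key_eq:
  assumes "rep {..<n} T v t" "key t k"
  shows "tree_key n T = k"
  unfolding tree_key_def
  by (rule some_equality) (use assms tree_key_unique in blast)+

lemma tree_key_iso_iff:
  assumes "is_tree_on n T" "is_tree_on n T'" "n \<ge> 1"
  shows "graph_iso n T T' \<longleftrightarrow> tree_key n T = tree_key n T'"
proof -
  obtain t t' where t: "rep {..<n} T 0 t" "rep {..<n} T' 0 t'"
    using tree_rep assms by blast
  obtain k where k: "key t k" using key_total by blast
  obtain k' where k': "key t' k'" using key_total by blast
  have simple: "simple_graph_on n T" "simple_graph_on n T'" using assms by (auto simp: is_tree_on_def)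
  have keys: "tree_key n T = k" "tree_key n T' = k'" using tree_key_eq t k k' by blast+
  show ?thesis
  proof
    assume "graph_iso n T T'"
    then obtain f where f: "bij_betw f {..<n} {..<n}" "T' = (`) f ` T"
      using graph_iso_imageD simple by blast
    have "rep (f ` {..<n}) ((`) f ` T) (f 0) t"
      using f(1) by (intro rep_image t(1)) (simp add: bij_betw_def)
    then have "rep (f ` {..<n}) T' (f 0) t" using f(2) by simp
    then have "rep {..<n} T' (f 0) t" using f(1) by (simp add: bij_betw_def)
    then have "tree_key n T' = k" using tree_key_eq k by blast
    then show "tree_key n T = tree_key n T'" using keys by simp
  next
    assume "tree_key n T = tree_key n T'"
    then have "key t' k" using keys k' by simp
    then obtain f where "bij_betw f {..<n} {..<n}" "T' = (`) f ` T" using rep_key_iso[OF t k] by blast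
    then show "graph_iso n T T'" using graph_iso_image simple by blast
  qed
qed

text \<open>The isomorphism relation lives on arbitrary sets of edges, so a class may contain
  elements outside \<open>A\<close>. Only elements of \<open>A\<close> are compared by
  \<open>f\<close>, and each class is evaluated at a representative in \<open>A\<close>.\<close>

lemma card_quotient_eq_card_image:
  assumes "equiv UNIV r" "\<And>x y. x \<in> A \<Longrightarrow> y \<in> A \<Longrightarrow> (x, y) \<in> r \<longleftrightarrow> f x = f y"
  shows "card (A // r) = card (f ` A)"
proof -
  define g where "g X = f (SOME x. x \<in> A \<and> X = r `` {x})" for X
  have gx: "g (r `` {x}) = f x" if "x \<in> A" for x
  proof -
    let ?y = "SOME y. y \<in> A \<and> r `` {x} = r `` {y}"
    have "?y \<in> A \<and> r `` {x} = r `` {?y}" by (rule someI[of _ x]) (use that in blast)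
    then have "?y \<in> A" "(x, ?y) \<in> r" using eq_equiv_class[OF _ assms(1)] by blast+
    then show ?thesis unfolding g_def using assms(2)[OF that] by metis
  qed
  have "f ` A = g ` (A // r)"
    unfolding quotient_def using gx by (auto simp: image_iff)
  moreover have "inj_on g (A // r)"
  proof (rule inj_onI)
    fix X Y assume XY: "X \<in> A // r" "Y \<in> A // r" "g X = g Y"
    then obtain x y where xy: "x \<in> A" "X = r `` {x}" "y \<in> A" "Y = r `` {y}"
      by (auto elim!: quotientE)
    then have "(x, y) \<in> r" using XY(3) gx assms(2) by metis
    then show "X = Y" using xy equiv_class_eq[OF assms(1)] by blast
  qed
  ultimately show ?thesis by (metis card_image)
qed

lemma num_unlabelled_trees_eq_card_keys:
  assumes "n \<ge> 1"
  shows "num_unlabelled_trees n = card (keys n)"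
proof -
  have "num_unlabelled_trees n = card (tree_key n ` {T. is_tree_on n T})"
    unfolding num_unlabelled_trees_def
  proof (rule card_quotient_eq_card_image[OF equiv_iso_rel])
    fix T T' assume "T \<in> {T. is_tree_on n T}" "T' \<in> {T. is_tree_on n T}"
    then show "(T, T') \<in> iso_rel n \<longleftrightarrow> tree_key n T = tree_key n T'"
      using tree_key_iso_iff assms by (simp add: iso_rel_def)
  qed
  also have "tree_key n ` {T. is_tree_on n T} = keys n"
  proof (intro equalityI subsetI)
    fix k assume "k \<in> tree_key n ` {T. is_tree_on n T}"
    then obtain T where T: "is_tree_on n T" "k = tree_key n T" by blast
    obtain t where t: "rep {..<n} T 0 t" using tree_rep[OF T(1) assms] by blast
    obtain k' where k': "key t k'" using key_total by blast
    have "sz t = n" using rep_card[OF t] by simp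
    then show "k \<in> keys n" using tree_key_eq[OF t k'] T(2) key_in_keys[OF k'] by simp
  next
    fix k assume "k \<in> keys n"
    then obtain t where t: "sz t = n" "key t k" using keys_realized by blast
    obtain F where "rep {..<n} F 0 t" using rep_exists[of "{..<n}" t 0] t(1) assms by auto
    then show "k \<in> tree_key n ` {T. is_tree_on n T}"
      using rep_tree tree_key_eq t(2) by blast
  qed
  finally show ?thesis .
qed

lemma num_unlabelled_trees_formula:
  assumes "n \<ge> 1"
  shows "2 * num_unlabelled_trees n + (\<Sum>i\<le>n. rcount i * rcount (n - i)) =
     2 * rcount n + (if even n then rcount (n div 2) else 0)"
  using card_keys[of n] num_unlabelled_trees_eq_card_keys[OF assms] by simp

section \<open>Generating functions\<close>

lemma fps_linear_ode_unique:
  fixes Y Z a :: "'a :: field_char_0 fps"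
  assumes "fps_deriv Y = a * Y" "fps_deriv Z = a * Z" "fps_nth Y 0 = fps_nth Z 0"
  shows "Y = Z"
proof (rule fps_ext)
  fix n show "fps_nth Y n = fps_nth Z n"
  proof (induction n rule: less_induct)
    case (less n)
    show ?case
    proof (cases n)
      case (Suc m)
      have "of_nat (Suc m) * fps_nth Y (Suc m) = fps_nth (a * Y) m"
        unfolding assms(1)[symmetric] by simp
      also have "\<dots> = fps_nth (a * Z) m"
        unfolding fps_mult_nth using less Suc by (intro sum.cong) auto
      also have "\<dots> = of_nat (Suc m) * fps_nth Z (Suc m)"
        unfolding assms(2)[symmetric] by simp
      finally show ?thesis using Suc by (simp del: of_nat_Suc)
    qed (simp add: assms(3))
  qed
qed

lemma fps_compose_mult_nth:
  fixes a b c :: "'a :: comm_ring_1 fps"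
  assumes "fps_nth b 0 = 0"
  shows "fps_nth ((a oo b) * c) m = (\<Sum>k\<le>m. fps_nth a k * fps_nth (b ^ k * c) m)"
proof -
  have "fps_nth (a oo b) i = (\<Sum>k\<le>m. fps_nth a k * fps_nth (b ^ k) i)" if "i \<le> m" for i
    unfolding fps_compose_nth using that assms
    by (intro sum.mono_neutral_left) (auto simp: startsby_zero_power_prefix)
  then have "fps_nth ((a oo b) * c) m = (\<Sum>i=0..m. (\<Sum>k\<le>m. fps_nth a k * fps_nth (b ^ k) i) * fps_nth c (m - i))"
    unfolding fps_mult_nth by (intro sum.cong) auto
  also have "\<dots> = (\<Sum>k\<le>m. \<Sum>i=0..m. fps_nth a k * (fps_nth (b ^ k) i * fps_nth c (m - i)))"
    by (subst sum.swap) (simp add: sum_distrib_right mult.assoc)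
  also have "\<dots> = (\<Sum>k\<le>m. fps_nth a k * fps_nth (b ^ k * c) m)"
    by (simp add: fps_mult_nth sum_distrib_left)
  finally show ?thesis .
qed

lemma fps_deriv_exp_compose:
  fixes F :: "'a :: field_char_0 fps"
  assumes "fps_nth F 0 = 0"
  shows "fps_deriv (fps_exp c oo F) = fps_const c * (fps_exp c oo F) * fps_deriv F"
proof -
  have "fps_deriv (fps_exp c oo F) = (fps_deriv (fps_exp c) oo F) * fps_deriv F"
    using assms by (rule fps_compose_deriv)
  also have "fps_deriv (fps_exp c) oo F = fps_const c * (fps_exp c oo F)"
    unfolding fps_exp_deriv fps_compose_mult_distrib[OF assms] by simp
  finally show ?thesis .
qed

section \<open>Lagrange inversion for the tree function\<close>

definition cayley_inv :: "real fps" where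
  "cayley_inv = fps_X * fps_exp (-1)"

definition cayley :: "real fps" where
  "cayley = fps_inv cayley_inv"

lemma cayley_inv_nth [simp]: "fps_nth cayley_inv 0 = 0" "fps_nth cayley_inv (Suc 0) = 1"
  by (simp_all add: cayley_inv_def)

lemma cayley_nth_0 [simp]: "fps_nth cayley 0 = 0"
  by (simp add: cayley_def fps_inv_def)

lemma cayley_compose_inv: "cayley oo cayley_inv = fps_X"
  unfolding cayley_def by (rule fps_inv) simp_all

lemma inv_compose_cayley: "cayley_inv oo cayley = fps_X"
  unfolding cayley_def by (rule fps_inv_right) simp_all

text \<open>The two contributions j^j / j! and j^(j-1) / (j-1)! cancel. This isolates a single term
  in the Lagrange inversion below.\<close>

lemma one_minus_X_exp_nth:
  "fps_nth ((1 - fps_X) * fps_exp (real j)) j = (if j = 0 then 1 else 0)"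
proof (cases j)
  case (Suc i)
  have "fps_nth ((1 - fps_X) * fps_exp (real j)) j = real j ^ j / fact j - real j ^ i / fact i"
    unfolding Suc by (simp add: left_diff_distrib fps_X_mult_nth del: of_nat_Suc fact_Suc power_Suc)
  also have "\<dots> = 0"
  proof -
    have "fact j = real j * fact i" unfolding Suc by (rule fact_Suc)
    moreover have "real j ^ j = real j * real j ^ i" "real j \<noteq> 0" by (simp_all add: Suc)
    ultimately show ?thesis by simp
  qed
  finally show ?thesis using Suc by simp
qed simp

text \<open>Lagrange inversion: extract the coefficient of degree n - 1 from the derivative of
  cayley oo cayley_inv = X multiplied by exp (n X).\<close>
lemma cayley_nth:
  assumes "n \<ge> 1"
  shows "fps_nth cayley n = real n ^ (n - 1) / fact n"
proof -
  have deriv: "fps_deriv cayley_inv = (1 - fps_X) * fps_exp (-1)"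
    unfolding cayley_inv_def by (simp add: algebra_simps fps_const_neg[symmetric] del: fps_const_neg)
  have "fps_exp (real n) = fps_deriv (cayley oo cayley_inv) * fps_exp (real n)"
    unfolding cayley_compose_inv by simp
  also have "\<dots> = (fps_deriv cayley oo cayley_inv) * ((1 - fps_X) * (fps_exp (-1) * fps_exp (real n)))"
    by (simp add: fps_compose_deriv deriv mult_ac)
  also have "fps_exp (-1) * fps_exp (real n) = fps_exp (real n - 1)"
    by (simp add: fps_exp_add_mult[symmetric])
  finally have "fps_nth (fps_exp (real n)) (n - 1) =
      fps_nth ((fps_deriv cayley oo cayley_inv) * ((1 - fps_X) * fps_exp (real n - 1))) (n - 1)"
    by simp
  also have "\<dots> = (\<Sum>k\<le>n - 1. fps_nth (fps_deriv cayley) k *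
      fps_nth (cayley_inv ^ k * ((1 - fps_X) * fps_exp (real n - 1))) (n - 1))"
    by (rule fps_compose_mult_nth) simp
  \<comment> \<open>The term of index \<open>k\<close> involves coefficient n - 1 - k of (1 - X) exp
    ((n - 1 - k) X), which vanishes unless k = n - 1.\<close>
  also have "\<dots> = (\<Sum>k\<le>n - 1. if k = n - 1 then fps_nth (fps_deriv cayley) k else 0)"
  proof (rule sum.cong)
    fix k assume k: "k \<in> {..n - 1}"
    have "cayley_inv ^ k * ((1 - fps_X) * fps_exp (real n - 1)) =
        fps_X ^ k * ((1 - fps_X) * (fps_exp (- real k) * fps_exp (real n - 1)))"
      by (simp add: cayley_inv_def power_mult_distrib fps_exp_power_mult mult_ac)
    also have "fps_exp (- real k) * fps_exp (real n - 1) = fps_exp (real (n - 1 - k))"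
      using k assms by (simp add: fps_exp_add_mult[symmetric] of_nat_diff)
    finally have "fps_nth (cayley_inv ^ k * ((1 - fps_X) * fps_exp (real n - 1))) (n - 1)
        = (if n - 1 - k = 0 then 1 else 0)"
      using k by (simp only: fps_X_power_mult_nth one_minus_X_exp_nth) auto
    then show "fps_nth (fps_deriv cayley) k * fps_nth (cayley_inv ^ k * ((1 - fps_X) * fps_exp (real n - 1))) (n - 1)
        = (if k = n - 1 then fps_nth (fps_deriv cayley) k else 0)"
      using k by auto
  qed simp
  also have "\<dots> = real n * fps_nth cayley n" using assms by simp
  finally have "real n * fps_nth cayley n = real n ^ (n - 1) / fact (n - 1)" by simp
  moreover have "fact n = real n * fact (n - 1)" using assms by (simp add: fact_reduce)
  ultimately show ?thesis using assms by (simp add: field_simps)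
qed

definition cayley_unrooted :: "real fps" where
  "cayley_unrooted = cayley - fps_const (1/2) * cayley ^ 2"

text \<open>Differentiating W exp (-W) = X gives W = X W' (1 - W), and W' (1 - W) is the derivative
  of W - W^2 / 2. So coefficient n of W is n times that of \<open>cayley_unrooted\<close>.\<close>

lemma cayley_unrooted_nth:
  "fps_nth cayley_unrooted n = (if n = 0 then 0 else real n ^ (n - 1) / (real n * fact n))"
proof -
  let ?e = "fps_exp (-1) oo cayley"
  have e: "cayley * ?e = fps_X"
    using inv_compose_cayley unfolding cayley_inv_def by (simp add: fps_compose_mult_distrib)
  have "1 = fps_deriv (cayley * ?e)" unfolding e by simp
  also have "\<dots> = fps_deriv cayley * (1 - cayley) * ?e"
    by (simp add: fps_deriv_exp_compose algebra_simps fps_const_neg[symmetric] del: fps_const_neg)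
  finally have "cayley = fps_deriv cayley * (1 - cayley) * (cayley * ?e)"
    by (metis mult.assoc mult.commute mult.right_neutral)
  then have "cayley = fps_X * (fps_deriv cayley * (1 - cayley))" unfolding e by (simp add: mult_ac)
  also have "fps_deriv cayley * (1 - cayley) = fps_deriv cayley_unrooted"
  proof -
    have half: "fps_const (1/2) * (x + x) = x" for x :: "real fps" by (rule fps_ext) simp
    have "fps_deriv cayley_unrooted = fps_deriv cayley -
        fps_const (1/2) * (fps_deriv cayley * cayley + fps_deriv cayley * cayley)"
      by (simp add: cayley_unrooted_def power2_eq_square mult.commute)
    then show ?thesis unfolding half by (simp add: algebra_simps)
  qed
  finally have eq: "cayley = fps_X * fps_deriv cayley_unrooted" .
  have "fps_nth cayley n = fps_nth (fps_X * fps_deriv cayley_unrooted) n"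
    by (rule arg_cong[OF eq])
  also have "\<dots> = real n * fps_nth cayley_unrooted n" by (cases n) simp_all
  finally have "fps_nth cayley n = real n * fps_nth cayley_unrooted n" .
  then show ?thesis
    using cayley_nth[of n] by (cases "n = 0") (simp_all add: cayley_unrooted_def power2_eq_square field_simps)
qed

section \<open>Polya's functional equation\<close>

definition rooted_gf :: "real fps" where
  "rooted_gf = Abs_fps (\<lambda>n. real (rcount n))"

text \<open>The generating function of forests is the exponential of rooted_gf + euler_rest.\<close>
definition euler_rest :: "real fps" where
  "euler_rest = Abs_fps (\<lambda>k. real (\<Sum>d | d dvd k \<and> d < k. d * rcount d) / real k)"

text \<open>\<open>euler_rest\<close> is the sum of R (X^i) / i over i at least 2: in its
  coefficient k, a proper divisor d comes from i = k / d with weight d / k.\<close>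

definition kernel_gf :: "real fps" where
  "kernel_gf = fps_X * (fps_exp 1 oo euler_rest)"

lemma rooted_gf_nth [simp]: "fps_nth rooted_gf n = real (rcount n)"
  by (simp add: rooted_gf_def)

lemma euler_rest_nth_0 [simp]: "fps_nth euler_rest 0 = 0"
  by (simp add: euler_rest_def)

lemma kernel_gf_nth_0 [simp]: "fps_nth kernel_gf 0 = 0"
  by (simp add: kernel_gf_def)

text \<open>\<open>rcount_recurrence\<close> states that the forest series M satisfies M' = (R +
  \<open>euler_rest\<close>)' M, because k times coefficient k of R + \<open>euler_rest\<close> is
  the full divisor sum. Hence M exp (-R) and exp (\<open>euler_rest\<close>) solve the same linear
  differential equation with the same constant term.\<close>

lemma rooted_gf_equation: "cayley_inv oo rooted_gf = kernel_gf"
proof -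
  define M where "M = Abs_fps (\<lambda>n. real (rcount (Suc n)))"
  let ?e = "fps_exp (-1) oo rooted_gf"
  have R: "rooted_gf = fps_X * M"
    by (rule fps_ext) (simp add: M_def fps_X_mult_nth)
  have L: "real k * fps_nth (rooted_gf + euler_rest) k = real (\<Sum>d | d dvd k. d * rcount d)" if "k \<ge> 1" for k
  proof -
    have "{d. d dvd k} = insert k {d. d dvd k \<and> d < k}" using that by (auto dest: dvd_imp_le simp: nat_less_le)
    moreover have "finite {d. d dvd k \<and> d < k}" by simp
    ultimately have "(\<Sum>d | d dvd k. d * rcount d) = k * rcount k + (\<Sum>d | d dvd k \<and> d < k. d * rcount d)"
      by simp
    then show ?thesis using that by (simp add: euler_rest_def field_simps)
  qed
  have M': "fps_deriv M = fps_deriv (rooted_gf + euler_rest) * M"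
  proof (rule fps_ext)
    fix n
    have "fps_nth (fps_deriv (rooted_gf + euler_rest) * M) n =
        (\<Sum>i=0..n. real (\<Sum>d | d dvd Suc i. d * rcount d) * real (rcount (Suc (n - i))))"
      unfolding fps_mult_nth
    proof (rule sum.cong)
      fix i
      have "fps_nth (fps_deriv (rooted_gf + euler_rest)) i = real (\<Sum>d | d dvd Suc i. d * rcount d)"
        unfolding fps_deriv_nth using L[of "Suc i"] by simp
      then show "fps_nth (fps_deriv (rooted_gf + euler_rest)) i * fps_nth M (n - i) =
          real (\<Sum>d | d dvd Suc i. d * rcount d) * real (rcount (Suc (n - i)))"
        by (simp only: M_def fps_nth_Abs_fps)
    qed simp
    also have "\<dots> = real (\<Sum>i=0..n. (\<Sum>d | d dvd Suc i. d * rcount d) * rcount (Suc (Suc n - Suc i)))"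
      by simp
    also have "(\<Sum>i=0..n. (\<Sum>d | d dvd Suc i. d * rcount d) * rcount (Suc (Suc n - Suc i))) =
        (\<Sum>k=1..Suc n. (\<Sum>d | d dvd k. d * rcount d) * rcount (Suc (Suc n - k)))"
      by (subst sum.shift_bounds_cl_Suc_ivl[symmetric]) simp
    also have "\<dots> = Suc n * rcount (Suc (Suc n))" by (rule rcount_recurrence[symmetric])
    finally have "fps_nth (fps_deriv (rooted_gf + euler_rest) * M) n = real (Suc n * rcount (Suc (Suc n)))" .
    moreover have "fps_nth (fps_deriv M) n = real (Suc n * rcount (Suc (Suc n)))"
      by (simp add: M_def algebra_simps)
    ultimately show "fps_nth (fps_deriv M) n = fps_nth (fps_deriv (rooted_gf + euler_rest) * M) n"
      by (simp only:)
  qed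
  have "M * ?e = fps_exp 1 oo euler_rest"
  proof (rule fps_linear_ode_unique)
    have e': "fps_deriv ?e = - (?e * fps_deriv rooted_gf)"
      by (simp add: fps_deriv_exp_compose fps_const_neg[symmetric] del: fps_const_neg)
    show "fps_deriv (M * ?e) = fps_deriv euler_rest * (M * ?e)"
      by (simp add: e' M' algebra_simps)
    show "fps_deriv (fps_exp 1 oo euler_rest) = fps_deriv euler_rest * (fps_exp 1 oo euler_rest)"
      by (simp add: fps_deriv_exp_compose)
  qed (simp add: M_def)
  then have "rooted_gf * ?e = kernel_gf" by (simp add: R kernel_gf_def mult.assoc)
  then show ?thesis by (simp add: cayley_inv_def fps_compose_mult_distrib)
qed

lemma rooted_gf_eq_compose: "rooted_gf = cayley oo kernel_gf"
proof -
  have "cayley oo kernel_gf = (cayley oo cayley_inv) oo rooted_gf"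
    unfolding rooted_gf_equation[symmetric] by (rule fps_compose_assoc) simp_all
  then show ?thesis by (simp add: cayley_compose_inv)
qed

lemma unrooted_gf_eq_compose:
  "rooted_gf - fps_const (1/2) * rooted_gf ^ 2 = cayley_unrooted oo kernel_gf"
  by (simp add: cayley_unrooted_def fps_compose_sub_distrib fps_compose_mult_distrib power2_eq_square
      rooted_gf_eq_compose[symmetric])

lemma rcount_unrooted_formula:
  "real (rcount n) - (1/2) * real (\<Sum>i\<le>n. rcount i * rcount (n - i)) =
    (\<Sum>j\<le>n. fps_nth cayley_unrooted j * fps_nth (kernel_gf ^ j) n)"
proof -
  have "fps_nth (rooted_gf - fps_const (1/2) * rooted_gf ^ 2) n =
      real (rcount n) - (1/2) * real (\<Sum>i\<le>n. rcount i * rcount (n - i))"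
    by (simp add: power2_eq_square fps_mult_nth[of rooted_gf rooted_gf] atLeast0AtMost)
  then show ?thesis
    unfolding unrooted_gf_eq_compose by (simp add: fps_compose_nth atLeast0AtMost)
qed

section \<open>Powers of a probability generating function\<close>

lemma inverse_one_minus_fps_nth:
  fixes F :: "'a :: field fps"
  assumes "fps_nth F 0 = 0"
  shows "fps_nth (inverse (1 - F)) n = (\<Sum>j\<le>n. fps_nth (F ^ j) n)"
proof -
  have nz: "fps_nth (1 - F) 0 \<noteq> 0" using assms by simp
  have "(1 - F) * (\<Sum>j\<le>n. F ^ j) = 1 - F ^ Suc n"
    by (rule sum_gp_basic)
  then have "inverse (1 - F) * ((1 - F) * (\<Sum>j\<le>n. F ^ j)) = inverse (1 - F) * (1 - F ^ Suc n)" by simp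
  then have "(\<Sum>j\<le>n. F ^ j) = inverse (1 - F) - inverse (1 - F) * F ^ Suc n"
    using inverse_mult_eq_1[OF nz] by (simp add: mult.assoc[symmetric] right_diff_distrib)
  moreover have "fps_nth (inverse (1 - F) * F ^ Suc n) n = 0"
    unfolding fps_mult_nth using assms startsby_zero_power_prefix[of F "Suc n"]
    by (intro sum.neutral) (auto simp del: power_Suc)
  ultimately show ?thesis by (metis diff_zero fps_sub_nth fps_sum_nth)
qed

lemma fps_power_nth_of_real:
  "fps_nth (Abs_fps (\<lambda>k. complex_of_real (p k)) ^ j) n = complex_of_real (fps_nth (Abs_fps p ^ j) n)"
proof (induction j arbitrary: n)
  case (Suc j)
  then show ?case by (simp add: fps_mult_nth)
qed simp

lemma fps_power_nth_nonneg:
  fixes p :: "nat \<Rightarrow> real"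
  assumes "\<And>k. p k \<ge> 0"
  shows "fps_nth (Abs_fps p ^ j) n \<ge> 0"
proof (induction j arbitrary: n)
  case (Suc j)
  then show ?case using assms by (auto simp: fps_mult_nth intro!: sum_nonneg)
qed simp

lemma summable_le_radius:
  fixes p :: "nat \<Rightarrow> real"
  assumes "\<And>k. p k \<ge> 0" "summable (\<lambda>k. p k * r ^ k)" "0 \<le> y" "y \<le> r"
  shows "summable (\<lambda>k. p k * y ^ k)"
proof (rule summable_comparison_test'[OF assms(2), of 0])
  fix n show "norm (p n * y ^ n) \<le> p n * r ^ n"
    using assms by (simp add: abs_mult mult_left_mono power_mono)
qed

text \<open>Here 1 - F = (1 - X) Q, where Q is the series of the tail sums of \<open>p\<close>.
  Exponential tails make Q analytic beyond the unit disk, and it has no zero in the closed disk, so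
  1 / Q also converges beyond it. The sum over \<open>j\<close> is coefficient n of 1 / (1 - F),
  which is a partial sum of 1 / Q at 1; it tends to 1 / Q(1), the reciprocal of the mean.\<close>

theorem renewal_limit:
  fixes p :: "nat \<Rightarrow> real"
  assumes nonneg: "\<And>k. p k \<ge> 0" and p0: "p 0 = 0" and p1: "p 1 > 0"
    and r: "r > 1" "summable (\<lambda>k. p k * r ^ k)" and one: "p sums 1"
  shows "\<exists>L>0. (\<lambda>n. \<Sum>j\<le>n. fps_nth (Abs_fps p ^ j) n) \<longlonglongrightarrow> L"
proof -
  define q where "q n = 1 - (\<Sum>k\<le>n. p k)" for n
  define F where "F = Abs_fps (\<lambda>k. complex_of_real (p k))"
  define Q where "Q = Abs_fps (\<lambda>n. complex_of_real (q n))"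
  define s where "s = (1 + r) / 2"
  have s: "1 < s" "s < r" using r by (simp_all add: s_def)
  have q_tail: "q n = (\<Sum>k. p (k + Suc n))" for n
    using suminf_minus_initial_segment[OF sums_summable[OF one], of "Suc n"] sums_unique[OF one]
    by (simp add: q_def lessThan_Suc_atMost)
  have sum_tail: "summable (\<lambda>k. p (k + Suc n))" for n
    using sums_summable[OF one] summable_iff_shift[of p "Suc n"] by simp
  have sum_tail_r: "summable (\<lambda>k. p (k + Suc n) * r ^ (k + Suc n))" for n
    using r(2) summable_iff_shift[of "\<lambda>k. p k * r ^ k" "Suc n"] by simp
  have q_nonneg: "q n \<ge> 0" for n
    unfolding q_tail using nonneg sum_tail by (intro suminf_nonneg) auto
  define K where "K = (\<Sum>k. p k * r ^ k)"
  have qK: "q n * r ^ n \<le> K" for n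
  proof -
    have "q n * r ^ n = (\<Sum>k. p (k + Suc n) * r ^ n)"
      unfolding q_tail using sum_tail by (rule suminf_mult2)
    also have "\<dots> \<le> (\<Sum>k. p (k + Suc n) * r ^ (k + Suc n))"
    proof (rule suminf_le)
      fix k show "p (k + Suc n) * r ^ n \<le> p (k + Suc n) * r ^ (k + Suc n)"
        using nonneg r by (intro mult_left_mono power_increasing) auto
    qed (use sum_tail_r summable_mult2[OF sum_tail] in auto)
    also have "\<dots> = K - (\<Sum>k<Suc n. p k * r ^ k)"
      unfolding K_def by (rule suminf_minus_initial_segment[OF r(2)])
    also have "\<dots> \<le> K"
    proof -
      have "0 \<le> (\<Sum>k<Suc n. p k * r ^ k)" using nonneg r by (intro sum_nonneg) auto
      then show ?thesis by linarith
    qed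
    finally show ?thesis .
  qed
  have "summable (\<lambda>n. q n * s ^ n)"
  proof (rule summable_comparison_test'[of "\<lambda>n. K * (s / r) ^ n" 0])
    show "summable (\<lambda>n. K * (s / r) ^ n)" using s by (intro summable_mult summable_geometric) auto
    fix n
    have "q n * s ^ n = (q n * r ^ n) * (s / r) ^ n" using s by (simp add: power_divide)
    also have "\<dots> \<le> K * (s / r) ^ n" using qK s by (intro mult_right_mono) auto
    finally show "norm (q n * s ^ n) \<le> K * (s / r) ^ n" using q_nonneg s by simp
  qed
  then have "summable (\<lambda>n. complex_of_real (q n * s ^ n))" by (rule summable_of_real)
  then have "summable (\<lambda>n. fps_nth Q n * complex_of_real s ^ n)" by (simp add: Q_def)
  then have rQ: "fps_conv_radius Q \<ge> ereal s"
    unfolding fps_conv_radius_def using s by (drule_tac conv_radius_geI) simp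
  have "summable (\<lambda>n. complex_of_real (p n * r ^ n))" using r(2) by (rule summable_of_real)
  then have "summable (\<lambda>n. fps_nth F n * complex_of_real r ^ n)" by (simp add: F_def)
  then have rF: "fps_conv_radius F \<ge> ereal r"
    unfolding fps_conv_radius_def using r(1) by (drule_tac conv_radius_geI) simp
  have FQ: "1 - F = (1 - fps_X) * Q"
  proof (rule fps_ext)
    fix n show "fps_nth (1 - F) n = fps_nth ((1 - fps_X) * Q) n"
      by (cases n) (simp_all add: F_def Q_def q_def p0 left_diff_distrib)
  qed
  have nz: "eval_fps Q z \<noteq> 0" if z: "norm z \<le> 1" for z
  proof (cases "z = 1")
    case True
    have "(\<lambda>n. complex_of_real (q n)) sums eval_fps Q 1"
      using sums_eval_fps[of 1 Q] rQ s by (simp add: Q_def less_le_trans[of _ "ereal s"])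
    then have "q sums Re (eval_fps Q 1)" by (auto dest: sums_Re)
    then have "q 0 \<le> Re (eval_fps Q 1)"
      using sum_le_suminf[of q "{0}"] q_nonneg by (auto simp: sums_iff)
    then show ?thesis using True by (auto simp: q_def p0)
  next
    case False
    have zF: "ereal (norm z) < fps_conv_radius F" using z r by (intro less_le_trans[OF _ rF]) auto
    have zQ: "ereal (norm z) < fps_conv_radius Q" using z s by (intro less_le_trans[OF _ rQ]) auto
    have "(\<lambda>n. fps_nth F n * z ^ n) sums eval_fps F z"
      by (rule sums_eval_fps[OF zF])
    then have "(\<lambda>n. p n * Re (z ^ n)) sums Re (eval_fps F z)"
      by (auto simp: F_def dest: sums_Re)
    then have "(\<lambda>n. p n - p n * Re (z ^ n)) sums (1 - Re (eval_fps F z))"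
      using one by (intro sums_diff)
    then have "(\<lambda>n. p n * (1 - Re (z ^ n))) sums (1 - Re (eval_fps F z))"
      by (simp add: algebra_simps)
    moreover have "p n * (1 - Re (z ^ n)) \<ge> 0" for n
    proof -
      have "Re (z ^ n) \<le> norm (z ^ n)" by (rule complex_Re_le_cmod)
      also have "\<dots> \<le> 1" using z by (simp add: norm_power power_le_one)
      finally show ?thesis using nonneg by simp
    qed
    \<comment> \<open>All terms are nonnegative and the one of index 1 is positive when Re z < 1, so
      F cannot take the value 1 at z. This is where \<open>p 1 > 0\<close> excludes
      periodicity.\<close>
    ultimately have "p 1 * (1 - Re (z ^ 1)) \<le> 1 - Re (eval_fps F z)"
      using sum_le_suminf[of "\<lambda>n. p n * (1 - Re (z ^ n))" "{1}"] by (auto simp: sums_iff)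
    moreover have "Re z < 1"
    proof (rule ccontr)
      assume "\<not> Re z < 1"
      then have "Re z = 1" using z complex_Re_le_cmod[of z] by linarith
      moreover from this have "(Im z)\<^sup>2 \<le> 0"
        using z cmod_power2[of z] power_mono[OF z, of 2] by simp
      ultimately show False using False by (simp add: complex_eq_iff)
    qed
    moreover have "p 1 * (1 - Re z) > 0" using p1 \<open>Re z < 1\<close> by (intro mult_pos_pos) auto
    ultimately have "Re (eval_fps F z) < 1" by simp
    then have "eval_fps (1 - F) z \<noteq> 0"
      using zF by (subst eval_fps_diff) (auto simp: complex_eq_iff)
    moreover have "eval_fps (1 - F) z = eval_fps (1 - fps_X) z * eval_fps Q z"
      unfolding FQ using zQ by (intro eval_fps_mult less_le_trans[OF _ fps_conv_radius_diff]) auto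
    ultimately show ?thesis by auto
  qed
  \<comment> \<open>By compactness the zeros of Q in a slightly larger disk keep a positive distance
    from the unit disk.\<close>
  obtain R where R: "R > 1" "\<And>z. norm z < R \<Longrightarrow> eval_fps Q z \<noteq> 0"
  proof -
    define t where "t = (1 + s) / 2"
    have t: "1 < t" "t < s" using s by (simp_all add: t_def)
    define Z where "Z = {z \<in> cball 0 t. eval_fps Q z = 0}"
    have "continuous_on (cball 0 t) (eval_fps Q)"
    proof (rule continuous_on_subset[OF continuous_on_eval_fps])
      show "cball (0::complex) t \<subseteq> eball 0 (fps_conv_radius Q)"
      proof
        fix z :: complex assume "z \<in> cball 0 t"
        then have "ereal (norm z) < ereal s" using t by simp
        also have "\<dots> \<le> fps_conv_radius Q" by (rule rQ)
        finally show "z \<in> eball 0 (fps_conv_radius Q)" by (simp add: in_eball_iff)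
      qed
    qed
    then have "closed Z" unfolding Z_def
      using continuous_closed_preimage_constant[of "cball 0 t" "eval_fps Q" 0] by simp
    moreover have "bounded Z" unfolding Z_def by (rule bounded_subset[of "cball 0 t"]) auto
    ultimately have Z: "compact Z" by (simp add: compact_eq_bounded_closed)
    show ?thesis
    proof (cases "Z = {}")
      case True
      show ?thesis
      proof (rule that[OF t(1)])
        fix z :: complex assume "norm z < t"
        then show "eval_fps Q z \<noteq> 0" using True by (auto simp: Z_def)
      qed
    next
      case False
      obtain z0 where z0: "z0 \<in> Z" "\<And>z. z \<in> Z \<Longrightarrow> norm z0 \<le> norm z"
        using continuous_attains_inf[OF Z False, of norm] by (auto intro: continuous_intros)
      have "norm z0 > 1" using nz[of z0] z0(1) by (auto simp: Z_def not_le[symmetric])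
      then show ?thesis
      proof (rule that)
        fix z :: complex assume z: "norm z < norm z0"
        have "norm z0 \<le> t" using z0(1) by (simp add: Z_def)
        then show "eval_fps Q z \<noteq> 0" using z z0(2)[of z] by (auto simp: Z_def)
      qed
    qed
  qed
  have "min (ereal R) (fps_conv_radius Q) \<le> fps_conv_radius (inverse Q)"
    by (rule fps_conv_radius_inverse) (simp add: R)
  moreover have r1: "ereal (norm (1::complex)) < fps_conv_radius Q"
    using s by (intro less_le_trans[OF _ rQ]) auto
  moreover have "ereal (norm (1::complex)) < ereal R" using R(1) by simp
  ultimately have rI: "ereal (norm (1::complex)) < fps_conv_radius (inverse Q)"
    by (metis less_le_trans min_less_iff_conj)
  have "eval_fps (inverse Q) 1 = inverse (eval_fps Q 1)"
    using r1 R by (intro eval_fps_inverse[of R]) auto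
  then have sums_inv: "(\<lambda>n. fps_nth (inverse Q) n) sums inverse (eval_fps Q 1)"
    using sums_eval_fps[OF rI] by simp
  have "(\<lambda>n. complex_of_real (q n)) sums eval_fps Q 1"
    using sums_eval_fps[OF r1] by (simp add: Q_def)
  then have q_sums: "q sums Re (eval_fps Q 1)" "(\<lambda>n. 0) sums Im (eval_fps Q 1)"
    by (auto dest: sums_Re sums_Im)
  then have "Im (eval_fps Q 1) = 0" by (simp add: sums_iff)
  then have "eval_fps Q 1 = complex_of_real (Re (eval_fps Q 1))" by (simp add: complex_eq_iff)
  moreover define L where "L = inverse (Re (eval_fps Q 1))"
  ultimately have eL: "inverse (eval_fps Q 1) = complex_of_real L"
    by (metis of_real_inverse)
  have "q 0 \<le> Re (eval_fps Q 1)"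
    using sum_le_suminf[of q "{0}"] q_nonneg q_sums(1) by (auto simp: sums_iff)
  then have "L > 0" by (simp add: L_def q_def p0)
  have "fps_nth (inverse (1 - F)) n = (\<Sum>k\<le>n. fps_nth (inverse Q) k)" for n
  proof -
    have "inverse (1 - F) = inverse (1 - fps_X) * inverse Q"
      unfolding FQ by (rule fps_inverse_mult)
    also have "inverse (1 - fps_X) = Abs_fps (\<lambda>n. 1 :: complex)"
      by (metis fps_inverse_gp' fps_inverse_idempotent fps_nth_Abs_fps zero_neq_one)
    finally show ?thesis by (simp add: fps_mult_nth mult.commute[of "Abs_fps _"] atLeast0AtMost)
  qed
  then have "complex_of_real (\<Sum>j\<le>n. fps_nth (Abs_fps p ^ j) n) = (\<Sum>k\<le>n. fps_nth (inverse Q) k)" for n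
    using inverse_one_minus_fps_nth[of F n] by (simp add: F_def p0 fps_power_nth_of_real)
  moreover have "(\<lambda>n. \<Sum>k\<le>n. fps_nth (inverse Q) k) \<longlonglongrightarrow> complex_of_real L"
    using sums_inv unfolding eL sums_def_le .
  ultimately have "(\<lambda>n. complex_of_real (\<Sum>j\<le>n. fps_nth (Abs_fps p ^ j) n)) \<longlonglongrightarrow> complex_of_real L"
    by simp
  then show ?thesis using \<open>L > 0\<close> by (auto simp: tendsto_of_real_iff simp del: of_real_sum)
qed

section \<open>Exponential moment bounds\<close>

lemma partial_sum_fps_mult_le:
  fixes G K :: "real fps"
  assumes "\<And>n. fps_nth G n \<ge> 0" "\<And>n. fps_nth K n \<ge> 0" "x \<ge> 0"
  shows "(\<Sum>n\<le>N. fps_nth (G * K) n * x ^ n) \<le> (\<Sum>n\<le>N. fps_nth G n * x ^ n) * (\<Sum>n\<le>N. fps_nth K n * x ^ n)"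
proof -
  let ?a = "\<lambda>n::nat. fps_nth G n * x ^ n" and ?b = "\<lambda>n::nat. fps_nth K n * x ^ n"
  have "(\<Sum>n\<le>N. fps_nth (G * K) n * x ^ n) = (\<Sum>n\<le>N. \<Sum>i\<le>n. ?a i * ?b (n - i))"
    unfolding fps_mult_nth sum_distrib_right atLeast0AtMost
  proof (intro sum.cong refl)
    fix n i :: nat assume "i \<in> {..n}"
    then have "x ^ n = x ^ i * x ^ (n - i)" by (simp add: power_add[symmetric])
    then show "fps_nth G i * fps_nth K (n - i) * x ^ n = ?a i * ?b (n - i)" by simp
  qed
  also have "\<dots> = (\<Sum>(i,j)\<in>{(i,j). i + j \<le> N}. ?a i * ?b j)"
    by (rule sum.triangle_reindex_eq[symmetric])
  also have "\<dots> \<le> (\<Sum>(i,j)\<in>{..N} \<times> {..N}. ?a i * ?b j)"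
    using assms by (intro sum_mono2) (auto intro!: mult_nonneg_nonneg)
  also have "\<dots> = (\<Sum>n\<le>N. ?a n) * (\<Sum>n\<le>N. ?b n)"
    by (simp add: sum_product sum.cartesian_product)
  finally show ?thesis .
qed

lemma partial_sum_fps_power_le:
  fixes p :: "nat \<Rightarrow> real"
  assumes "\<And>k. p k \<ge> 0" "x \<ge> 0" "summable (\<lambda>k. p k * x ^ k)"
  shows "(\<Sum>n\<le>N. fps_nth (Abs_fps p ^ j) n * x ^ n) \<le> (\<Sum>k. p k * x ^ k) ^ j"
proof (induction j)
  case 0
  have "(\<Sum>n\<le>N. fps_nth (1 :: real fps) n * x ^ n) = (\<Sum>n\<le>N. if n = 0 then 1 else 0)"
    by (intro sum.cong) auto
  then show ?case by simp
next
  case (Suc j)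
  have "(\<Sum>n\<le>N. fps_nth (Abs_fps p ^ Suc j) n * x ^ n)
      \<le> (\<Sum>n\<le>N. fps_nth (Abs_fps p) n * x ^ n) * (\<Sum>n\<le>N. fps_nth (Abs_fps p ^ j) n * x ^ n)"
    unfolding power_Suc using assms fps_power_nth_nonneg by (intro partial_sum_fps_mult_le) auto
  also have "\<dots> \<le> (\<Sum>k. p k * x ^ k) * (\<Sum>k. p k * x ^ k) ^ j"
  proof (rule mult_mono)
    show "(\<Sum>n\<le>N. fps_nth (Abs_fps p) n * x ^ n) \<le> (\<Sum>k. p k * x ^ k)"
      using assms by (simp add: sum_le_suminf)
    show "0 \<le> (\<Sum>k. p k * x ^ k)" using assms by (simp add: suminf_nonneg)
    show "0 \<le> (\<Sum>n\<le>N. fps_nth (Abs_fps p ^ j) n * x ^ n)"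
      using assms fps_power_nth_nonneg by (auto intro!: sum_nonneg mult_nonneg_nonneg)
  qed (rule Suc)
  finally show ?case by simp
qed

text \<open>For a probability distribution \<open>p\<close> the coefficient is the probability that
  \<open>j\<close> independent steps add up to \<open>n\<close>, and this is the exponential Markov
  inequality.\<close>

lemma fps_power_nth_le:
  fixes p :: "nat \<Rightarrow> real"
  assumes "\<And>k. p k \<ge> 0" "x \<ge> 0" "summable (\<lambda>k. p k * x ^ k)"
  shows "fps_nth (Abs_fps p ^ j) n * x ^ n \<le> (\<Sum>k. p k * x ^ k) ^ j"
proof -
  have "fps_nth (Abs_fps p ^ j) n * x ^ n \<le> (\<Sum>n\<le>n. fps_nth (Abs_fps p ^ j) n * x ^ n)"
    using assms fps_power_nth_nonneg by (intro member_le_sum) (auto intro!: mult_nonneg_nonneg)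
  then show ?thesis using partial_sum_fps_power_le[OF assms] by (rule order_trans)
qed

lemma summable_fps_compose:
  fixes F :: "real fps" and p :: "nat \<Rightarrow> real"
  assumes "\<And>n. fps_nth F n \<ge> 0" "\<And>k. p k \<ge> 0" "x \<ge> 0"
    "summable (\<lambda>k. p k * x ^ k)" "summable (\<lambda>n. fps_nth F n * (\<Sum>k. p k * x ^ k) ^ n)"
  shows "summable (\<lambda>n. fps_nth (F oo Abs_fps p) n * x ^ n)"
proof (rule summableI_nonneg_bounded)
  have y: "0 \<le> (\<Sum>k. p k * x ^ k)" using assms by (simp add: suminf_nonneg)
  fix n show "0 \<le> fps_nth (F oo Abs_fps p) n * x ^ n"
    unfolding fps_compose_nth using assms fps_power_nth_nonneg
    by (auto intro!: mult_nonneg_nonneg sum_nonneg)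
  have "(\<Sum>i<n. fps_nth (F oo Abs_fps p) i * x ^ i) =
      (\<Sum>i<n. \<Sum>j\<le>i. fps_nth F j * (fps_nth (Abs_fps p ^ j) i * x ^ i))"
    by (simp add: fps_compose_nth sum_distrib_right mult.assoc atLeast0AtMost)
  also have "\<dots> \<le> (\<Sum>i<n. \<Sum>j\<le>n. fps_nth F j * (fps_nth (Abs_fps p ^ j) i * x ^ i))"
    using assms fps_power_nth_nonneg by (intro sum_mono sum_mono2) (auto intro!: mult_nonneg_nonneg)
  also have "\<dots> = (\<Sum>j\<le>n. fps_nth F j * (\<Sum>i<n. fps_nth (Abs_fps p ^ j) i * x ^ i))"
    by (subst sum.swap) (simp add: sum_distrib_left)
  also have "\<dots> \<le> (\<Sum>j\<le>n. fps_nth F j * (\<Sum>k. p k * x ^ k) ^ j)"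
  proof (intro sum_mono mult_left_mono assms(1))
    fix j
    have "(\<Sum>i<n. fps_nth (Abs_fps p ^ j) i * x ^ i) \<le> (\<Sum>i\<le>n. fps_nth (Abs_fps p ^ j) i * x ^ i)"
      using assms fps_power_nth_nonneg by (intro sum_mono2) (auto intro!: mult_nonneg_nonneg)
    then show "(\<Sum>i<n. fps_nth (Abs_fps p ^ j) i * x ^ i) \<le> (\<Sum>k. p k * x ^ k) ^ j"
      using partial_sum_fps_power_le[OF assms(2,3,4)] by (rule order_trans)
  qed
  also have "\<dots> \<le> (\<Sum>n. fps_nth F n * (\<Sum>k. p k * x ^ k) ^ n)"
    using assms y by (intro sum_le_suminf) auto
  finally show "(\<Sum>i<n. fps_nth (F oo Abs_fps p) i * x ^ i) \<le> (\<Sum>n. fps_nth F n * (\<Sum>k. p k * x ^ k) ^ n)" .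
qed

text \<open>For j = a n the bound of \<open>fps_power_nth_le\<close> reads exp (n psi(y)) with
  psi(y) = a ln f(y) - ln y. Since psi vanishes at 1, the sign of its derivative there decides on
  which side of 1 some y makes the bound exponentially small.\<close>

lemma exponential_tilt:
  fixes p :: "nat \<Rightarrow> real"
  assumes nonneg: "\<And>k. p k \<ge> 0" and r: "r > 1" "summable (\<lambda>k. p k * r ^ k)" and one: "p sums 1"
  defines "f \<equiv> \<lambda>y. \<Sum>k. p k * y ^ k" and "\<mu> \<equiv> \<Sum>k. diffs p k"
  shows "((\<lambda>y. a * ln (f y) - ln y) has_real_derivative (a * \<mu> - 1)) (at 1)" "f 1 = 1"
proof -
  show f1: "f 1 = 1" using one by (simp add: f_def sums_iff)
  have "(f has_real_derivative (\<Sum>k. diffs p k * 1 ^ k)) (at 1)"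
    unfolding f_def using r by (intro termdiffs_strong[of p r]) auto
  then have "(f has_real_derivative \<mu>) (at 1)" by (simp add: \<mu>_def)
  then show "((\<lambda>y. a * ln (f y) - ln y) has_real_derivative (a * \<mu> - 1)) (at 1)"
    using f1 by (auto intro!: derivative_eq_intros)
qed

text \<open>Too few steps to reach \<open>n\<close>: the derivative at 1 is negative, so a point
  just above 1 and inside the radius of convergence works. There ln f is nonnegative, which makes
  the bound monotone in \<open>j\<close> in the right direction.\<close>

lemma chernoff_below:
  fixes p :: "nat \<Rightarrow> real"
  assumes nonneg: "\<And>k. p k \<ge> 0" and r: "r > 1" "summable (\<lambda>k. p k * r ^ k)" and one: "p sums 1"
    and a: "a * (\<Sum>k. diffs p k) < 1" "a > 0"
  shows "\<exists>\<theta>. 0 < \<theta> \<and> \<theta> < 1 \<and> (\<forall>n j. real j \<le> a * real n \<longrightarrow> fps_nth (Abs_fps p ^ j) n \<le> \<theta> ^ n)"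
proof -
  define f where "f = (\<lambda>y. \<Sum>k. p k * y ^ k)"
  define \<psi> where "\<psi> = (\<lambda>y. a * ln (f y) - ln y)"
  have D: "(\<psi> has_real_derivative (a * (\<Sum>k. diffs p k) - 1)) (at 1)" and f1: "f 1 = 1"
    unfolding \<psi>_def f_def by (rule exponential_tilt[OF nonneg r one])+
  obtain d where d: "d > 0" "\<And>h. h > 0 \<Longrightarrow> h < d \<Longrightarrow> \<psi> (1 + h) < \<psi> 1"
    using DERIV_neg_dec_right[OF D] a by auto
  define h where "h = min d (r - 1) / 2"
  have h: "h > 0" "h < d" "1 + h < r" using d(1) r(1) by (auto simp: h_def min_def field_simps)
  define y where "y = 1 + h"
  have y: "y > 1" "y < r" using h by (simp_all add: y_def)
  have "\<psi> y < 0" using d(2)[OF h(1,2)] f1 by (simp add: y_def \<psi>_def)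
  have sm: "summable (\<lambda>k. p k * y ^ k)" using summable_le_radius[OF nonneg r(2)] y by simp
  have "f 1 \<le> f y" unfolding f_def
  proof (rule suminf_le)
    fix k show "p k * 1 ^ k \<le> p k * y ^ k" using nonneg y by (intro mult_left_mono power_mono) auto
  qed (use sm one in \<open>auto simp: sums_iff\<close>)
  then have fy: "f y \<ge> 1" using f1 by simp
  have "fps_nth (Abs_fps p ^ j) n \<le> exp (\<psi> y) ^ n" if j: "real j \<le> a * real n" for n j
  proof -
    have "fps_nth (Abs_fps p ^ j) n * y ^ n \<le> f y ^ j"
      unfolding f_def using y by (intro fps_power_nth_le nonneg sm) auto
    also have "f y ^ j = exp (real j * ln (f y))" using fy by (simp add: exp_of_nat_mult)
    also have "\<dots> \<le> exp (a * real n * ln (f y))" using j fy by (simp add: mult_right_mono)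
    also have "\<dots> = exp (real n * \<psi> y + real n * ln y)" by (simp add: \<psi>_def algebra_simps)
    also have "\<dots> = exp (\<psi> y) ^ n * y ^ n" using y by (simp add: exp_add exp_of_nat_mult)
    finally show ?thesis using y by simp
  qed
  then show ?thesis using \<open>\<psi> y < 0\<close> by (intro exI[of _ "exp (\<psi> y)"]) auto
qed

text \<open>Too many steps: now a point just below 1 works, where ln f is at most 0. Positivity of
  \<open>p 1\<close> keeps f positive there, so that its logarithm makes sense.\<close>

lemma chernoff_above:
  fixes p :: "nat \<Rightarrow> real"
  assumes nonneg: "\<And>k. p k \<ge> 0" and p1: "p 1 > 0" and r: "r > 1" "summable (\<lambda>k. p k * r ^ k)" and one: "p sums 1"
    and a: "a * (\<Sum>k. diffs p k) > 1" "a > 0"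
  shows "\<exists>\<theta>. 0 < \<theta> \<and> \<theta> < 1 \<and> (\<forall>n j. real j \<ge> a * real n \<longrightarrow> fps_nth (Abs_fps p ^ j) n \<le> \<theta> ^ n)"
proof -
  define f where "f = (\<lambda>y. \<Sum>k. p k * y ^ k)"
  define \<psi> where "\<psi> = (\<lambda>y. a * ln (f y) - ln y)"
  have D: "(\<psi> has_real_derivative (a * (\<Sum>k. diffs p k) - 1)) (at 1)" and f1: "f 1 = 1"
    unfolding \<psi>_def f_def by (rule exponential_tilt[OF nonneg r one])+
  obtain d where d: "d > 0" "\<And>h. h > 0 \<Longrightarrow> h < d \<Longrightarrow> \<psi> (1 - h) < \<psi> 1"
    using DERIV_pos_inc_left[OF D] a by auto
  define h where "h = min d 1 / 2"
  have h: "h > 0" "h < d" "h < 1" using d(1) by (auto simp: h_def min_def)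
  define y where "y = 1 - h"
  have y: "y > 0" "y < 1" using h by (simp_all add: y_def)
  have "\<psi> y < 0" using d(2)[OF h(1,2)] f1 by (simp add: y_def \<psi>_def)
  have sm: "summable (\<lambda>k. p k * y ^ k)" using summable_le_radius[OF nonneg r(2)] y r(1) by simp
  have "f y \<le> f 1" unfolding f_def
  proof (rule suminf_le)
    fix k show "p k * y ^ k \<le> p k * 1 ^ k" using nonneg y by (intro mult_left_mono power_mono) auto
  qed (use sm one in \<open>auto simp: sums_iff\<close>)
  then have fy: "f y \<le> 1" using f1 by simp
  have "(\<Sum>k\<in>{1}. p k * y ^ k) \<le> f y"
    unfolding f_def using sm nonneg y by (intro sum_le_suminf) auto
  moreover have "p 1 * y > 0" using p1 y by (intro mult_pos_pos)
  ultimately have fy0: "f y > 0" by simp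
  have "fps_nth (Abs_fps p ^ j) n \<le> exp (\<psi> y) ^ n" if j: "real j \<ge> a * real n" for n j
  proof -
    have "fps_nth (Abs_fps p ^ j) n * y ^ n \<le> f y ^ j"
      unfolding f_def using y by (intro fps_power_nth_le nonneg sm) auto
    also have "f y ^ j = exp (real j * ln (f y))" using fy0 by (simp add: exp_of_nat_mult)
    also have "\<dots> \<le> exp (a * real n * ln (f y))" using j fy fy0 by (simp add: mult_right_mono_neg)
    also have "\<dots> = exp (real n * \<psi> y + real n * ln y)" by (simp add: \<psi>_def algebra_simps)
    also have "\<dots> = exp (\<psi> y) ^ n * y ^ n" using y by (simp add: exp_add exp_of_nat_mult)
    finally show ?thesis using y by simp
  qed
  then show ?thesis using \<open>\<psi> y < 0\<close> by (intro exI[of _ "exp (\<psi> y)"]) auto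
qed

text \<open>The weights of the powers concentrate on exponents close to n / m, where m is the mean of p,
  and their total mass converges by the renewal theorem.\<close>
theorem critical_composition_limit:
  fixes p v :: "nat \<Rightarrow> real"
  assumes nonneg: "\<And>k. p k \<ge> 0" and p0: "p 0 = 0" and p1: "p 1 > 0"
    and r: "r > 1" "summable (\<lambda>k. p k * r ^ k)" and one: "p sums 1"
    and v: "(\<lambda>j. v j * real j powr (5/2)) \<longlonglongrightarrow> c" "c > 0" and vB: "\<And>j. \<bar>v j\<bar> \<le> B"
  shows "\<exists>C>0. (\<lambda>n. real n powr (5/2) * (\<Sum>j\<le>n. v j * fps_nth (Abs_fps p ^ j) n)) \<longlonglongrightarrow> C"
proof -
  define w where "w j n = fps_nth (Abs_fps p ^ j) n" for j n
  define \<mu> where "\<mu> = (\<Sum>k. diffs p k)"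
  obtain L where L: "L > 0" "(\<lambda>n. \<Sum>j\<le>n. w j n) \<longlonglongrightarrow> L"
    unfolding w_def using renewal_limit[OF nonneg p0 p1 r one] by blast
  have w: "w j n \<ge> 0" for j n unfolding w_def using nonneg by (rule fps_power_nth_nonneg)
  have "summable (\<lambda>n. diffs p n * 1 ^ n)"
  proof (rule termdiff_converges)
    show "norm (1::real) < r" using r(1) by simp
    show "summable (\<lambda>n. p n * x ^ n)" if "norm x < r" for x
      using that r(1) by (intro powser_inside[OF r(2)]) auto
  qed
  then have "summable (diffs p)" by simp
  then have "\<mu> \<ge> diffs p 0"
    unfolding \<mu>_def using sum_le_suminf[of "diffs p" "{0}"] nonneg by (simp add: diffs_def)
  then have \<mu>: "\<mu> > 0" using p1 by (simp add: diffs_def)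
  \<comment> \<open>For \<open>j\<close> near n / mean the weight v j is about c j^(-5/2), so
    n^(5/2) v j is about this constant.\<close>
  define K where "K = c * \<mu> powr (5/2)"
  have K: "K > 0" using v(2) \<mu> by (simp add: K_def)
  define S where "S n = (\<Sum>j\<le>n. (real n powr (5/2) * v j - K) * w j n)" for n
  have "S \<longlonglongrightarrow> 0"
  proof (rule LIMSEQ_I)
    fix \<eta>' :: real assume "\<eta>' > 0"
    \<comment> \<open>The total mass is eventually below \<open>L + 1\<close>, so an error of this
      size per unit of mass costs at most half of the allowance; the other half is left for the
      tails.\<close>
    define \<eta> where "\<eta> = \<eta>' / (2 * (L + 1))"
    have \<eta>: "\<eta> > 0" using \<open>\<eta>' > 0\<close> L by (simp add: \<eta>_def)
    have "((\<lambda>xz. fst xz * snd xz powr (5/2)) \<longlongrightarrow> K) (nhds (c, \<mu>))"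
    proof -
      have "((\<lambda>xz. fst xz) \<longlongrightarrow> fst (c, \<mu>)) (nhds (c, \<mu>))" "((\<lambda>xz. snd xz) \<longlongrightarrow> snd (c, \<mu>)) (nhds (c, \<mu>))"
        by (intro tendsto_fst tendsto_snd filterlim_ident)+
      then have "((\<lambda>xz. fst xz * snd xz powr (5/2)) \<longlongrightarrow> fst (c, \<mu>) * snd (c, \<mu>) powr (5/2)) (nhds (c, \<mu>))"
        using \<mu> by (intro tendsto_mult tendsto_powr tendsto_const) auto
      then show ?thesis by (simp add: K_def)
    qed
    then have "\<forall>\<^sub>F xz in nhds (c, \<mu>). dist (fst xz * snd xz powr (5/2)) K < \<eta>"
      using \<eta> by (rule tendstoD)
    then obtain e where e: "e > 0" "\<And>xz. dist xz (c, \<mu>) < e \<Longrightarrow> dist (fst xz * snd xz powr (5/2)) K < \<eta>"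
      unfolding eventually_nhds_metric by blast
    define e' where "e' = min (e / 2) (\<mu> / 2)"
    have e': "e' > 0" "e' \<le> e / 2" "e' < \<mu>" using e(1) \<mu> by (auto simp: e'_def min_def)
    have close: "\<bar>x * z powr (5/2) - K\<bar> < \<eta>" if "\<bar>x - c\<bar> < e'" "\<bar>z - \<mu>\<bar> < e'" for x z
    proof -
      have "dist (x, z) (c, \<mu>) \<le> \<bar>x - c\<bar> + \<bar>z - \<mu>\<bar>"
        unfolding dist_Pair_Pair dist_real_def by (rule sqrt_sum_squares_le_sum_abs[THEN order_trans]) simp
      also have "\<dots> < e" using that e' by linarith
      finally show ?thesis using e(2)[of "(x, z)"] by (simp add: dist_real_def)
    qed
    \<comment> \<open>The window between \<open>a1 * n\<close> and \<open>a2 * n\<close> consists of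
      those \<open>j\<close> for which n / j is within \<open>e'\<close> of the mean.\<close>
    define a1 where "a1 = 1 / (\<mu> + e')"
    define a2 where "a2 = 1 / (\<mu> - e')"
    have a: "a1 > 0" "a2 > 0" "a1 * \<mu> < 1" "a2 * \<mu> > 1"
      using e' \<mu> by (simp_all add: a1_def a2_def field_simps)
    obtain \<theta>1 where \<theta>1: "0 < \<theta>1" "\<theta>1 < 1" "\<And>n j. real j \<le> a1 * real n \<Longrightarrow> w j n \<le> \<theta>1 ^ n"
      using chernoff_below[OF nonneg r one, of a1] a unfolding w_def \<mu>_def by blast
    obtain \<theta>2 where \<theta>2: "0 < \<theta>2" "\<theta>2 < 1" "\<And>n j. real j \<ge> a2 * real n \<Longrightarrow> w j n \<le> \<theta>2 ^ n"
      using chernoff_above[OF nonneg p1 r one, of a2] a unfolding w_def \<mu>_def by blast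
    define T where "T n = (real n powr (5/2) * B + K) * (\<theta>1 ^ n + \<theta>2 ^ n) * (real n + 1)" for n :: nat
    have lim: "(\<lambda>n. real n powr (5/2) * (real n + 1) * \<theta> ^ n) \<longlonglongrightarrow> 0" "(\<lambda>n. (real n + 1) * \<theta> ^ n) \<longlonglongrightarrow> 0"
      if "0 < \<theta>" "\<theta> < 1" for \<theta> :: real
      using that by real_asymp+
    have "T = (\<lambda>n. B * (real n powr (5/2) * (real n + 1) * \<theta>1 ^ n + real n powr (5/2) * (real n + 1) * \<theta>2 ^ n)
        + K * ((real n + 1) * \<theta>1 ^ n + (real n + 1) * \<theta>2 ^ n))"
      by (rule ext) (simp add: T_def algebra_simps)
    moreover have "(\<lambda>n. B * (real n powr (5/2) * (real n + 1) * \<theta>1 ^ n + real n powr (5/2) * (real n + 1) * \<theta>2 ^ n)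
        + K * ((real n + 1) * \<theta>1 ^ n + (real n + 1) * \<theta>2 ^ n)) \<longlonglongrightarrow> B * (0 + 0) + K * (0 + 0)"
      by (intro tendsto_intros lim \<theta>1(1,2) \<theta>2(1,2))
    ultimately have "T \<longlonglongrightarrow> 0" by simp
    then have ev1: "\<forall>\<^sub>F n in sequentially. T n < \<eta>' / 2"
      using \<open>\<eta>' > 0\<close> by (intro order_tendstoD) auto
    have ev2: "\<forall>\<^sub>F n in sequentially. (\<Sum>j\<le>n. w j n) < L + 1"
      using L by (intro order_tendstoD(2)) auto
    obtain J where J: "\<And>j. j \<ge> J \<Longrightarrow> \<bar>v j * real j powr (5/2) - c\<bar> < e'"
      using LIMSEQ_D[OF v(1) e'(1)] by auto
    \<comment> \<open>Ensures that every \<open>j\<close> in the window is at least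
      \<open>J\<close>.\<close>
    have ev3: "\<forall>\<^sub>F n in sequentially. real n \<ge> real (Suc J) / a1"
      by (rule eventually_compose_filterlim[OF eventually_ge_at_top filterlim_real_sequentially])
    have "\<forall>\<^sub>F n in sequentially. norm (S n - 0) < \<eta>'"
      using ev1 ev2 ev3
    proof eventually_elim
      case (elim n)
      have n: "real n > 0" using elim(3) a by (smt (verit) divide_pos_pos of_nat_0_less_iff zero_less_Suc)
      have bound: "\<bar>(real n powr (5/2) * v j - K) * w j n\<bar> \<le>
          \<eta> * w j n + (real n powr (5/2) * B + K) * (\<theta>1 ^ n + \<theta>2 ^ n)" for j
      proof (cases "a1 * real n < real j \<and> real j < a2 * real n")
        case True
        have "real (Suc J) \<le> a1 * real n" using elim(3) a by (simp add: field_simps)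
        then have "j \<ge> J" using True by linarith
        have j: "real j > 0" using True a n by (smt (verit) mult_pos_pos)
        have "\<bar>real n / real j - \<mu>\<bar> < e'"
        proof -
          have "real n < real j * (\<mu> + e')" using True e' \<mu> by (simp add: a1_def field_simps)
          moreover have "real j * (\<mu> - e') < real n" using True e' by (simp add: a2_def field_simps)
          ultimately show ?thesis using j by (simp add: abs_less_iff field_simps)
        qed
        then have "\<bar>v j * real j powr (5/2) * (real n / real j) powr (5/2) - K\<bar> < \<eta>"
          using J[OF \<open>j \<ge> J\<close>] by (intro close)
        moreover have "real j powr (5/2) * (real n / real j) powr (5/2) = real n powr (5/2)"
          using j n by (simp add: powr_mult[symmetric])
        ultimately have "\<bar>real n powr (5/2) * v j - K\<bar> < \<eta>" by (simp add: mult_ac)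
        then have "\<bar>(real n powr (5/2) * v j - K) * w j n\<bar> \<le> \<eta> * w j n"
          using w by (simp add: abs_mult mult_right_mono)
        moreover have "0 \<le> (real n powr (5/2) * B + K) * (\<theta>1 ^ n + \<theta>2 ^ n)"
          using K vB[of 0] \<theta>1 \<theta>2 by (intro mult_nonneg_nonneg add_nonneg_nonneg) auto
        ultimately show ?thesis by linarith
      next
        case False
        then have "w j n \<le> \<theta>1 ^ n \<or> w j n \<le> \<theta>2 ^ n" using \<theta>1(3) \<theta>2(3) by (meson not_less)
        moreover have "\<theta>1 ^ n \<ge> 0" "\<theta>2 ^ n \<ge> 0" using \<theta>1 \<theta>2 by auto
        ultimately have w_le: "w j n \<le> \<theta>1 ^ n + \<theta>2 ^ n" by linarith
        have "\<bar>real n powr (5/2) * v j - K\<bar> \<le> real n powr (5/2) * \<bar>v j\<bar> + K"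
          using K abs_triangle_ineq4[of "real n powr (5/2) * v j" K] by (simp add: abs_mult)
        also have "\<dots> \<le> real n powr (5/2) * B + K" using vB by (simp add: mult_left_mono)
        finally have "\<bar>real n powr (5/2) * v j - K\<bar> * w j n \<le> (real n powr (5/2) * B + K) * (\<theta>1 ^ n + \<theta>2 ^ n)"
          using w_le w by (intro mult_mono) auto
        moreover have "0 \<le> \<eta> * w j n" using \<eta> w by simp
        ultimately show ?thesis using w by (simp add: abs_mult)
      qed
      have "\<bar>S n\<bar> \<le> (\<Sum>j\<le>n. \<bar>(real n powr (5/2) * v j - K) * w j n\<bar>)"
        unfolding S_def by (rule sum_abs)
      also have "\<dots> \<le> (\<Sum>j\<le>n. \<eta> * w j n + (real n powr (5/2) * B + K) * (\<theta>1 ^ n + \<theta>2 ^ n))"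
        by (intro sum_mono bound)
      also have "\<dots> = \<eta> * (\<Sum>j\<le>n. w j n) + T n"
        by (simp add: sum.distrib sum_distrib_left T_def algebra_simps)
      also have "\<dots> < \<eta> * (L + 1) + \<eta>' / 2"
        using elim(1,2) \<eta> by (intro add_le_less_mono mult_left_mono) auto
      also have "\<dots> = \<eta>'" using L by (simp add: \<eta>_def field_simps)
      finally show ?case by simp
    qed
    then show "\<exists>no. \<forall>n\<ge>no. norm (S n - 0) < \<eta>'" by (simp add: eventually_sequentially)
  qed
  then have "(\<lambda>n. S n + K * (\<Sum>j\<le>n. w j n)) \<longlonglongrightarrow> 0 + K * L"
    using L by (intro tendsto_intros)
  moreover have "S n + K * (\<Sum>j\<le>n. w j n) = real n powr (5/2) * (\<Sum>j\<le>n. v j * w j n)" for n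
    unfolding S_def sum_distrib_left sum.distrib[symmetric] by (intro sum.cong) (simp_all add: algebra_simps)
  ultimately show ?thesis using K L unfolding w_def by (intro exI[of _ "K * L"]) simp
qed

section \<open>Otter's asymptotics\<close>

text \<open>Stirling's formula with an unspecified constant: \<open>s n\<close> is the logarithm of
  the n-th term, and its increments are O(1 / n^2), so it converges.\<close>

lemma cayley_unrooted_asymp:
  "\<exists>c>0. (\<lambda>j. fps_nth cayley_unrooted j * exp (- real j) * real j powr (5/2)) \<longlonglongrightarrow> c"
proof -
  define s where "s n = (real n + 1/2) * ln (real n) - real n - ln (fact n)" for n :: nat
  have diff: "\<forall>\<^sub>F n in sequentially. s (Suc n) - s n = (real n + 1/2) * ln (1 + 1 / real n) - 1"
    using eventually_gt_at_top[of 0]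
  proof eventually_elim
    case (elim n)
    have lf: "ln (fact (Suc n) :: real) = ln (real (Suc n)) + ln (fact n)"
      by (simp add: ln_mult del: of_nat_Suc)
    have l1: "ln (1 + 1 / real n) = ln (real (Suc n)) - ln (real n)"
    proof -
      have "1 + 1 / real n = real (Suc n) / real n" using elim by (simp add: field_simps)
      then show ?thesis using elim by (simp add: ln_div del: of_nat_Suc)
    qed
    show ?case unfolding s_def lf l1 by (simp add: algebra_simps)
  qed
  have "(\<lambda>n. (real n + 1/2) * ln (1 + 1 / real n) - 1) \<in> O(\<lambda>n. inverse (real n ^ 2))"
    by real_asymp
  then have "(\<lambda>n. s (Suc n) - s n) \<in> O(\<lambda>n. inverse (real n ^ 2))"
    using landau_o.big.in_cong[OF diff] by blast
  then have "summable (\<lambda>n. s (Suc n) - s n)"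
    by (rule summable_comparison_test_bigo[rotated]) (simp add: inverse_power_summable)
  then obtain l where "(\<lambda>n. \<Sum>k<n. s (Suc k) - s k) \<longlonglongrightarrow> l"
    by (auto simp: summable_def sums_def)
  then have "(\<lambda>n. s n - s 0) \<longlonglongrightarrow> l" by (simp add: sum_lessThan_telescope)
  then have "(\<lambda>n. (s n - s 0) + s 0) \<longlonglongrightarrow> l + s 0" by (intro tendsto_intros)
  then have "(\<lambda>n. exp (s n)) \<longlonglongrightarrow> exp (l + s 0)" by (intro tendsto_exp) simp
  moreover have "\<forall>\<^sub>F n in sequentially. exp (s n) = fps_nth cayley_unrooted n * exp (- real n) * real n powr (5/2)"
    using eventually_gt_at_top[of 0]
  proof eventually_elim
    case (elim n)
    have "exp (s n) = exp (real n * ln (real n)) * exp (ln (real n) / 2) * exp (- real n) / exp (ln (fact n))"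
    proof -
      have s: "s n = real n * ln (real n) + ln (real n) / 2 + (- real n) - ln (fact n)"
        by (simp add: s_def algebra_simps)
      show ?thesis unfolding s exp_add exp_diff ..
    qed
    also have "exp (real n * ln (real n)) = real n ^ n" using elim by (simp add: exp_of_nat_mult)
    also have "exp (ln (real n) / 2) = real n powr (1/2)" using elim by (simp add: powr_def)
    also have "real n powr (1/2) = real n powr (5/2) / real n ^ 2"
    proof -
      have "real n powr (1/2 + 2) = real n powr (1/2) * real n powr 2" by (rule powr_add)
      then have "real n powr (5/2) = real n powr (1/2) * real n ^ 2" by simp
      then show ?thesis using elim by simp
    qed
    also have "real n ^ n = real n ^ (n - 1) * real n" using elim by (simp add: power_eq_if)
    finally show ?case using elim by (simp add: cayley_unrooted_nth power2_eq_square field_simps)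
  qed
  ultimately have "(\<lambda>n. fps_nth cayley_unrooted n * exp (- real n) * real n powr (5/2)) \<longlonglongrightarrow> exp (l + s 0)"
    by (rule Lim_transform_eventually)
  then show ?thesis by (intro exI[of _ "exp (l + s 0)"]) simp
qed

lemma cayley_nth_bounds: "0 \<le> fps_nth cayley n" "fps_nth cayley n \<le> exp 1 ^ n"
proof -
  show "0 \<le> fps_nth cayley n" by (cases "n = 0") (simp_all add: cayley_nth)
  show "fps_nth cayley n \<le> exp 1 ^ n"
  proof (cases "n = 0")
    case False
    have "fps_nth cayley n = real n ^ (n - 1) / fact n" using False by (intro cayley_nth) simp
    also have "\<dots> \<le> real n ^ n / fact n" using False by (intro divide_right_mono power_increasing) auto
    also have "\<dots> \<le> exp (real n)"
      using sum_le_suminf[OF summable_exp_generic[of "real n"], of "{n}"]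
      by (simp add: exp_def scaleR_conv_of_real field_simps)
    also have "\<dots> = exp 1 ^ n" by (simp add: exp_of_nat_mult[symmetric])
    finally show ?thesis .
  qed simp
qed

section \<open>Radius of convergence and the critical point\<close>

abbreviation rooted_summable :: "real \<Rightarrow> bool" where
  "rooted_summable x \<equiv> summable (\<lambda>n. real (rcount n) * x ^ n)"

lemma rooted_summable_quarter: "rooted_summable (1/4)"
proof (rule summableI_nonneg_bounded)
  fix n show "(\<Sum>i<n. real (rcount i) * (1/4) ^ i) \<le> 1/2"
    using rcount_quarter_sum_le[of n] by (rule order_trans[rotated]) (intro sum_mono2, auto)
qed simp

text \<open>\<open>rcount (2 n + 1)\<close> is at least 2^n, and 2 x^2 > 1 once x > 3/4, so the
  terms of odd index would not tend to 0.\<close>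

lemma rooted_summable_le:
  assumes "rooted_summable x" "x \<ge> 0"
  shows "x \<le> 3/4"
proof (rule ccontr)
  assume "\<not> x \<le> 3/4"
  then have x: "x > 3/4" by simp
  have "strict_mono (\<lambda>n::nat. Suc (2 * n))" by (rule strict_monoI) simp
  then have "(\<lambda>n. real (rcount (Suc (2 * n))) * x ^ Suc (2 * n)) \<longlonglongrightarrow> 0"
    using LIMSEQ_subseq_LIMSEQ[OF summable_LIMSEQ_zero[OF assms(1)]] unfolding o_def by blast
  then have "\<forall>\<^sub>F n in sequentially. real (rcount (Suc (2 * n))) * x ^ Suc (2 * n) < 3/4"
    by (rule order_tendstoD) simp
  then obtain n where n: "real (rcount (Suc (2 * n))) * x ^ Suc (2 * n) < 3/4"
    by (auto simp: eventually_sequentially)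
  have "3/4 = (3/4) * (1::real) ^ n" by simp
  also have "\<dots> \<le> x * (2 * (x * x)) ^ n"
  proof (intro mult_mono power_mono)
    have "(3/4) * (3/4) \<le> x * x" using x by (intro mult_mono) auto
    then show "1 \<le> 2 * (x * x)" by simp
  qed (use x in auto)
  also have "\<dots> = 2 ^ n * x ^ Suc (2 * n)"
    by (simp add: power_mult power_mult_distrib power2_eq_square)
  also have "\<dots> \<le> real (rcount (Suc (2 * n))) * x ^ Suc (2 * n)"
    using rcount_exp_ge[of n] x by (intro mult_right_mono) (auto simp: of_nat_le_iff[symmetric] simp del: of_nat_le_iff)
  finally show False using n by simp
qed

definition rooted_radius :: real where
  "rooted_radius = Sup {x. 0 \<le> x \<and> rooted_summable x}"

lemma rooted_bdd: "bdd_above {x. 0 \<le> x \<and> rooted_summable x}"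
  using rooted_summable_le by (intro bdd_aboveI[of _ "3/4"]) auto

lemma rooted_radius_bounds: "1/4 \<le> rooted_radius" "rooted_radius \<le> 3/4"
proof -
  show "1/4 \<le> rooted_radius" unfolding rooted_radius_def
    using rooted_summable_quarter by (intro cSup_upper rooted_bdd) simp
  show "rooted_radius \<le> 3/4" unfolding rooted_radius_def
  proof (rule cSup_least)
    have "(1/4) \<in> {x. 0 \<le> x \<and> rooted_summable x}" using rooted_summable_quarter by simp
    then show "{x. 0 \<le> x \<and> rooted_summable x} \<noteq> {}" by blast
  qed (use rooted_summable_le in simp)
qed

lemma rooted_summable_inside:
  assumes "0 \<le> x" "x < rooted_radius"
  shows "rooted_summable x"
proof -
  obtain y where y: "0 \<le> y" "rooted_summable y" "x < y"
  proof -
    have "(1/4) \<in> {x. 0 \<le> x \<and> rooted_summable x}" using rooted_summable_quarter by simp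
    then have "{x. 0 \<le> x \<and> rooted_summable x} \<noteq> {}" by blast
    from less_cSup_iff[OF this rooted_bdd, of x] show ?thesis
      using assms(2) that unfolding rooted_radius_def by auto
  qed
  then show ?thesis using summable_le_radius[of "\<lambda>n. real (rcount n)" y x] assms(1) by simp
qed

lemma rcount_bound:
  assumes "0 \<le> y" "y < rooted_radius"
  shows "\<exists>K>0. \<forall>d. real (rcount d) * y ^ d \<le> K"
proof -
  have "real (rcount d) * y ^ d \<le> (\<Sum>d. real (rcount d) * y ^ d) + 1" for d
    using sum_le_suminf[OF rooted_summable_inside[OF assms], of "{d}"] assms by simp
  moreover have "(\<Sum>d. real (rcount d) * y ^ d) + 1 > 0"
    using assms by (intro add_nonneg_pos suminf_nonneg rooted_summable_inside) auto
  ultimately show ?thesis by blast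
qed

lemma euler_rest_nonneg: "0 \<le> fps_nth euler_rest k"
  by (auto simp: euler_rest_def intro!: divide_nonneg_nonneg sum_nonneg)

text \<open>A proper divisor of k is at most k / 2, so coefficient k of \<open>euler_rest\<close>
  grows only like \<open>rcount\<close> at k / 2, up to a linear factor. Hence the series converges
  up to the square root of the rooted radius, which is larger than the radius because that is below
  1.\<close>

lemma summable_euler_rest:
  assumes "0 \<le> x" "x\<^sup>2 < rooted_radius"
  shows "summable (\<lambda>k. fps_nth euler_rest k * x ^ k)"
proof -
  define y where "y = (x\<^sup>2 + rooted_radius) / 2"
  have y1: "x\<^sup>2 < y" "y < rooted_radius" using assms(2) by (simp_all add: y_def)
  have "0 < y" using zero_le_power2[of x] y1(1) by linarith
  moreover have "y < 1" using y1(2) rooted_radius_bounds(2) by linarith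
  ultimately have y: "x\<^sup>2 < y" "y < rooted_radius" "0 < y" "y < 1" using y1 by simp_all
  define t where "t = sqrt y"
  have t: "x < t" "0 < t" "t \<le> 1" "t\<^sup>2 = y"
    using y assms(1) by (auto simp: t_def real_less_rsqrt)
  obtain K where K: "K > 0" "\<And>d. real (rcount d) * y ^ d \<le> K"
    using rcount_bound[of y] y by auto
  have bound: "fps_nth euler_rest k \<le> real (Suc k) * (K / t ^ k)" for k
  proof (cases "k = 0")
    case False
    let ?D = "{d. d dvd k \<and> d < k}"
    have D: "?D \<subseteq> {..k}" by auto
    have half: "2 * d \<le> k" if "d \<in> ?D" for d
    proof -
      obtain m where m: "k = d * m" using \<open>d \<in> ?D\<close> by auto
      then have "m \<noteq> 0" "m \<noteq> 1" using \<open>d \<in> ?D\<close> by auto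
      then have "m \<ge> 2" by linarith
      then show ?thesis using m by (simp add: mult.commute)
    qed
    have "fps_nth euler_rest k = (\<Sum>d\<in>?D. real d * real (rcount d) / real k)"
      by (simp add: euler_rest_def sum_divide_distrib)
    also have "\<dots> \<le> (\<Sum>d\<in>?D. K / t ^ k)"
    proof (rule sum_mono)
      fix d assume d: "d \<in> ?D"
      have "real d * real (rcount d) / real k \<le> real k * real (rcount d) / real k"
        using d by (intro divide_right_mono mult_right_mono) auto
      also have "\<dots> = real (rcount d)" using False by simp
      also have "\<dots> \<le> K / y ^ d" using K(2)[of d] y by (simp add: field_simps)
      also have "\<dots> \<le> K / t ^ k"
      proof (rule divide_left_mono)
        have "t ^ k \<le> t ^ (2 * d)" using half[OF d] t by (intro power_decreasing) auto
        then show "t ^ k \<le> y ^ d" using t(4) by (simp add: power_mult)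
      qed (use K t y in auto)
      finally show "real d * real (rcount d) / real k \<le> K / t ^ k" .
    qed
    also have "\<dots> = real (card ?D) * (K / t ^ k)" by simp
    also have "\<dots> \<le> real (Suc k) * (K / t ^ k)"
      using card_mono[OF _ D] K t by (intro mult_right_mono) auto
    finally show ?thesis .
  qed (use K in simp)
  show ?thesis
  proof (rule summable_comparison_test')
    have "summable (\<lambda>k. real (Suc k) * (x / t) ^ k)"
      using geometric_deriv_sums[of "x / t"] t assms(1) by (auto simp: sums_iff)
    then show "summable (\<lambda>k. K * (real (Suc k) * (x / t) ^ k))" by (rule summable_mult)
    fix k assume "k \<ge> (0::nat)"
    have "fps_nth euler_rest k * x ^ k \<le> real (Suc k) * (K / t ^ k) * x ^ k"
      using bound assms(1) by (intro mult_right_mono) auto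
    then show "norm (fps_nth euler_rest k * x ^ k) \<le> K * (real (Suc k) * (x / t) ^ k)"
      using euler_rest_nonneg[of k] assms(1) by (simp add: power_divide mult_ac)
  qed
qed

lemma kernel_nonneg: "0 \<le> fps_nth kernel_gf n"
  unfolding kernel_gf_def using fps_power_nth_nonneg[of "fps_nth euler_rest"] euler_rest_nonneg
  by (auto simp: fps_compose_nth fps_nth_inverse intro!: sum_nonneg)

lemma summable_kernel:
  assumes "0 \<le> x" "x\<^sup>2 < rooted_radius"
  shows "summable (\<lambda>n. fps_nth kernel_gf n * x ^ n)"
proof -
  have "summable (\<lambda>n. fps_nth (fps_exp 1 oo Abs_fps (fps_nth euler_rest)) n * x ^ n)"
  proof (rule summable_fps_compose)
    show "summable (\<lambda>n. fps_nth (fps_exp 1) n * (\<Sum>k. fps_nth euler_rest k * x ^ k) ^ n)"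
      using summable_exp[of "\<Sum>k. fps_nth euler_rest k * x ^ k"] by (simp add: field_simps)
  qed (use assms euler_rest_nonneg summable_euler_rest in auto)
  then have "summable (\<lambda>n. x * (fps_nth (fps_exp 1 oo euler_rest) n * x ^ n))"
    by (intro summable_mult) (simp add: fps_nth_inverse)
  then have "summable (\<lambda>n. fps_nth kernel_gf (Suc n) * x ^ Suc n)"
    by (simp add: kernel_gf_def mult_ac)
  then show ?thesis using summable_Suc_iff[of "\<lambda>n. fps_nth kernel_gf n * x ^ n"] by simp
qed

text \<open>Were the kernel still below 1/e at some b beyond the rooted radius, the tree function
  would converge at its value, and R = W o g would converge at b. So the value 1/e is attained at or
  before b, by the intermediate value theorem.\<close>

lemma critical_point:
  obtains x x' where "0 < x" "x < x'" "x'\<^sup>2 < rooted_radius"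
    "(\<lambda>n. fps_nth kernel_gf n * x ^ n) sums exp (- 1)"
proof -
  define \<rho> where "\<rho> = rooted_radius"
  have \<rho>: "0 < \<rho>" "\<rho> < 1" using rooted_radius_bounds by (auto simp: \<rho>_def)
  have "\<rho> * \<rho> < \<rho> * 1" using \<rho> by (intro mult_strict_left_mono) auto
  then have sq: "\<rho> < sqrt \<rho>" using \<rho> by (intro real_less_rsqrt) (simp add: power2_eq_square)
  \<comment> \<open>Any b strictly between the radius and its square root would do; x' lies above b
    and still below the square root, which leaves room for exponential tails.\<close>
  define b where "b = (\<rho> + sqrt \<rho>) / 2"
  define x' where "x' = (b + sqrt \<rho>) / 2"
  have b: "\<rho> < b" "b < x'" "x' < sqrt \<rho>" using sq by (simp_all add: b_def x'_def)
  have below: "z\<^sup>2 < rooted_radius" if "0 \<le> z" "z \<le> x'" for z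
  proof -
    have "z < sqrt \<rho>" using that b by linarith
    then show ?thesis using that(1) \<rho> by (metis \<rho>_def power_strict_mono pos2 real_sqrt_pow2 less_imp_le)
  qed
  define G where "G z = (\<Sum>n. fps_nth kernel_gf n * z ^ n)" for z
  have "exp (- 1) \<le> G b"
  proof (rule ccontr)
    assume "\<not> exp (- 1) \<le> G b"
    then have Gb: "G b < exp (- 1)" by simp
    have sm: "summable (\<lambda>n. fps_nth kernel_gf n * b ^ n)" using summable_kernel below b \<rho> by simp
    then have G0: "0 \<le> G b" unfolding G_def using kernel_nonneg b \<rho> by (intro suminf_nonneg) auto
    have "exp 1 * G b < exp 1 * exp (- 1)" using Gb by (intro mult_strict_left_mono) auto
    then have lt1: "exp 1 * G b < 1" by (simp add: exp_add[symmetric])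
    have "summable (\<lambda>n. fps_nth cayley n * G b ^ n)"
    proof (rule summable_comparison_test')
      show "summable (\<lambda>n. (exp 1 * G b) ^ n)" using lt1 G0 by (intro summable_geometric) simp
      fix n assume "n \<ge> (0::nat)"
      show "norm (fps_nth cayley n * G b ^ n) \<le> (exp 1 * G b) ^ n"
        using cayley_nth_bounds[of n] G0 by (simp add: power_mult_distrib mult_right_mono abs_mult)
    qed
    then have "summable (\<lambda>n. fps_nth (cayley oo Abs_fps (fps_nth kernel_gf)) n * b ^ n)"
      using sm b \<rho> kernel_nonneg cayley_nth_bounds unfolding G_def by (intro summable_fps_compose) auto
    then have "rooted_summable b" by (simp add: fps_nth_inverse rooted_gf_eq_compose[symmetric])
    then have "b \<le> rooted_radius"
      unfolding rooted_radius_def using b \<rho> by (intro cSup_upper rooted_bdd) auto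
    then show False using b by (simp add: \<rho>_def)
  qed
  moreover have G0: "G 0 = 0" unfolding G_def by (simp add: powser_zero)
  moreover have "continuous_on {0..b} G"
  proof (rule continuous_at_imp_continuous_on, rule ballI)
    fix z assume z: "z \<in> {0..b}"
    show "isCont G z" unfolding G_def
      using summable_kernel[of x'] below[of x'] z b \<rho> by (intro isCont_powser[of _ x']) auto
  qed
  ultimately obtain x where x: "0 \<le> x" "x \<le> b" "G x = exp (- 1)"
    using IVT'[of G 0 "exp (- 1)" b] b \<rho> by auto
  have "x \<noteq> 0" using x(3) G0 by auto
  moreover have "(\<lambda>n. fps_nth kernel_gf n * x ^ n) sums exp (- 1)"
    using summable_kernel[of x] below[of x] x b unfolding G_def by (auto simp: sums_iff)
  ultimately show ?thesis using that[of x x'] x b \<rho> below[of x'] by auto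
qed

lemma fps_power_nth_scale:
  "fps_nth (Abs_fps (\<lambda>k. c * fps_nth A k * x ^ k) ^ j) n = c ^ j * fps_nth (A ^ j) n * (x :: real) ^ n"
proof (induction j arbitrary: n)
  case (Suc j)
  have "fps_nth (Abs_fps (\<lambda>k. c * fps_nth A k * x ^ k) ^ Suc j) n =
      (\<Sum>i=0..n. (c * fps_nth A i * x ^ i) * (c ^ j * fps_nth (A ^ j) (n - i) * x ^ (n - i)))"
    by (simp add: fps_mult_nth Suc)
  also have "\<dots> = (\<Sum>i=0..n. c ^ Suc j * (fps_nth A i * fps_nth (A ^ j) (n - i)) * x ^ n)"
  proof (rule sum.cong)
    fix i assume "i \<in> {0..n}"
    then have "x ^ n = x ^ i * x ^ (n - i)" by (simp add: power_add[symmetric])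
    then show "(c * fps_nth A i * x ^ i) * (c ^ j * fps_nth (A ^ j) (n - i) * x ^ (n - i)) =
        c ^ Suc j * (fps_nth A i * fps_nth (A ^ j) (n - i)) * x ^ n" by simp
  qed simp
  finally show ?case by (simp add: fps_mult_nth sum_distrib_left sum_distrib_right)
qed auto

text \<open>Scaling the kernel at the critical point by x^k and by e turns it into the probability
  distribution \<open>p\<close>, and the factor e^(-j) lost in the j-th power is exactly what makes
  the coefficients of U decay like j^(-5/2). The growth rate is the reciprocal of the critical
  point.\<close>

theorem otter_asymptotics:
  "\<exists>\<alpha>>0. \<exists>C>0. (\<lambda>n. real (num_unlabelled_trees n)) \<sim>[at_top] (\<lambda>n. C * real n powr (-5/2) * \<alpha> ^ n)"
proof -
  obtain x x' where x: "0 < x" "x < x'" "x'\<^sup>2 < rooted_radius"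
    "(\<lambda>n. fps_nth kernel_gf n * x ^ n) sums exp (- 1)" by (rule critical_point)
  define p where "p = (\<lambda>k. exp 1 * fps_nth kernel_gf k * x ^ k)"
  define v where "v = (\<lambda>j. fps_nth cayley_unrooted j * exp (- real j))"
  obtain c where c: "c > 0" "(\<lambda>j. v j * real j powr (5/2)) \<longlonglongrightarrow> c"
    using cayley_unrooted_asymp by (auto simp: v_def)
  have "Bseq (\<lambda>j. v j * real j powr (5/2))" using c(2) by (intro convergent_imp_Bseq convergentI)
  then obtain B where B: "B > 0" "\<And>j. norm (v j * real j powr (5/2)) \<le> B" by (rule BseqE) blast
  have vB: "\<bar>v j\<bar> \<le> B" for j
  proof (cases "j = 0")
    case False
    then have "1 \<le> real j powr (5/2)" by (intro ge_one_powr_ge_zero) auto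
    then have "\<bar>v j\<bar> * 1 \<le> \<bar>v j\<bar> * real j powr (5/2)" by (intro mult_left_mono) auto
    then show ?thesis using B(2)[of j] by (simp add: abs_mult)
  qed (use B in \<open>simp add: v_def cayley_unrooted_nth\<close>)
  have "\<exists>C>0. (\<lambda>n. real n powr (5/2) * (\<Sum>j\<le>n. v j * fps_nth (Abs_fps p ^ j) n)) \<longlonglongrightarrow> C"
  proof (rule critical_composition_limit[where r = "x' / x" and c = c and B = B])
    show "p 1 > 0" using x by (simp add: p_def kernel_gf_def)
    show "x' / x > 1" using x by simp
    have "summable (\<lambda>k. exp 1 * (fps_nth kernel_gf k * x' ^ k))"
      using x by (intro summable_mult summable_kernel) auto
    then show "summable (\<lambda>k. p k * (x' / x) ^ k)"
      using x by (simp add: p_def power_divide mult_ac)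
    have "(\<lambda>k. exp 1 * (fps_nth kernel_gf k * x ^ k)) sums (exp 1 * exp (- 1))"
      by (intro sums_mult x)
    then show "p sums 1" by (simp add: p_def exp_add[symmetric] mult_ac)
  qed (use x kernel_nonneg c vB in \<open>auto simp: p_def\<close>)
  then obtain C where C: "C > 0"
    "(\<lambda>n. real n powr (5/2) * (\<Sum>j\<le>n. v j * fps_nth (Abs_fps p ^ j) n)) \<longlonglongrightarrow> C" by blast
  define e where "e n = (if even n then rcount (n div 2) else 0)" for n
  have main: "real (num_unlabelled_trees n) * x ^ n =
      (\<Sum>j\<le>n. v j * fps_nth (Abs_fps p ^ j) n) + real (e n) / 2 * x ^ n" if "n \<ge> 1" for n
  proof -
    have "2 * num_unlabelled_trees n + (\<Sum>i\<le>n. rcount i * rcount (n - i)) = 2 * rcount n + e n"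
      using num_unlabelled_trees_formula[OF that] unfolding e_def .
    then have "real (2 * num_unlabelled_trees n + (\<Sum>i\<le>n. rcount i * rcount (n - i))) = real (2 * rcount n + e n)"
      by (rule arg_cong)
    then have "2 * real (num_unlabelled_trees n) + real (\<Sum>i\<le>n. rcount i * rcount (n - i)) = 2 * real (rcount n) + real (e n)"
      by (simp only: of_nat_add of_nat_mult of_nat_numeral)
    then have "real (num_unlabelled_trees n) =
        (\<Sum>j\<le>n. fps_nth cayley_unrooted j * fps_nth (kernel_gf ^ j) n) + real (e n) / 2"
      using rcount_unrooted_formula[of n] by linarith
    then have "real (num_unlabelled_trees n) * x ^ n =
        (\<Sum>j\<le>n. fps_nth cayley_unrooted j * fps_nth (kernel_gf ^ j) n * x ^ n) + real (e n) / 2 * x ^ n"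
      by (simp add: distrib_right sum_distrib_right)
    moreover have "fps_nth cayley_unrooted j * fps_nth (kernel_gf ^ j) n * x ^ n = v j * fps_nth (Abs_fps p ^ j) n" for j
      unfolding p_def fps_power_nth_scale by (simp add: v_def exp_of_nat_mult[symmetric] exp_minus)
    ultimately show ?thesis by simp
  qed
  \<comment> \<open>The contribution of central edges is exponentially small:
    \<open>rcount (n div 2)\<close> is bounded by a constant times x'^(-n), and x < x'.\<close>
  have "(\<lambda>n. real n powr (5/2) * (real (e n) / 2 * x ^ n)) \<longlonglongrightarrow> 0"
  proof -
    have xx: "x\<^sup>2 < x'\<^sup>2" using x by (intro power_strict_mono) auto
    obtain K where K: "K > 0" "\<And>d. real (rcount d) * (x'\<^sup>2) ^ d \<le> K"
      using rcount_bound[of "x'\<^sup>2"] x by auto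
    have en: "real (e n) * x ^ n \<le> K * (x / x') ^ n" for n
    proof (cases "even n")
      case True
      then obtain m where m: "n = 2 * m" by (elim evenE)
      have "real (rcount m) * x' ^ n \<le> K" using K(2)[of m] by (simp add: m power_mult)
      then have "real (rcount m) * x' ^ n * (x / x') ^ n \<le> K * (x / x') ^ n"
        using x by (intro mult_right_mono) auto
      then show ?thesis using x by (simp add: e_def m power_divide)
    qed (use K x in \<open>simp add: e_def\<close>)
    define q where "q = x / x'"
    have q: "0 < q" "q < 1" using x by (simp_all add: q_def)
    have "(\<lambda>n. real n powr (5/2) * q ^ n) \<longlonglongrightarrow> 0" using q by real_asymp
    then have lim: "(\<lambda>n. K / 2 * (real n powr (5/2) * q ^ n)) \<longlonglongrightarrow> 0"
      using tendsto_mult_left[of "\<lambda>n. real n powr (5/2) * q ^ n" 0 sequentially "K / 2"] by simp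
    show ?thesis
    proof (rule tendsto_sandwich[OF _ _ tendsto_const lim])
      show "\<forall>\<^sub>F n in sequentially. 0 \<le> real n powr (5/2) * (real (e n) / 2 * x ^ n)"
        using x by simp
      have "real n powr (5/2) * (real (e n) * x ^ n) \<le> real n powr (5/2) * (K * q ^ n)" for n
        unfolding q_def by (intro mult_left_mono en) simp
      then show "\<forall>\<^sub>F n in sequentially. real n powr (5/2) * (real (e n) / 2 * x ^ n) \<le> K / 2 * (real n powr (5/2) * q ^ n)"
        by (intro always_eventually allI) (simp add: mult_ac)
    qed
  qed
  from tendsto_add[OF C(2) this]
  have "(\<lambda>n. real n powr (5/2) * ((\<Sum>j\<le>n. v j * fps_nth (Abs_fps p ^ j) n) + real (e n) / 2 * x ^ n)) \<longlonglongrightarrow> C"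
    by (simp add: distrib_left)
  moreover have "\<forall>\<^sub>F n in sequentially. real n powr (5/2) * ((\<Sum>j\<le>n. v j * fps_nth (Abs_fps p ^ j) n) + real (e n) / 2 * x ^ n)
      = real n powr (5/2) * (real (num_unlabelled_trees n) * x ^ n)"
    using eventually_ge_at_top[of 1] by eventually_elim (simp add: main)
  ultimately have lim: "(\<lambda>n. real n powr (5/2) * (real (num_unlabelled_trees n) * x ^ n)) \<longlonglongrightarrow> C"
    by (rule Lim_transform_eventually)
  have "(\<lambda>n. real (num_unlabelled_trees n)) \<sim>[at_top] (\<lambda>n. C * real n powr (-5/2) * (1 / x) ^ n)"
  proof (rule asymp_equivI')
    have "(\<lambda>n. real n powr (5/2) * (real (num_unlabelled_trees n) * x ^ n) / C) \<longlonglongrightarrow> C / C"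
      using C(1) by (intro tendsto_divide lim tendsto_const) auto
    then have "(\<lambda>n. real n powr (5/2) * (real (num_unlabelled_trees n) * x ^ n) / C) \<longlonglongrightarrow> 1"
      using C(1) by simp
    moreover have "\<forall>\<^sub>F n in sequentially. real n powr (5/2) * (real (num_unlabelled_trees n) * x ^ n) / C
        = real (num_unlabelled_trees n) / (C * real n powr (-5/2) * (1 / x) ^ n)"
      using eventually_gt_at_top[of 0]
    proof eventually_elim
      case (elim n)
      have "real n powr (-5/2) = inverse (real n powr (5/2))" by (simp add: powr_minus[symmetric])
      then show ?case using elim C(1) x(1) by (simp add: field_simps)
    qed
    ultimately show "(\<lambda>n. real (num_unlabelled_trees n) / (C * real n powr (-5/2) * (1 / x) ^ n)) \<longlonglongrightarrow> 1"
      by (rule Lim_transform_eventually)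
  qed
  then show ?thesis using C(1) x(1) by (intro exI[of _ "1 / x"] conjI exI[of _ C]) auto
qed

section \<open>Otter's constant is uniquely determined\<close>

lemma otter_constant_not_less:
  assumes "0 < \<alpha>" "\<alpha> < \<beta>" "C > 0" "D > 0"
    "t \<sim>[at_top] (\<lambda>n. C * real n powr (-5/2) * \<alpha> ^ n)" "t \<sim>[at_top] (\<lambda>n. D * real n powr (-5/2) * \<beta> ^ n)"
  shows False
proof -
  have "(\<lambda>n. C * real n powr (-5/2) * \<alpha> ^ n) \<sim>[at_top] (\<lambda>n. D * real n powr (-5/2) * \<beta> ^ n)"
    using assms(5,6) asymp_equiv_sym asymp_equiv_trans by blast
  then have "(\<lambda>n. (C * real n powr (-5/2) * \<alpha> ^ n) / (D * real n powr (-5/2) * \<beta> ^ n)) \<longlonglongrightarrow> 1"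
  proof (rule asymp_equivD_strong)
    show "\<forall>\<^sub>F n in sequentially. C * real n powr (-5/2) * \<alpha> ^ n \<noteq> 0 \<or> D * real n powr (-5/2) * \<beta> ^ n \<noteq> 0"
      using eventually_gt_at_top[of 0] by eventually_elim (use assms in simp)
  qed
  moreover have "\<forall>\<^sub>F n in sequentially. (C * real n powr (-5/2) * \<alpha> ^ n) / (D * real n powr (-5/2) * \<beta> ^ n) = C / D * (\<alpha> / \<beta>) ^ n"
    using eventually_gt_at_top[of 0] by eventually_elim (simp add: power_divide)
  ultimately have "(\<lambda>n. C / D * (\<alpha> / \<beta>) ^ n) \<longlonglongrightarrow> 1" by (rule Lim_transform_eventually)
  moreover have "(\<lambda>n. C / D * (\<alpha> / \<beta>) ^ n) \<longlonglongrightarrow> C / D * 0"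
    using assms by (intro tendsto_mult tendsto_const LIMSEQ_realpow_zero) auto
  ultimately have "1 = C / D * 0" by (rule LIMSEQ_unique)
  then show False by simp
qed

lemma otter_alpha_asymp:
  "otter_alpha > 0 \<and> (\<exists>C>0. (\<lambda>n. real (num_unlabelled_trees n)) \<sim>[at_top] (\<lambda>n. C * real n powr (-5/2) * otter_alpha ^ n))"
  unfolding otter_alpha_def
proof (rule theI')
  let ?P = "\<lambda>\<alpha>. 0 < \<alpha> \<and> (\<exists>C>0. (\<lambda>n. real (num_unlabelled_trees n)) \<sim>[at_top] (\<lambda>n. C * real n powr (-5/2) * \<alpha> ^ n))"
  have not_less: False if "?P \<alpha>" "?P \<beta>" "\<alpha> < \<beta>" for \<alpha> \<beta>
    using that otter_constant_not_less[of \<alpha> \<beta>] by blast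
  obtain \<alpha> where \<alpha>: "?P \<alpha>" using otter_asymptotics by blast
  show "\<exists>!\<alpha>. ?P \<alpha>"
  proof (rule ex1I[of ?P, OF \<alpha>])
    fix \<beta> assume \<beta>: "?P \<beta>"
    show "\<beta> = \<alpha>"
      using not_less[OF \<alpha> \<beta>] not_less[OF \<beta> \<alpha>] by (cases \<beta> \<alpha> rule: linorder_cases) simp_all
  qed
qed

lemma num_unlabelled_trees_le_rcount:
  assumes "n \<ge> 1"
  shows "num_unlabelled_trees n \<le> rcount n"
proof -
  have "(if even n then rcount (n div 2) else 0) \<le> (\<Sum>i\<le>n. rcount i * rcount (n - i))"
  proof (cases "even n")
    case True
    then have n: "n div 2 \<ge> 1" "n - n div 2 = n div 2" using assms by auto
    have "rcount (n div 2) * 1 \<le> rcount (n div 2) * rcount (n - n div 2)"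
      using rcount_pos n by (intro mult_left_mono) auto
    also have "\<dots> \<le> (\<Sum>i\<le>n. rcount i * rcount (n - i))" by (rule member_le_sum) auto
    finally show ?thesis using True by simp
  qed simp
  then show ?thesis using num_unlabelled_trees_formula[OF assms] by linarith
qed

lemma rcount_ge_power:
  assumes "0 < b" "b < otter_alpha"
  shows "\<forall>\<^sub>F n in sequentially. b ^ n \<le> real (rcount n)"
proof -
  obtain C where C: "C > 0" "(\<lambda>n. real (num_unlabelled_trees n)) \<sim>[at_top] (\<lambda>n. C * real n powr (-5/2) * otter_alpha ^ n)"
    using otter_alpha_asymp by blast
  define q where "q = otter_alpha / b"
  have q: "q > 1" using assms by (simp add: q_def)
  have "(\<lambda>n. real (num_unlabelled_trees n) / (C * real n powr (-5/2) * otter_alpha ^ n)) \<longlonglongrightarrow> 1"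
  proof (rule asymp_equivD_strong[OF C(2)])
    show "\<forall>\<^sub>F n in sequentially. real (num_unlabelled_trees n) \<noteq> 0 \<or> C * real n powr (-5/2) * otter_alpha ^ n \<noteq> 0"
      using eventually_gt_at_top[of 0] by eventually_elim (use assms C(1) in simp)
  qed
  then have "\<forall>\<^sub>F n in sequentially. 1/2 < real (num_unlabelled_trees n) / (C * real n powr (-5/2) * otter_alpha ^ n)"
    by (rule order_tendstoD) simp
  moreover have "filterlim (\<lambda>n. real n powr (-5/2) * q ^ n) at_top sequentially" using q by real_asymp
  then have "\<forall>\<^sub>F n in sequentially. 2 / C \<le> real n powr (-5/2) * q ^ n" by (simp add: filterlim_at_top)
  ultimately show ?thesis using eventually_ge_at_top[of 1]
  proof eventually_elim
    case (elim n)
    have pos: "C * real n powr (-5/2) * otter_alpha ^ n > 0" using elim(3) C(1) assms by simp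
    have "b ^ n = b ^ n * (C / 2) * (2 / C)" using C(1) by simp
    also have "\<dots> \<le> b ^ n * (C / 2) * (real n powr (-5/2) * q ^ n)"
      using elim(2) C(1) assms by (intro mult_left_mono) auto
    also have "\<dots> = 1/2 * (C * real n powr (-5/2) * otter_alpha ^ n)"
      using assms by (simp add: q_def power_divide)
    also have "\<dots> \<le> real (num_unlabelled_trees n)" using elim(1) pos by (simp add: less_divide_eq)
    also have "\<dots> \<le> real (rcount n)" using num_unlabelled_trees_le_rcount elim(3) by simp
    finally show ?case .
  qed
qed

section \<open>Embedding bounded-degree trees\<close>

inductive bounded_kids :: "nat \<Rightarrow> rtree \<Rightarrow> bool" for K where
  "size M \<le> K \<Longrightarrow> (\<And>s. s \<in># M \<Longrightarrow> bounded_kids K s) \<Longrightarrow> bounded_kids K (Node M)"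

lemma bounded_kids_Node: "bounded_kids K (Node M) \<longleftrightarrow> size M \<le> K \<and> (\<forall>s\<in>#M. bounded_kids K s)"
  by (auto intro: bounded_kids.intros elim: bounded_kids.cases)

lemma size_le_msz: "size M \<le> msz M"
proof (induction M)
  case (add t M)
  then show ?case by (cases t) simp
qed simp

lemma bounded_kids_small: "sz t \<le> Suc K \<Longrightarrow> bounded_kids K t"
proof (induction t)
  case (Node M)
  have "size M \<le> K" using Node.prems size_le_msz[of M] by simp
  moreover have "bounded_kids K s" if "s \<in># M" for s
    using Node.IH[of s] that sz_kid_less[OF that] Node.prems by simp
  ultimately show ?case by (simp add: bounded_kids_Node)
qed

fun chain :: "rtree list \<Rightarrow> rtree" where
  "chain [] = Node {#}"
| "chain [t] = t"
| "chain (t # u # ts) = Node (add_mset (chain (u # ts)) (kids t))"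

lemma sz_chain: "\<forall>t\<in>set ts. sz t = k \<Longrightarrow> ts \<noteq> [] \<Longrightarrow> sz (chain ts) = k * length ts"
proof (induction ts rule: chain.induct)
  case (3 t u ts)
  then have "sz t = k" "sz (chain (u # ts)) = k * length (u # ts)" by auto
  then show ?case by (cases t) (simp add: algebra_simps)
qed auto

lemma msz_kids: "Suc (msz (kids t)) = sz t"
  by (cases t) simp

text \<open>The root of a tree with k vertices has at most k - 1 children, which leaves room for the
  one that continues the chain.\<close>

lemma bounded_kids_chain:
  "\<forall>t\<in>set ts. sz t = k \<Longrightarrow> ts \<noteq> [] \<Longrightarrow> bounded_kids k (chain ts)"
proof (induction ts rule: chain.induct)
  case (2 t)
  then show ?case by (intro bounded_kids_small) simp
next
  case (3 t u ts)
  have "bounded_kids k t" using 3 by (intro bounded_kids_small) simp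
  moreover have "size (kids t) < k" using size_le_msz[of "kids t"] msz_kids[of t] 3 by simp
  ultimately show ?case using 3 by (cases t) (simp add: bounded_kids_Node)
qed simp

text \<open>The continuation of the chain has at least k vertices, while the other branches at the
  root have k - 1 together. So it is recognisable by \<open>big_branch_unique\<close> and the first
  block can be peeled off.\<close>

lemma chain_inj:
  assumes "\<forall>t\<in>set ts. sz t = k" "\<forall>t\<in>set us. sz t = k" "length ts = length us" "chain ts = chain us"
  shows "ts = us"
  using assms
proof (induction ts arbitrary: us rule: chain.induct)
  case (2 t)
  then obtain u where "us = [u]" by (metis length_0_conv length_Suc_conv)
  then show ?case using 2 by simp
next
  case (3 t t' ts)
  obtain u u' us' where us: "us = u # u' # us'" using 3(4) by (metis length_Suc_conv)
  have eq: "add_mset (chain (t' # ts)) (kids t) = add_mset (chain (u' # us')) (kids u)"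
    using 3(5) us by simp
  have k: "sz t = k" "sz u = k" using 3(2,3) us by auto
  have "\<forall>t\<in>set (t' # ts). sz t = k" "\<forall>t\<in>set (u' # us'). sz t = k" using 3(2,3) us by auto
  then have "sz (chain (t' # ts)) = k * length (t' # ts)" "sz (chain (u' # us')) = k * length (u' # us')"
    by (blast intro: sz_chain)+
  then have "k \<le> sz (chain (t' # ts))" "k \<le> sz (chain (u' # us'))" by simp_all
  then have big: "msz (kids t) < sz (chain (t' # ts))" "msz (kids u) < sz (chain (u' # us'))"
    using msz_kids[of t] msz_kids[of u] k by simp_all
  have "chain (t' # ts) = chain (u' # us')" "kids t = kids u"
    using big_branch_unique[OF eq big] .
  moreover from this(1) have "t' # ts = u' # us'" using 3(2-4) us by (intro "3.IH") auto
  ultimately show ?case using us by (simp add: rtree.expand)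
qed simp

lemma many_bounded_trees:
  assumes "q \<ge> 1"
  shows "rcount k ^ q \<le> card {t \<in> rtrees (k * q). bounded_kids k t}"
proof -
  let ?L = "{ts. set ts \<subseteq> rtrees k \<and> length ts = q}"
  have sz: "\<forall>t\<in>set ts. sz t = k" if "ts \<in> ?L" for ts using that by (auto simp: rtrees_def)
  have "inj_on chain ?L"
    using sz by (intro inj_onI chain_inj[of _ k]) auto
  then have "card ?L = card (chain ` ?L)" by (simp add: card_image)
  also have "\<dots> \<le> card {t \<in> rtrees (k * q). bounded_kids k t}"
  proof (rule card_mono)
    show "chain ` ?L \<subseteq> {t \<in> rtrees (k * q). bounded_kids k t}"
    proof
      fix t assume "t \<in> chain ` ?L"
      then obtain ts where ts: "t = chain ts" "ts \<in> ?L" by blast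
      then have "ts \<noteq> []" using assms by auto
      then show "t \<in> {t \<in> rtrees (k * q). bounded_kids k t}"
        using sz_chain[OF sz[OF ts(2)]] bounded_kids_chain[OF sz[OF ts(2)]] ts by (simp add: rtrees_def)
    qed
  qed simp
  finally show ?thesis by (simp add: card_lists_length_eq rcount_def)
qed

section \<open>The extension argument\<close>

definition nbh :: "nat \<Rightarrow> nat set set \<Rightarrow> nat set \<Rightarrow> nat set" where
  "nbh n E U = {y. y < n \<and> (\<exists>x\<in>U. {x, y} \<in> E)}"

definition joined :: "nat \<Rightarrow> nat \<Rightarrow> nat set set \<Rightarrow> bool" where
  "joined n m E \<longleftrightarrow> (\<forall>A B. A \<subseteq> {..<n} \<and> B \<subseteq> {..<n} \<and> m \<le> card A \<and> m \<le> card B \<longrightarrow> (\<exists>a\<in>A. \<exists>b\<in>B. {a, b} \<in> E))"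

text \<open>The number c x is the number of children still to be attached to the vertex x, for used
  vertices (those in V) and unused vertices alike.\<close>
definition extendable :: "nat \<Rightarrow> nat \<Rightarrow> nat set set \<Rightarrow> nat set \<Rightarrow> (nat \<Rightarrow> nat) \<Rightarrow> bool" where
  "extendable n m E V c \<longleftrightarrow>
    (\<forall>U. U \<subseteq> {..<n} \<and> card U \<le> 2 * m \<longrightarrow> (\<Sum>x\<in>U. c x) \<le> card (nbh n E U - V))"

lemma finite_nbh [simp]: "finite (nbh n E U)"
  by (rule finite_subset[of _ "{..<n}"]) (auto simp: nbh_def)

lemma nbh_Un: "nbh n E (A \<union> B) = nbh n E A \<union> nbh n E B"
  by (auto simp: nbh_def)

lemma card_nbh_joined:
  assumes "joined n m E" "U \<subseteq> {..<n}" "m \<le> card U"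
  shows "n < card (nbh n E U) + m"
proof (rule ccontr)
  assume no: "\<not> n < card (nbh n E U) + m"
  have "nbh n E U \<subseteq> {..<n}" by (auto simp: nbh_def)
  then have "card ({..<n} - nbh n E U) = n - card (nbh n E U)" by (simp add: card_Diff_subset)
  then have "m \<le> card ({..<n} - nbh n E U)" using no by simp
  then obtain a b where ab: "a \<in> U" "b \<in> {..<n} - nbh n E U" "{a, b} \<in> E"
    using assms unfolding joined_def by (metis Diff_subset)
  then show False by (auto simp: nbh_def)
qed

text \<open>If no neighbour y of s can be added, each y lies in the neighbourhood of a tight set avoiding s.
  Tight sets are smaller than m, so by submodularity the union of all of them is tight, and
  adding s to it violates extendability.\<close>
lemma extend_leaf:
  assumes joined: "joined n m E" and m: "m \<ge> 1" and ext: "extendable n m E V c"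
    and V: "V \<subseteq> {..<n}" and size: "card V + m + 2 * m * K \<le> n"
    and s: "s < n" "c s \<ge> 1" and cK: "\<And>x. c x \<le> K"
  shows "\<exists>y<n. y \<notin> V \<and> {s, y} \<in> E \<and> extendable n m E (insert y V) (c(s := c s - 1))"
proof (rule ccontr)
  assume no: "\<not> ?thesis"
  define tight where "tight U \<longleftrightarrow> U \<subseteq> {..<n} \<and> card U \<le> 2 * m \<and> card (nbh n E U - V) \<le> (\<Sum>x\<in>U. c x)" for U
  have finV: "finite V" using V finite_subset by blast
  have extD: "(\<Sum>x\<in>U. c x) \<le> card (nbh n E U - V)" if "U \<subseteq> {..<n}" "card U \<le> 2 * m" for U
    using ext that unfolding extendable_def by blast
  \<comment> \<open>A set with at least \<open>m\<close> vertices has fewer than \<open>m\<close>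
    non-neighbours, so more than \<open>2 * m * K\<close> of its neighbours are free by the size
    assumption. This exceeds the demand of any set with at most \<open>2 * m\<close>
    vertices.\<close>
  have small: "card U < m" if U: "tight U" for U
  proof (rule ccontr)
    assume "\<not> card U < m"
    then have "n < card (nbh n E U) + m" using U by (intro card_nbh_joined[OF joined]) (auto simp: tight_def)
    moreover have "card (nbh n E U) - card V \<le> card (nbh n E U - V)" by (rule diff_card_le_card_Diff[OF finV])
    moreover have "card (nbh n E U - V) \<le> (\<Sum>x\<in>U. c x)" using U by (simp add: tight_def)
    moreover have "(\<Sum>x\<in>U. c x) \<le> card U * K" using cK sum_bounded_above[of U c K] by simp
    moreover have "card U * K \<le> 2 * m * K" using U by (simp add: tight_def)
    ultimately show False using size by linarith
  qed
  have ex_tight: "\<exists>U. tight U \<and> s \<notin> U \<and> y \<in> nbh n E U" if y: "y \<in> nbh n E {s} - V" for y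
  proof -
    have y': "y < n" "y \<notin> V" "{s, y} \<in> E" using y by (auto simp: nbh_def)
    then have "\<not> extendable n m E (insert y V) (c(s := c s - 1))" using no by blast
    then obtain U where U: "U \<subseteq> {..<n}" "card U \<le> 2 * m"
      "card (nbh n E U - insert y V) < (\<Sum>x\<in>U. (c(s := c s - 1)) x)"
      unfolding extendable_def by (meson not_le)
    have finU: "finite U" using U(1) finite_subset by blast
    have yU: "card (nbh n E U - V) = Suc (card (nbh n E U - insert y V))" if "y \<in> nbh n E U"
    proof -
      have eq: "nbh n E U - V = insert y (nbh n E U - insert y V)" using that y' by auto
      show ?thesis by (subst eq) simp
    qed
    \<comment> \<open>If \<open>s\<close> were in \<open>U\<close>, the demand of \<open>U\<close>
      would drop by one together with its free neighbourhood, and \<open>U\<close> would not be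
      violated.\<close>
    have "s \<notin> U"
    proof
      assume sU: "s \<in> U"
      then have "y \<in> nbh n E U" using y' by (auto simp: nbh_def)
      moreover have "(\<Sum>x\<in>U. c x) = Suc (\<Sum>x\<in>U. (c(s := c s - 1)) x)"
        using s(2) by (simp add: sum.remove[OF finU sU])
      ultimately show False using yU U(3) extD[OF U(1,2)] by linarith
    qed
    then have eq: "(\<Sum>x\<in>U. (c(s := c s - 1)) x) = (\<Sum>x\<in>U. c x)" by (intro sum.cong) auto
    have "y \<in> nbh n E U"
    proof (rule ccontr)
      assume "y \<notin> nbh n E U"
      then have "nbh n E U - insert y V = nbh n E U - V" by auto
      then show False using U(3) eq extD[OF U(1,2)] by simp
    qed
    moreover have "tight U" using U eq yU[OF \<open>y \<in> nbh n E U\<close>] by (simp add: tight_def)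
    ultimately show ?thesis using \<open>s \<notin> U\<close> by blast
  qed
  \<comment> \<open>Demand is modular and the free neighbourhood submodular. Since both sets have
    fewer than \<open>m\<close> vertices, their union stays within the range \<open>2 * m\<close> of
    the extendability condition.\<close>
  have tight_Un: "tight (A \<union> B)" if A: "tight A" and B: "tight B" for A B
  proof -
    have sub: "A \<subseteq> {..<n}" "B \<subseteq> {..<n}" using A B by (auto simp: tight_def)
    then have fin: "finite A" "finite B" using finite_subset by blast+
    have "card (A \<union> B) \<le> card A + card B" by (rule card_Un_le)
    then have card: "card (A \<union> B) \<le> 2 * m" using small[OF A] small[OF B] by linarith
    have "card (A \<inter> B) \<le> card A" using fin by (intro card_mono) auto
    then have int: "(\<Sum>x\<in>A \<inter> B. c x) \<le> card (nbh n E (A \<inter> B) - V)"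
      using sub small[OF A] by (intro extD) auto
    have "card (nbh n E (A \<inter> B) - V) \<le> card ((nbh n E A - V) \<inter> (nbh n E B - V))"
      by (intro card_mono) (auto simp: nbh_def)
    moreover have "card (nbh n E A - V) + card (nbh n E B - V) =
        card (nbh n E (A \<union> B) - V) + card ((nbh n E A - V) \<inter> (nbh n E B - V))"
      by (subst card_Un_Int) (auto simp: nbh_Un Un_Diff)
    moreover have "(\<Sum>x\<in>A \<union> B. c x) + (\<Sum>x\<in>A \<inter> B. c x) = (\<Sum>x\<in>A. c x) + (\<Sum>x\<in>B. c x)"
      using fin by (rule sum.union_inter)
    moreover have "card (nbh n E A - V) \<le> (\<Sum>x\<in>A. c x)" "card (nbh n E B - V) \<le> (\<Sum>x\<in>B. c x)"
      using A B by (simp_all add: tight_def)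
    ultimately show ?thesis using int sub card by (simp add: tight_def)
  qed
  have "\<exists>U. tight U \<and> s \<notin> U \<and> Y \<subseteq> nbh n E U" if "finite Y" "Y \<subseteq> nbh n E {s} - V" for Y
    using that
  proof (induction rule: finite_induct)
    case empty
    have "tight {}" by (simp add: tight_def nbh_def)
    then show ?case by blast
  next
    case (insert y Y)
    obtain A where A: "tight A" "s \<notin> A" "Y \<subseteq> nbh n E A" using insert by auto
    obtain B where B: "tight B" "s \<notin> B" "y \<in> nbh n E B" using ex_tight[of y] insert by auto
    show ?case using A B tight_Un[OF A(1) B(1)] by (intro exI[of _ "A \<union> B"]) (auto simp: nbh_Un)
  qed
  from this[of "nbh n E {s} - V"] obtain U where U: "tight U" "s \<notin> U" "nbh n E {s} - V \<subseteq> nbh n E U"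
    by auto
  have sub: "insert s U \<subseteq> {..<n}" using U s by (auto simp: tight_def)
  have finU: "finite U" using finite_subset[OF sub] by simp
  have "card (insert s U) \<le> 2 * m" using small[OF U(1)] m U(2) finU by simp
  from extD[OF sub this] have "c s + (\<Sum>x\<in>U. c x) \<le> card (nbh n E (insert s U) - V)"
    using U(2) finU by simp
  moreover have "nbh n E (insert s U) - V = nbh n E U - V"
    using U(3) nbh_Un[of n E "{s}" U] by auto
  moreover have "card (nbh n E U - V) \<le> (\<Sum>x\<in>U. c x)" using U(1) by (simp add: tight_def)
  ultimately show False using s(2) by simp
qed

text \<open>Places a copy of \<open>s\<close> so that its root becomes a child of the used vertex
  \<open>v\<close>. The new root keeps a demand of \<open>K\<close> minus its number of children,
  and used vertices other than \<open>v\<close> keep theirs; so in the join step the induction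
  hypothesis applies twice, first to the tree without its last branch and then to that branch below
  the new root.\<close>

lemma embed_below:
  assumes joined: "joined n m E" and m: "m \<ge> 1"
    and "bounded_kids K s" "extendable n m E V c" "V \<subseteq> {..<n}" "card V + sz s + m + 2 * m * K \<le> n"
    and "v \<in> V" "c v \<ge> 1" "\<And>x. c x \<le> K" "\<And>x. x \<notin> V \<Longrightarrow> c x = K"
  shows "\<exists>W F w c'. V \<inter> W = {} \<and> W \<subseteq> {..<n} \<and> rep W F w s \<and> F \<subseteq> E \<and> {v, w} \<in> E \<and>
    extendable n m E (V \<union> W) c' \<and> c' v = c v - 1 \<and> (\<forall>x\<in>V - {v}. c' x = c x) \<and> c' w = K - size (kids s) \<and>
    (\<forall>x. c' x \<le> K) \<and> (\<forall>x. x \<notin> V \<union> W \<longrightarrow> c' x = K)"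
  using assms(3-)
proof (induction s arbitrary: V c v rule: rtree_join_induct)
  case single
  have "v < n" using single by auto
  have "card V + m + 2 * m * K \<le> n" using single(4) by simp
  then obtain y where y: "y < n" "y \<notin> V" "{v, y} \<in> E" "extendable n m E (insert y V) (c(v := c v - 1))"
    using extend_leaf[OF joined m single(2,3) _ \<open>v < n\<close> single(6,7)] by blast
  have "y \<noteq> v" using y single by auto
  define c1 where "c1 = c(v := c v - 1)"
  have cK: "c1 x \<le> K" for x
  proof (cases "x = v")
    case True
    then show ?thesis using single(7)[of v] by (simp add: c1_def)
  qed (use single(7) in \<open>simp add: c1_def\<close>)
  have "c1 y = K - size (kids (Node {#}))" "c1 v = c v - 1" "\<forall>x\<in>V - {v}. c1 x = c x"
    using single(8)[of y] y(2) \<open>y \<noteq> v\<close> by (simp_all add: c1_def)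
  moreover have "\<forall>x. x \<notin> V \<union> {y} \<longrightarrow> c1 x = K" using single(5,8) by (auto simp: c1_def)
  moreover have "extendable n m E (V \<union> {y}) c1" using y(4) by (simp add: c1_def)
  moreover have "V \<inter> {y} = {}" "{y} \<subseteq> {..<n}" "rep {y} {} y (Node {#})" using y by (auto intro: rep.rep_single)
  ultimately show ?case using y(3) cK by (intro exI[of _ "{y}"] exI[of _ "{}"] exI[of _ y] exI[of _ c1]) simp
next
  case (join s M)
  have bs: "bounded_kids K s" and bM: "bounded_kids K (Node M)" and sM: "Suc (size M) \<le> K"
    using join.prems(1) by (simp_all add: bounded_kids_Node)
  have "card V + sz (Node M) + m + 2 * m * K \<le> n" using join.prems(4) by simp
  from join.IH(2)[OF bM join.prems(2,3) this join.prems(5-8)]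
  obtain W1 F1 w c1 where 1: "V \<inter> W1 = {}" "W1 \<subseteq> {..<n}" "rep W1 F1 w (Node M)" "F1 \<subseteq> E" "{v, w} \<in> E"
    "extendable n m E (V \<union> W1) c1" "c1 v = c v - 1" "\<forall>x\<in>V - {v}. c1 x = c x" "c1 w = K - size M"
    "\<forall>x. c1 x \<le> K" "\<forall>x. x \<notin> V \<union> W1 \<longrightarrow> c1 x = K"
    by auto
  have finV: "finite V" using join.prems(3) finite_subset by blast
  have "card (V \<union> W1) = card V + sz (Node M)"
    using 1(1) finV rep_finite[OF 1(3)] rep_card[OF 1(3)] by (simp add: card_Un_disjoint)
  then have sz: "card (V \<union> W1) + sz s + m + 2 * m * K \<le> n" using join.prems(4) by simp
  have w: "w \<in> W1" using rep_root[OF 1(3)] .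
  have sub: "V \<union> W1 \<subseteq> {..<n}" using join.prems(3) 1(2) by simp
  have cw: "c1 w \<ge> 1" using 1(9) sM by simp
  have "w \<in> V \<union> W1" using w by simp
  from join.IH(1)[OF bs 1(6) sub sz this cw 1(10)[rule_format] 1(11)[rule_format]]
  obtain W2 F2 w2 c2 where 2: "(V \<union> W1) \<inter> W2 = {}" "W2 \<subseteq> {..<n}" "rep W2 F2 w2 s" "F2 \<subseteq> E" "{w, w2} \<in> E"
    "extendable n m E (V \<union> W1 \<union> W2) c2" "c2 w = c1 w - 1" "\<forall>x\<in>V \<union> W1 - {w}. c2 x = c1 x"
    "\<forall>x. c2 x \<le> K" "\<forall>x. x \<notin> V \<union> W1 \<union> W2 \<longrightarrow> c2 x = K"
    by blast
  have v: "v \<in> V \<union> W1 - {w}" using join.prems(5) w 1(1) by auto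
  have "V \<inter> (W1 \<union> W2) = {}" "W1 \<union> W2 \<subseteq> {..<n}" using 1(1,2) 2(1,2) by auto
  moreover have "rep (W1 \<union> W2) (insert {w, w2} (F1 \<union> F2)) w (Node (add_mset s M))"
    using 1(3) 2(3,1) by (intro rep.rep_join) auto
  moreover have "insert {w, w2} (F1 \<union> F2) \<subseteq> E" using 1(4) 2(4,5) by simp
  moreover have "extendable n m E (V \<union> (W1 \<union> W2)) c2" using 2(6) by (simp add: Un_assoc)
  moreover have "c2 v = c v - 1" using 2(8) v 1(7) by simp
  moreover have "c2 x = c x" if "x \<in> V - {v}" for x
  proof -
    have "x \<in> V \<union> W1 - {w}" using that w 1(1) by auto
    then show ?thesis using 2(8) 1(8) that by simp
  qed
  moreover have "c2 w = K - size (kids (Node (add_mset s M)))" using 2(7) 1(9) by simp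
  moreover have "\<forall>x. x \<notin> V \<union> (W1 \<union> W2) \<longrightarrow> c2 x = K" using 2(10) by simp
  ultimately show ?case using 1(5) 2(9)
    by (intro exI[of _ "W1 \<union> W2"] exI[of _ "insert {w, w2} (F1 \<union> F2)"] exI[of _ w] exI[of _ c2]) simp
qed

text \<open>The tree hangs below the auxiliary vertex 0. This costs one vertex of room and one free
  neighbour per set, whence \<open>Suc (sz s)\<close> and the expansion factor \<open>K + 1\<close>
  instead of \<open>K\<close>.\<close>

lemma embed_tree:
  assumes "joined n m E" "m \<ge> 1" "K \<ge> 1" "bounded_kids K s" "Suc (sz s) + m + 2 * m * K \<le> n"
    and expand: "\<And>U. U \<subseteq> {..<n} \<Longrightarrow> U \<noteq> {} \<Longrightarrow> card U \<le> 2 * m \<Longrightarrow> (K + 1) * card U \<le> card (nbh n E U)"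
  shows "\<exists>W F w. W \<subseteq> {..<n} \<and> rep W F w s \<and> F \<subseteq> E"
proof -
  have "extendable n m E {0} (\<lambda>_. K)"
    unfolding extendable_def
  proof (intro allI impI)
    fix U assume U: "U \<subseteq> {..<n} \<and> card U \<le> 2 * m"
    have "card U * K \<le> card (nbh n E U - {0})"
    proof (cases "U = {}")
      case False
      moreover have "finite U" using U finite_subset by blast
      ultimately have "card U \<ge> 1" by (simp add: Suc_le_eq card_gt_0_iff)
      moreover have "(K + 1) * card U \<le> card (nbh n E U)" using U False by (intro expand) auto
      moreover have "card (nbh n E U) - card {0::nat} \<le> card (nbh n E U - {0})"
        by (rule diff_card_le_card_Diff) simp
      ultimately show ?thesis by (simp add: algebra_simps)
    qed simp
    then show "(\<Sum>x\<in>U. K) \<le> card (nbh n E U - {0})" by simp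
  qed
  moreover have "{0} \<subseteq> {..<n}" using assms(5) by auto
  moreover have "card {0::nat} + sz s + m + 2 * m * K \<le> n" using assms(5) by simp
  ultimately show ?thesis
    using embed_below[OF assms(1,2,4), of "{0}" "\<lambda>_. K" 0] assms(3) by auto
qed

section \<open>Expander mixing\<close>

lemma real_rooted_split:
  fixes p :: "real poly"
  assumes "lead_coeff p = 1" "\<And>z. poly (map_poly complex_of_real p) z = 0 \<Longrightarrow> Im z = 0"
  shows "p = (\<Prod>a\<in>#proots p. [:- a, 1:])"
  using assms
proof (induction "degree p" arbitrary: p)
  case 0
  then obtain c where "p = [:c:]" by (metis degree_eq_zeroE)
  then have "p = 1" using 0 by (simp add: one_pCons)
  then show ?case by simp
next
  case (Suc k)
  have "degree (map_poly complex_of_real p) = Suc k"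
    using Suc.hyps(2) by (simp add: degree_map_poly)
  then have nc: "\<not> constant (poly (map_poly complex_of_real p))" by (simp add: constant_degree)
  obtain z where z: "poly (map_poly complex_of_real p) z = 0"
    using Fundamental_Theorem_Algebra.fundamental_theorem_of_algebra[OF nc] by (elim exE)
  then have "Im z = 0" by (rule Suc.prems(2))
  then have "z = complex_of_real (Re z)" by (simp add: complex_eq_iff)
  moreover have "poly (map_poly complex_of_real p) (complex_of_real x) = complex_of_real (poly p x)" for x
    by simp
  ultimately have "poly p (Re z) = 0" using z by (metis of_real_eq_0_iff)
  then obtain q where q: "p = [:- Re z, 1:] * q" by (auto simp: poly_eq_0_iff_dvd elim: dvdE)
  have "q \<noteq> 0" using Suc.hyps(2) q by auto
  have "lead_coeff q = 1" using Suc.prems(1) unfolding q lead_coeff_mult by simp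
  have "degree p = Suc (degree q)" unfolding q using \<open>q \<noteq> 0\<close> by (subst degree_mult_eq) auto
  then have "k = degree q" using Suc.hyps(2) by simp
  moreover have "Im w = 0" if "poly (map_poly complex_of_real q) w = 0" for w
  proof -
    have "map_poly complex_of_real (a * b) = map_poly complex_of_real a * map_poly complex_of_real b" for a b
      by (rule poly_eqI) (simp add: coeff_map_poly coeff_mult)
    from this[of "[:- Re z, 1:]" q]
    have "map_poly complex_of_real p = map_poly complex_of_real [:- Re z, 1:] * map_poly complex_of_real q"
      by (simp only: q[symmetric])
    then show ?thesis using that by (intro Suc.prems(2)) simp
  qed
  ultimately have IH: "q = (\<Prod>a\<in>#proots q. [:- a, 1:])"
    using \<open>lead_coeff q = 1\<close> by (intro Suc.hyps(1)) auto
  have "proots p = add_mset (Re z) (proots q)"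
    unfolding q using \<open>q \<noteq> 0\<close> by (subst proots_mult) auto
  then show ?case using IH q by simp
qed

lemma nonzero_vec_index:
  assumes "v \<in> carrier_vec n" "v \<noteq> 0\<^sub>v n"
  shows "\<exists>i<n. vec_index v i \<noteq> 0"
proof (rule ccontr)
  assume "\<not> ?thesis"
  then have "v = 0\<^sub>v n" using assms(1) by (intro eq_vecI) auto
  then show False using assms(2) by simp
qed

text \<open>For an eigenvector v the form v* A v equals its own conjugate by symmetry, and it is z
  times the positive number |v|^2.\<close>

lemma symmetric_eigenvalue_real:
  fixes A :: "real mat"
  assumes A: "A \<in> carrier_mat n n" and sym: "\<And>i j. i < n \<Longrightarrow> j < n \<Longrightarrow> A $$ (i, j) = A $$ (j, i)"
    and root: "poly (map_poly complex_of_real (char_poly A)) z = 0"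
  shows "Im z = 0"
proof -
  let ?B = "map_mat complex_of_real A"
  have B: "?B \<in> carrier_mat n n" using A by simp
  have "poly (char_poly ?B) z = 0" using root by (simp add: of_real_hom.char_poly_hom[OF A])
  then have "eigenvalue ?B z" using eigenvalue_root_char_poly[OF B] by simp
  then obtain v where v: "v \<in> carrier_vec n" "v \<noteq> 0\<^sub>v n" "?B *\<^sub>v v = z \<cdot>\<^sub>v v"
    using B unfolding eigenvalue_def eigenvector_def by auto
  define f where "f i = vec_index v i" for i
  have Bf: "(\<Sum>j<n. complex_of_real (A $$ (i, j)) * f j) = z * f i" if "i < n" for i
  proof -
    have "vec_index (?B *\<^sub>v v) i = (\<Sum>j<n. complex_of_real (A $$ (i, j)) * f j)"
      using A v(1) that by (simp add: scalar_prod_def f_def atLeast0LessThan)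
    then show ?thesis using v that by (simp add: f_def)
  qed
  define S where "S = (\<Sum>i<n. \<Sum>j<n. cnj (f i) * complex_of_real (A $$ (i, j)) * f j)"
  have "cnj S = (\<Sum>i<n. \<Sum>j<n. f i * complex_of_real (A $$ (i, j)) * cnj (f j))"
    by (simp add: S_def)
  also have "\<dots> = (\<Sum>j<n. \<Sum>i<n. f i * complex_of_real (A $$ (i, j)) * cnj (f j))"
    by (rule sum.swap)
  also have "\<dots> = S" unfolding S_def
  proof (intro sum.cong refl)
    fix i j assume "i \<in> {..<n}" "j \<in> {..<n}"
    then show "f j * complex_of_real (A $$ (j, i)) * cnj (f i) = cnj (f i) * complex_of_real (A $$ (i, j)) * f j"
      using sym[of i j] by simp
  qed
  finally have "Im (cnj S) = Im S" by (rule arg_cong)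
  then have "Im S = 0" by simp
  have "S = (\<Sum>i<n. cnj (f i) * (z * f i))"
    unfolding S_def
  proof (intro sum.cong refl)
    fix i assume "i \<in> {..<n}"
    then show "(\<Sum>j<n. cnj (f i) * complex_of_real (A $$ (i, j)) * f j) = cnj (f i) * (z * f i)"
      using Bf[of i] by (simp only: mult.assoc sum_distrib_left[symmetric] lessThan_iff)
  qed
  also have "\<dots> = z * complex_of_real (\<Sum>i<n. (cmod (f i))\<^sup>2)"
    unfolding of_real_sum sum_distrib_left
  proof (intro sum.cong refl)
    fix i show "cnj (f i) * (z * f i) = z * complex_of_real ((cmod (f i))\<^sup>2)"
      unfolding complex_norm_square by (simp only: mult_ac)
  qed
  finally have S: "S = z * complex_of_real (\<Sum>i<n. (cmod (f i))\<^sup>2)" .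
  obtain i where i: "i < n" "f i \<noteq> 0" using nonzero_vec_index[OF v(1,2)] by (auto simp: f_def)
  have "0 < (cmod (f i))\<^sup>2" using i by simp
  also have "\<dots> \<le> (\<Sum>i<n. (cmod (f i))\<^sup>2)" using i by (intro member_le_sum) auto
  finally show ?thesis using \<open>Im S = 0\<close> S by simp
qed

lemma upper_triangular_pow:
  fixes B :: "'a :: comm_ring_1 mat"
  assumes B: "B \<in> carrier_mat n n" "upper_triangular B"
  shows "\<forall>i<n. \<forall>j<n. (j < i \<longrightarrow> (B ^\<^sub>m k) $$ (i, j) = 0) \<and> (j = i \<longrightarrow> (B ^\<^sub>m k) $$ (i, j) = (B $$ (i, i)) ^ k)"
proof (induction k)
  case 0
  then show ?case using B by auto
next
  case (Suc k)
  have C: "B ^\<^sub>m k \<in> carrier_mat n n" using B by simp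
  have tri: "B $$ (i, j) = 0" if "i < n" "j < i" for i j using B that by auto
  show ?case
  proof (intro allI impI)
    fix i j assume ij: "i < n" "j < n"
    have entry: "(B ^\<^sub>m Suc k) $$ (i, j) = (\<Sum>l<n. (B ^\<^sub>m k) $$ (i, l) * B $$ (l, j))"
      using B C ij by (simp add: scalar_prod_def atLeast0LessThan)
    show "(j < i \<longrightarrow> (B ^\<^sub>m Suc k) $$ (i, j) = 0) \<and> (j = i \<longrightarrow> (B ^\<^sub>m Suc k) $$ (i, j) = (B $$ (i, i)) ^ Suc k)"
    proof (intro conjI impI)
      assume "j < i"
      have "(B ^\<^sub>m k) $$ (i, l) * B $$ (l, j) = 0" if "l < n" for l
        using Suc tri[of l j] ij that \<open>j < i\<close> by (cases "l < i") auto
      then show "(B ^\<^sub>m Suc k) $$ (i, j) = 0" unfolding entry by simp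
    next
      assume "j = i"
      have "(B ^\<^sub>m k) $$ (i, l) * B $$ (l, j) = (if l = i then (B $$ (i, i)) ^ k * B $$ (i, i) else 0)" if "l < n" for l
        using Suc tri[of l j] ij that \<open>j = i\<close> by (cases l i rule: linorder_cases) auto
      then have "(\<Sum>l<n. (B ^\<^sub>m k) $$ (i, l) * B $$ (l, j)) = (\<Sum>l<n. if l = i then (B $$ (i, i)) ^ k * B $$ (i, i) else 0)"
        by (intro sum.cong) auto
      then show "(B ^\<^sub>m Suc k) $$ (i, j) = (B $$ (i, i)) ^ Suc k" unfolding entry using ij by (simp add: mult.commute)
    qed
  qed
qed

lemma trace_comm:
  fixes X Y :: "'a :: comm_ring_1 mat"
  assumes "X \<in> carrier_mat n n" "Y \<in> carrier_mat n n"
  shows "(\<Sum>i<n. (X * Y) $$ (i, i)) = (\<Sum>i<n. (Y * X) $$ (i, i))"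
proof -
  have "(\<Sum>i<n. (X * Y) $$ (i, i)) = (\<Sum>i<n. \<Sum>j<n. X $$ (i, j) * Y $$ (j, i))"
    using assms by (intro sum.cong) (auto simp: scalar_prod_def atLeast0LessThan)
  also have "\<dots> = (\<Sum>j<n. \<Sum>i<n. X $$ (i, j) * Y $$ (j, i))" by (rule sum.swap)
  also have "\<dots> = (\<Sum>i<n. (Y * X) $$ (i, i))"
    using assms by (intro sum.cong) (auto simp: scalar_prod_def atLeast0LessThan mult.commute)
  finally show ?thesis .
qed

lemma trace_pow_eigenvalues:
  fixes A :: "real mat"
  assumes A: "A \<in> carrier_mat n n" and cp: "char_poly A = (\<Prod>a\<leftarrow>es. [:- a, 1:])"
  shows "length es = n" "(\<Sum>i<n. (A ^\<^sub>m k) $$ (i, i)) = (\<Sum>i<n. (es ! i) ^ k)"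
proof -
  obtain B P Q where "schur_decomposition A es = (B, P, Q)" by (metis prod_cases3)
  from schur_decomposition[OF A cp this]
  have sim: "similar_mat_wit A B P Q" and ut: "upper_triangular B" and dg: "diag_mat B = es" by auto
  have car: "B \<in> carrier_mat n n" "P \<in> carrier_mat n n" "Q \<in> carrier_mat n n" and QP: "Q * P = 1\<^sub>m n"
    using similar_mat_witD2[OF A sim] by auto
  show len: "length es = n" using dg car(1) by (auto simp: diag_mat_def)
  have es: "es ! i = B $$ (i, i)" if "i < n" for i
    using that car(1) unfolding dg[symmetric] diag_mat_def by simp
  have Bk: "B ^\<^sub>m k \<in> carrier_mat n n" using car by simp
  have Ak: "A ^\<^sub>m k = P * (B ^\<^sub>m k * Q)"
    using similar_mat_wit_pow_id[OF sim, of k] car Bk by (simp add: assoc_mult_mat[of _ n n _ n _ n])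
  have "(\<Sum>i<n. (A ^\<^sub>m k) $$ (i, i)) = (\<Sum>i<n. ((B ^\<^sub>m k * Q) * P) $$ (i, i))"
    unfolding Ak by (rule trace_comm) (use car Bk in auto)
  also have "(B ^\<^sub>m k * Q) * P = B ^\<^sub>m k"
    using car Bk QP by (simp add: assoc_mult_mat[of _ n n _ n _ n])
  also have "(\<Sum>i<n. (B ^\<^sub>m k) $$ (i, i)) = (\<Sum>i<n. (es ! i) ^ k)"
    using upper_triangular_pow[OF car(1) ut, of k] es by (intro sum.cong) auto
  finally show "(\<Sum>i<n. (A ^\<^sub>m k) $$ (i, i)) = (\<Sum>i<n. (es ! i) ^ k)" .
qed

lemma adj_matrix_carrier: "adj_matrix n E \<in> carrier_mat n n"
  by (simp add: adj_matrix_def)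

text \<open>\<open>adj_eigenvalues\<close> collects real roots only. Because the characteristic
  polynomial splits over the reals, none is missing and the indices up to n - 1 are
  meaningful.\<close>

lemma adj_char_poly: "char_poly (adj_matrix n E) = (\<Prod>a\<leftarrow>adj_eigenvalues n E. [:- a, 1:])"
proof -
  let ?p = "char_poly (adj_matrix n E)"
  have "?p = (\<Prod>a\<in>#proots ?p. [:- a, 1:])"
  proof (rule real_rooted_split)
    show "lead_coeff ?p = 1" using degree_monic_char_poly[OF adj_matrix_carrier] by auto
    show "Im z = 0" if "poly (map_poly complex_of_real ?p) z = 0" for z
      by (rule symmetric_eigenvalue_real[OF adj_matrix_carrier _ that]) (auto simp: adj_matrix_def insert_commute)
  qed
  also have "proots ?p = mset (adj_eigenvalues n E)" by (simp add: adj_eigenvalues_def)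
  finally show ?thesis by (simp add: prod_mset_prod_list flip: mset_map)
qed

lemma adj_eigenvalues_sorted:
  assumes "i \<le> j" "j < length (adj_eigenvalues n E)"
  shows "adj_eigenvalues n E ! j \<le> adj_eigenvalues n E ! i"
proof -
  let ?s = "sorted_list_of_multiset (proots (char_poly (adj_matrix n E)))"
  have "sorted ?s" by simp
  then show ?thesis using assms unfolding adj_eigenvalues_def
    by (simp add: rev_nth sorted_nth_mono)
qed

text \<open>The ratios of consecutive terms are nondecreasing, so an initial ratio above L contradicts the
  bound for large k.\<close>
lemma log_convex_bound:
  fixes s :: "nat \<Rightarrow> real"
  assumes nonneg: "\<And>k. s k \<ge> 0" and conv: "\<And>k. (s (Suc k))\<^sup>2 \<le> s k * s (Suc (Suc k))"
    and bound: "\<And>k. s k \<le> B * L ^ k" and L: "L > 0"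
  shows "s 1 \<le> L * s 0"
proof (rule ccontr)
  assume "\<not> s 1 \<le> L * s 0"
  then have gt: "L * s 0 < s 1" by simp
  have s0: "s 0 > 0"
  proof (rule ccontr)
    assume "\<not> s 0 > 0"
    then have "s 0 = 0" using nonneg[of 0] by simp
    then show False using conv[of 0] gt by simp
  qed
  define \<rho> where "\<rho> = s 1 / s 0"
  have \<rho>: "\<rho> > L" using gt s0 by (simp add: \<rho>_def field_simps)
  have step: "s k > 0 \<and> \<rho> * s k \<le> s (Suc k)" for k
  proof (induction k)
    case 0
    then show ?case using s0 by (simp add: \<rho>_def)
  next
    case (Suc k)
    have "0 < \<rho> * s k" using Suc \<rho> L by (intro mult_pos_pos) auto
    then have pos: "s (Suc k) > 0" using Suc by linarith
    have "\<rho> * s k * s (Suc k) \<le> s (Suc k) * s (Suc k)" using Suc pos by (intro mult_right_mono) auto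
    also have "\<dots> \<le> s k * s (Suc (Suc k))" using conv[of k] by (simp add: power2_eq_square)
    finally have "s k * (\<rho> * s (Suc k)) \<le> s k * s (Suc (Suc k))" by (simp add: mult_ac)
    then show ?case using Suc pos by simp
  qed
  have lower: "\<rho> ^ k * s 0 \<le> s k" for k
  proof (induction k)
    case (Suc k)
    have "\<rho> ^ Suc k * s 0 = \<rho> * (\<rho> ^ k * s 0)" by simp
    also have "\<dots> \<le> \<rho> * s k" using Suc \<rho> L by (intro mult_left_mono) auto
    also have "\<dots> \<le> s (Suc k)" using step by blast
    finally show ?case .
  qed simp
  obtain k where k: "B / s 0 < (\<rho> / L) ^ k"
    using real_arch_pow[of "\<rho> / L" "B / s 0"] \<rho> L by (auto simp: field_simps)
  have "\<rho> ^ k * s 0 \<le> B * L ^ k" using lower[of k] bound[of k] by simp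
  then have "(\<rho> / L) ^ k \<le> B / s 0" using s0 L by (simp add: power_divide field_simps)
  then show False using k by simp
qed

section \<open>The adjacency matrix as an operator on functions\<close>

definition adj_op :: "nat \<Rightarrow> nat set set \<Rightarrow> (nat \<Rightarrow> real) \<Rightarrow> nat \<Rightarrow> real" where
  "adj_op n E x i = (\<Sum>j<n. if {i, j} \<in> E then x j else 0)"

lemma adj_op_symmetric: "(\<Sum>i<n. adj_op n E x i * y i) = (\<Sum>i<n. x i * adj_op n E y i)"
proof -
  have "(\<Sum>i<n. adj_op n E x i * y i) = (\<Sum>i<n. \<Sum>j<n. if {i, j} \<in> E then x j * y i else 0)"
    unfolding adj_op_def sum_distrib_right by (intro sum.cong) auto
  also have "\<dots> = (\<Sum>j<n. \<Sum>i<n. if {i, j} \<in> E then x j * y i else 0)" by (rule sum.swap)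
  also have "\<dots> = (\<Sum>i<n. x i * adj_op n E y i)"
    unfolding adj_op_def sum_distrib_left by (intro sum.cong) (auto simp: insert_commute)
  finally show ?thesis .
qed

lemma adj_matrix_pow_apply:
  assumes "i < n"
  shows "(\<Sum>j<n. (adj_matrix n E ^\<^sub>m k) $$ (i, j) * x j) = ((adj_op n E) ^^ k) x i"
  using assms
proof (induction k arbitrary: x)
  case 0
  have "(\<Sum>j<n. (adj_matrix n E ^\<^sub>m 0) $$ (i, j) * x j) = (\<Sum>j<n. if j = i then x j else 0)"
    using 0 adj_matrix_carrier[of n E] by (intro sum.cong) auto
  then show ?case using 0 by simp
next
  case (Suc k)
  let ?A = "adj_matrix n E"
  have C: "?A ^\<^sub>m k \<in> carrier_mat n n" "?A \<in> carrier_mat n n" using adj_matrix_carrier by auto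
  have "(\<Sum>j<n. (?A ^\<^sub>m Suc k) $$ (i, j) * x j) = (\<Sum>j<n. \<Sum>l<n. (?A ^\<^sub>m k) $$ (i, l) * ?A $$ (l, j) * x j)"
    using C Suc.prems by (intro sum.cong) (auto simp: scalar_prod_def atLeast0LessThan sum_distrib_right)
  also have "\<dots> = (\<Sum>l<n. \<Sum>j<n. (?A ^\<^sub>m k) $$ (i, l) * ?A $$ (l, j) * x j)" by (rule sum.swap)
  also have "\<dots> = (\<Sum>l<n. (?A ^\<^sub>m k) $$ (i, l) * adj_op n E x l)"
    unfolding adj_op_def sum_distrib_left by (intro sum.cong refl) (auto simp: adj_matrix_def)
  also have "\<dots> = ((adj_op n E) ^^ k) (adj_op n E x) i" using Suc by simp
  finally show ?case by (simp only: funpow_Suc_right o_apply)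
qed

lemma adj_matrix_pow_entry:
  assumes "i < n" "j < n"
  shows "(adj_matrix n E ^\<^sub>m k) $$ (i, j) = ((adj_op n E) ^^ k) (\<lambda>l. if l = j then 1 else 0) i"
  using adj_matrix_pow_apply[OF assms(1), of E k "\<lambda>l. if l = j then 1 else 0"] assms(2)
  by (simp add: if_distrib[of "\<lambda>x. _ * x"] cong: if_cong)

lemma adj_matrix_pow_symmetric:
  assumes "i < n" "j < n"
  shows "(adj_matrix n E ^\<^sub>m k) $$ (i, j) = (adj_matrix n E ^\<^sub>m k) $$ (j, i)"
proof -
  let ?A = "adj_matrix n E"
  have sym: "(\<Sum>i<n. ((adj_op n E) ^^ k) x i * y i) = (\<Sum>i<n. x i * ((adj_op n E) ^^ k) y i)" for x y
  proof (induction k arbitrary: x y)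
    case (Suc k)
    have "(\<Sum>i<n. ((adj_op n E) ^^ Suc k) x i * y i) = (\<Sum>i<n. ((adj_op n E) ^^ k) x i * adj_op n E y i)"
      by (simp add: adj_op_symmetric)
    also have "\<dots> = (\<Sum>i<n. x i * ((adj_op n E) ^^ k) (adj_op n E y) i)" by (rule Suc)
    finally show ?case by (simp only: funpow_Suc_right o_apply)
  qed simp
  show ?thesis
    using sym[of "\<lambda>l. if l = j then 1 else 0" "\<lambda>l. if l = i then 1 else 0"] adj_matrix_pow_entry assms
    by (simp add: if_distrib[of "\<lambda>x. _ * x"] if_distrib[of "\<lambda>x. x * _"] cong: if_cong)
qed

text \<open>Bessel's inequality for two orthogonal vectors: the squared norm of \<open>a\<close>
  minus its projections is nonnegative. It will be applied to the rows of a power of the adjacency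
  matrix.\<close>

lemma bessel_two:
  fixes a u x :: "nat \<Rightarrow> real"
  assumes "(\<Sum>j<n. u j * x j) = 0" "(\<Sum>j<n. (u j)\<^sup>2) > 0" "(\<Sum>j<n. (x j)\<^sup>2) > 0"
  shows "(\<Sum>j<n. a j * u j)\<^sup>2 / (\<Sum>j<n. (u j)\<^sup>2) + (\<Sum>j<n. a j * x j)\<^sup>2 / (\<Sum>j<n. (x j)\<^sup>2) \<le> (\<Sum>j<n. (a j)\<^sup>2)"
proof -
  define U where "U = (\<Sum>j<n. (u j)\<^sup>2)"
  define X where "X = (\<Sum>j<n. (x j)\<^sup>2)"
  define p where "p = (\<Sum>j<n. a j * u j)"
  define q where "q = (\<Sum>j<n. a j * x j)"
  define \<alpha> where "\<alpha> = p / U"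
  define \<beta> where "\<beta> = q / X"
  have "0 \<le> (\<Sum>j<n. (a j - \<alpha> * u j - \<beta> * x j)\<^sup>2)" by (rule sum_nonneg) simp
  also have "\<dots> = (\<Sum>j<n. (a j)\<^sup>2 + \<alpha>\<^sup>2 * (u j)\<^sup>2 + \<beta>\<^sup>2 * (x j)\<^sup>2 - 2 * \<alpha> * (a j * u j) - 2 * \<beta> * (a j * x j) + 2 * \<alpha> * \<beta> * (u j * x j))"
    by (intro sum.cong refl) (simp add: power2_eq_square algebra_simps)
  also have "\<dots> = (\<Sum>j<n. (a j)\<^sup>2) + \<alpha>\<^sup>2 * U + \<beta>\<^sup>2 * X - 2 * \<alpha> * p - 2 * \<beta> * q + 2 * \<alpha> * \<beta> * 0"
    by (simp only: sum.distrib sum_subtractf sum_distrib_left[symmetric] U_def X_def p_def q_def assms(1))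
  also have "\<alpha>\<^sup>2 * U = p\<^sup>2 / U" using assms(2) by (simp add: \<alpha>_def U_def[symmetric] power2_eq_square)
  also have "\<beta>\<^sup>2 * X = q\<^sup>2 / X" using assms(3) by (simp add: \<beta>_def X_def[symmetric] power2_eq_square)
  finally show ?thesis
    unfolding U_def[symmetric] X_def[symmetric] p_def[symmetric] q_def[symmetric]
    by (simp add: \<alpha>_def \<beta>_def power2_eq_square)
qed

lemma trace_adj_matrix_pow:
  "(\<Sum>i<n. (adj_matrix n E ^\<^sub>m (k + k)) $$ (i, i)) = (\<Sum>i<n. \<Sum>j<n. ((adj_matrix n E ^\<^sub>m k) $$ (i, j))\<^sup>2)"
proof (intro sum.cong refl)
  fix i assume "i \<in> {..<n}"
  then have i: "i < n" by simp
  let ?A = "adj_matrix n E" and ?e = "\<lambda>l. if l = i then 1 else 0 :: real"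
  have "(?A ^\<^sub>m (k + k)) $$ (i, i) = ((adj_op n E) ^^ k) (((adj_op n E) ^^ k) ?e) i"
    unfolding adj_matrix_pow_entry[OF i i] funpow_add by simp
  also have "\<dots> = (\<Sum>j<n. (?A ^\<^sub>m k) $$ (i, j) * ((adj_op n E) ^^ k) ?e j)"
    by (rule adj_matrix_pow_apply[OF i, symmetric])
  also have "\<dots> = (\<Sum>j<n. ((?A ^\<^sub>m k) $$ (i, j))\<^sup>2)"
  proof (intro sum.cong refl)
    fix j assume "j \<in> {..<n}"
    then have "((adj_op n E) ^^ k) ?e j = (?A ^\<^sub>m k) $$ (i, j)"
      using adj_matrix_pow_entry[of j n i E k] adj_matrix_pow_symmetric[of i n j E k] i by simp
    then show "(?A ^\<^sub>m k) $$ (i, j) * ((adj_op n E) ^^ k) ?e j = ((?A ^\<^sub>m k) $$ (i, j))\<^sup>2"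
      by (simp add: power2_eq_square)
  qed
  finally show "(?A ^\<^sub>m (k + k)) $$ (i, i) = (\<Sum>j<n. ((?A ^\<^sub>m k) $$ (i, j))\<^sup>2)" .
qed

lemma adj_op_const:
  assumes "regular_graph n d E" "i < n"
  shows "adj_op n E (\<lambda>_. c) i = real d * c"
proof -
  have "adj_op n E (\<lambda>_. c) i = (\<Sum>j\<in>{j \<in> {..<n}. {i, j} \<in> E}. c)"
    unfolding adj_op_def by (rule sum.inter_filter[symmetric]) simp
  also have "{j \<in> {..<n}. {i, j} \<in> E} = {u. u < n \<and> {u, i} \<in> E}" by (auto simp: insert_commute)
  finally show ?thesis using assms by (simp add: regular_graph_def)
qed

lemma adj_op_cong: "(\<And>j. j < n \<Longrightarrow> x j = y j) \<Longrightarrow> adj_op n E x i = adj_op n E y i"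
  unfolding adj_op_def by (intro sum.cong) auto

lemma adj_op_pow_one:
  assumes "regular_graph n d E" "i < n"
  shows "((adj_op n E) ^^ k) (\<lambda>_. 1) i = real d ^ k"
  using assms(2)
proof (induction k arbitrary: i)
  case (Suc k)
  have "adj_op n E (((adj_op n E) ^^ k) (\<lambda>_. 1)) i = adj_op n E (\<lambda>_. real d ^ k) i"
    by (rule adj_op_cong) (rule Suc.IH)
  then show ?case using adj_op_const[OF assms(1) Suc.prems] by simp
qed simp

text \<open>Compare both sides of the eigenvalue equation at an entry of the eigenvector of largest
  absolute value.\<close>

lemma adj_eigenvalue_le_degree:
  assumes reg: "regular_graph n d E" and i: "i < n"
  shows "\<bar>adj_eigenvalues n E ! i\<bar> \<le> real d"
proof -
  let ?A = "adj_matrix n E" and ?es = "adj_eigenvalues n E"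
  define e where "e = ?es ! i"
  have len: "length ?es = n" by (rule trace_pow_eigenvalues(1)[OF adj_matrix_carrier adj_char_poly])
  then have "e \<in> set ?es" using i by (simp add: e_def)
  then have "poly (char_poly ?A) e = 0"
    unfolding adj_char_poly by (auto simp: poly_prod_list prod_list_zero_iff)
  then have "eigenvalue ?A e" using eigenvalue_root_char_poly[OF adj_matrix_carrier] by blast
  then obtain v where v: "v \<in> carrier_vec n" "v \<noteq> 0\<^sub>v n" "?A *\<^sub>v v = e \<cdot>\<^sub>v v"
    using adj_matrix_carrier[of n E] unfolding eigenvalue_def eigenvector_def by auto
  define f where "f i = vec_index v i" for i
  have Af: "adj_op n E f j = e * f j" if "j < n" for j
  proof -
    have "vec_index (?A *\<^sub>v v) j = (\<Sum>l<n. ?A $$ (j, l) * f l)"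
      using v(1) that adj_matrix_carrier[of n E] by (simp add: scalar_prod_def f_def atLeast0LessThan)
    also have "\<dots> = adj_op n E f j"
      unfolding adj_op_def using that by (intro sum.cong) (auto simp: adj_matrix_def)
    finally show ?thesis using v that by (simp add: f_def)
  qed
  obtain l where l: "l < n" "f l \<noteq> 0" using nonzero_vec_index[OF v(1,2)] by (auto simp: f_def)
  have "Max ((\<lambda>j. \<bar>f j\<bar>) ` {..<n}) \<in> (\<lambda>j. \<bar>f j\<bar>) ` {..<n}" using l by (intro Max_in) auto
  then obtain m where m: "m < n" "Max ((\<lambda>j. \<bar>f j\<bar>) ` {..<n}) = \<bar>f m\<bar>" by auto
  have max: "\<bar>f j\<bar> \<le> \<bar>f m\<bar>" if "j < n" for j
    unfolding m(2)[symmetric] using that by (intro Max_ge) auto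
  have "0 < \<bar>f m\<bar>" using max[OF l(1)] l(2) by linarith
  have "\<bar>e\<bar> * \<bar>f m\<bar> = \<bar>adj_op n E f m\<bar>" using Af[OF m(1)] by (simp add: abs_mult)
  also have "\<dots> \<le> (\<Sum>j<n. \<bar>if {m, j} \<in> E then f j else 0\<bar>)" unfolding adj_op_def by (rule sum_abs)
  also have "\<dots> \<le> adj_op n E (\<lambda>_. \<bar>f m\<bar>) m" unfolding adj_op_def using max by (intro sum_mono) auto
  also have "\<dots> = real d * \<bar>f m\<bar>" by (rule adj_op_const[OF reg m(1)])
  finally show ?thesis using \<open>0 < \<bar>f m\<bar>\<close> by (simp add: e_def)
qed

lemma trace_ndl_le:
  assumes ndl: "ndl_graph n d lam E" and n: "n \<ge> 2"
  shows "(\<Sum>i<n. (adj_eigenvalues n E ! i) ^ (k + k)) \<le> real d ^ (k + k) + real n * (lam\<^sup>2) ^ k"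
proof -
  let ?es = "adj_eigenvalues n E"
  have len: "length ?es = n" by (rule trace_pow_eigenvalues(1)[OF adj_matrix_carrier adj_char_poly])
  have lam: "?es ! 1 \<le> lam" "\<bar>?es ! (n - 1)\<bar> \<le> lam" using ndl by (auto simp: ndl_graph_def)
  have sq: "x ^ (k + k) = (x\<^sup>2) ^ k" for x :: real by (simp add: power_mult[symmetric] mult_2)
  have small: "(?es ! i) ^ (k + k) \<le> (lam\<^sup>2) ^ k" if "i \<in> {1..<n}" for i
  proof -
    \<comment> \<open>Sortedness puts every eigenvalue but the first between the last and the
      second, which bound it from below and from above.\<close>
    have "?es ! i \<le> ?es ! 1" "?es ! (n - 1) \<le> ?es ! i"
      using that n len by (auto intro!: adj_eigenvalues_sorted)
    then have "\<bar>?es ! i\<bar> \<le> lam" using lam by linarith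
    then have "(?es ! i)\<^sup>2 \<le> lam\<^sup>2" using power_mono[of "\<bar>?es ! i\<bar>" lam 2] by simp
    then show ?thesis unfolding sq by (rule power_mono) simp
  qed
  have "regular_graph n d E" using ndl by (simp add: ndl_graph_def)
  from adj_eigenvalue_le_degree[OF this, of 0] have "\<bar>?es ! 0\<bar> \<le> real d" using n by simp
  then have "(?es ! 0)\<^sup>2 \<le> (real d)\<^sup>2" using power_mono[of "\<bar>?es ! 0\<bar>" "real d" 2] by simp
  then have first: "(?es ! 0) ^ (k + k) \<le> real d ^ (k + k)" unfolding sq by (rule power_mono) simp
  have "{..<n} = insert 0 {1..<n}" using n by auto
  then have "(\<Sum>i<n. (?es ! i) ^ (k + k)) = (?es ! 0) ^ (k + k) + (\<Sum>i\<in>{1..<n}. (?es ! i) ^ (k + k))" by simp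
  also have "\<dots> \<le> real d ^ (k + k) + (\<Sum>i\<in>{1..<n}. (lam\<^sup>2) ^ k)" by (intro add_mono first sum_mono small)
  also have "\<dots> \<le> real d ^ (k + k) + real n * (lam\<^sup>2) ^ k" by (simp add: mult_right_mono)
  finally show ?thesis .
qed

text \<open>With \<open>x\<close> the indicator of \<open>U\<close> minus its mean and
  \<open>s k\<close> the squared norm of A^k x, the claim follows from s 1 <= lam^2 s 0. Row i of
  A^k has product d^k with the constant vector and (A^k x) i with x, so Bessel's inequality summed
  over the rows gives d^(2k) + s k / s 0 <= trace A^(2k) <= d^(2k) + n lam^(2k). Thus s k <= n s 0
  lam^(2k), and log-convexity of s, which is Cauchy-Schwarz, removes the factor n.\<close>

theorem expander_mixing:
  assumes ndl: "ndl_graph n d lam E" and n: "n \<ge> 2" and lam: "lam > 0" and U: "U \<subseteq> {..<n}"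
  shows "(\<Sum>v<n. (real (card {u \<in> U. {u, v} \<in> E}) - real d * real (card U) / real n)\<^sup>2) \<le> lam\<^sup>2 * real (card U)"
proof -
  let ?A = "adj_matrix n E"
  have reg: "regular_graph n d E" using ndl by (simp add: ndl_graph_def)
  have finU: "finite U" using U finite_subset by blast
  define c where "c = real (card U) / real n"
  define x where "x v = (if v \<in> U then 1 else 0) - c" for v
  define s where "s k = (\<Sum>i<n. (((adj_op n E) ^^ k) x i)\<^sup>2)" for k
  have sumU: "(\<Sum>v<n. if v \<in> U then 1 else 0) = real (card U)"
    using U by (simp add: sum.If_cases Int_absorb1)
  have s0: "s 0 \<le> real (card U)"
  proof -
    have "s 0 = (\<Sum>v<n. (if v \<in> U then 1 else 0) * (1 - 2 * c) + c\<^sup>2)"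
      unfolding s_def x_def by (intro sum.cong) (auto simp: power2_eq_square algebra_simps)
    also have "\<dots> = real (card U) * (1 - 2 * c) + real n * c\<^sup>2"
      by (simp only: sum.distrib sum_distrib_right[symmetric] sumU) simp
    also have "real n * c\<^sup>2 = real (card U) * c" using n by (simp add: c_def power2_eq_square)
    also have "real (card U) * (1 - 2 * c) + real (card U) * c = real (card U) - real (card U) * c"
      by (simp add: algebra_simps)
    finally show ?thesis by (simp add: c_def)
  qed
  have s1: "s 1 = (\<Sum>v<n. (real (card {u \<in> U. {u, v} \<in> E}) - real d * real (card U) / real n)\<^sup>2)"
    unfolding s_def
  proof (intro sum.cong refl)
    fix v assume v: "v \<in> {..<n}"
    have "adj_op n E x v = (\<Sum>j<n. (if {v, j} \<in> E then (if j \<in> U then 1 else 0) else 0) - (if {v, j} \<in> E then c else 0))"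
      unfolding adj_op_def x_def by (intro sum.cong) auto
    also have "\<dots> = (\<Sum>j<n. if {v, j} \<in> E then (if j \<in> U then 1 else 0) else 0) - adj_op n E (\<lambda>_. c) v"
      by (simp add: sum_subtractf adj_op_def)
    also have "(\<Sum>j<n. if {v, j} \<in> E then (if j \<in> U then 1 else 0) else 0) = (\<Sum>j<n. if j \<in> {u \<in> U. {u, v} \<in> E} then 1 else (0::real))"
      by (intro sum.cong) (auto simp: insert_commute)
    also have "\<dots> = real (card {u \<in> U. {u, v} \<in> E})"
    proof -
      have "{..<n} \<inter> {u \<in> U. {u, v} \<in> E} = {u \<in> U. {u, v} \<in> E}" using U by auto
      then show ?thesis by (subst sum.If_cases) auto
    qed
    also have "adj_op n E (\<lambda>_. c) v = real d * c" using adj_op_const[OF reg] v by simp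
    finally show "(((adj_op n E) ^^ 1) x v)\<^sup>2 = (real (card {u \<in> U. {u, v} \<in> E}) - real d * real (card U) / real n)\<^sup>2"
      by (simp add: c_def)
  qed
  have "s 1 \<le> lam\<^sup>2 * s 0"
  proof (cases "s 0 = 0")
    case True
    have "(x i)\<^sup>2 = 0" if "i < n" for i
      using True that sum_nonneg_eq_0_iff[of "{..<n}" "\<lambda>i. (x i)\<^sup>2"] by (auto simp: s_def)
    then have "adj_op n E x i = 0" for i unfolding adj_op_def by (intro sum.neutral) auto
    then show ?thesis using True by (simp add: s_def)
  next
    case False
    then have X: "s 0 > 0" by (auto simp: s_def intro!: le_neq_trans sum_nonneg)
    show ?thesis
    proof (rule log_convex_bound)
      show "s k \<ge> 0" for k unfolding s_def by (intro sum_nonneg) simp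
      show "lam\<^sup>2 > 0" using lam by simp
      show "(s (Suc k))\<^sup>2 \<le> s k * s (Suc (Suc k))" for k
      proof -
        let ?y = "((adj_op n E) ^^ k) x"
        have "s (Suc k) = (\<Sum>i<n. adj_op n E ?y i * adj_op n E ?y i)" by (simp add: s_def power2_eq_square)
        also have "\<dots> = (\<Sum>i<n. ?y i * adj_op n E (adj_op n E ?y) i)" by (rule adj_op_symmetric)
        finally have "(s (Suc k))\<^sup>2 = (\<Sum>i<n. ?y i * adj_op n E (adj_op n E ?y) i)\<^sup>2" by simp
        also have "\<dots> \<le> (\<Sum>i<n. (?y i)\<^sup>2) * (\<Sum>i<n. (adj_op n E (adj_op n E ?y) i)\<^sup>2)"
          by (rule Cauchy_Schwarz_ineq_sum)
        finally show ?thesis by (simp add: s_def)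
      qed
      show "s k \<le> (real n * s 0) * (lam\<^sup>2) ^ k" for k
      proof -
        have orth: "(\<Sum>j<n. 1 * x j) = 0"
          using n sumU by (simp add: x_def sum_subtractf c_def)
        have "(\<Sum>i<n. (real d ^ k)\<^sup>2 / real n + (((adj_op n E) ^^ k) x i)\<^sup>2 / s 0)
            \<le> (\<Sum>i<n. \<Sum>j<n. ((?A ^\<^sub>m k) $$ (i, j))\<^sup>2)"
        proof (rule sum_mono)
          fix i assume "i \<in> {..<n}"
          then have i: "i < n" by simp
          have "(\<Sum>j<n. (?A ^\<^sub>m k) $$ (i, j) * 1) = real d ^ k"
            using adj_matrix_pow_apply[OF i, of E k "\<lambda>_. 1"] adj_op_pow_one[OF reg i] by simp
          moreover have "(\<Sum>j<n. (?A ^\<^sub>m k) $$ (i, j) * x j) = ((adj_op n E) ^^ k) x i"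
            by (rule adj_matrix_pow_apply[OF i])
          moreover have "(\<Sum>j<n. (x j)\<^sup>2) = s 0" by (simp add: s_def)
          moreover have "(\<Sum>j<n. (1::real)\<^sup>2) = real n" by simp
          ultimately show "(real d ^ k)\<^sup>2 / real n + (((adj_op n E) ^^ k) x i)\<^sup>2 / s 0 \<le> (\<Sum>j<n. ((?A ^\<^sub>m k) $$ (i, j))\<^sup>2)"
            using bessel_two[where u = "\<lambda>_. 1" and x = x and n = n and a = "\<lambda>j. (?A ^\<^sub>m k) $$ (i, j)"] orth X n
            by (simp only:)
        qed
        also have "\<dots> = (\<Sum>i<n. (adj_eigenvalues n E ! i) ^ (k + k))"
          unfolding trace_adj_matrix_pow[symmetric]
          by (rule trace_pow_eigenvalues(2)[OF adj_matrix_carrier adj_char_poly])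
        also have "\<dots> \<le> real d ^ (k + k) + real n * (lam\<^sup>2) ^ k" by (rule trace_ndl_le[OF ndl n])
        also have "(\<Sum>i<n. (real d ^ k)\<^sup>2 / real n + (((adj_op n E) ^^ k) x i)\<^sup>2 / s 0) = real d ^ (k + k) + s k / s 0"
          using n by (simp add: sum.distrib s_def sum_divide_distrib[symmetric] power_add power2_eq_square)
        finally show ?thesis using X by (simp add: field_simps)
      qed
    qed
  qed
  also have "\<dots> \<le> lam\<^sup>2 * real (card U)" using s0 by (intro mult_left_mono) auto
  finally show ?thesis unfolding s1 .
qed

section \<open>Counting spanning trees\<close>

lemma sum_degrees:
  assumes reg: "regular_graph n d E" and U: "U \<subseteq> {..<n}"
  shows "(\<Sum>v<n. real (card {u \<in> U. {u, v} \<in> E})) = real d * real (card U)"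
proof -
  have finU: "finite U" using finite_subset[OF U] by simp
  have "real (card {u \<in> U. {u, v} \<in> E}) = (\<Sum>u\<in>U. if {u, v} \<in> E then 1 else 0)" for v
    using finU by (simp add: sum.If_cases Int_def)
  then have "(\<Sum>v<n. real (card {u \<in> U. {u, v} \<in> E})) = (\<Sum>v<n. \<Sum>u\<in>U. if {u, v} \<in> E then 1 else 0)"
    by simp
  also have "\<dots> = (\<Sum>u\<in>U. \<Sum>v<n. if {u, v} \<in> E then 1 else 0)" by (rule sum.swap)
  also have "\<dots> = (\<Sum>u\<in>U. real d)"
  proof (intro sum.cong refl)
    fix u assume "u \<in> U"
    then have "u < n" using U by auto
    then show "(\<Sum>v<n. if {u, v} \<in> E then 1 else 0) = real d"
      using adj_op_const[OF reg, of u 1] by (simp add: adj_op_def)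
  qed
  finally show ?thesis by (simp add: mult.commute)
qed

text \<open>Without edges between A and B every vertex of B deviates from the mean by d |A| / n, so
  mixing gives |A| |B| <= (lam n / d)^2. By the choice of \<open>T\<close> the right side is at most
  (n / (2 T))^2, which is below m^2.\<close>

lemma ndl_joined:
  assumes ndl: "ndl_graph n d lam E" and n: "n \<ge> 2" and lam: "lam > 0"
    and T: "real d \<ge> 2 * real T * lam" and m: "m \<ge> 1" "n < 2 * m * T"
  shows "joined n m E"
  unfolding joined_def
proof (intro allI impI, rule ccontr)
  fix A B assume AB: "A \<subseteq> {..<n} \<and> B \<subseteq> {..<n} \<and> m \<le> card A \<and> m \<le> card B"
    and no: "\<not> (\<exists>a\<in>A. \<exists>b\<in>B. {a, b} \<in> E)"
  define a where "a = real (card A)"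
  define b where "b = real (card B)"
  have a: "a \<ge> real m" "a > 0" and b: "b \<ge> real m" using AB m(1) by (auto simp: a_def b_def)
  have zero: "{u \<in> A. {u, v} \<in> E} = {}" if "v \<in> B" for v using no that by auto
  have "b * (real d * a / real n)\<^sup>2 = (\<Sum>v\<in>B. (real (card {u \<in> A. {u, v} \<in> E}) - real d * a / real n)\<^sup>2)"
  proof -
    have "(real (card {u \<in> A. {u, v} \<in> E}) - real d * a / real n)\<^sup>2 = (real d * a / real n)\<^sup>2" if "v \<in> B" for v
      unfolding zero[OF that] by simp
    then show ?thesis by (simp add: b_def)
  qed
  also have "\<dots> \<le> (\<Sum>v<n. (real (card {u \<in> A. {u, v} \<in> E}) - real d * a / real n)\<^sup>2)"
    using AB by (intro sum_mono2) auto
  also have "\<dots> \<le> lam\<^sup>2 * a"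
    unfolding a_def using AB by (intro expander_mixing[OF ndl n lam]) auto
  finally have "b * (real d * a)\<^sup>2 \<le> lam\<^sup>2 * a * (real n)\<^sup>2"
    using n by (simp add: power_divide field_simps)
  then have "(b * a * (real d)\<^sup>2) * a \<le> (lam\<^sup>2 * (real n)\<^sup>2) * a"
    by (simp add: power2_eq_square mult_ac)
  then have 1: "b * a * (real d)\<^sup>2 \<le> lam\<^sup>2 * (real n)\<^sup>2"
    using a(2) by (rule mult_right_le_imp_le)
  have "(real m * (2 * real T * lam))\<^sup>2 = (real m * real m) * (2 * real T * lam)\<^sup>2" by (simp add: power2_eq_square)
  also have "\<dots> \<le> (b * a) * (real d)\<^sup>2"
    using a b T lam by (intro mult_mono power_mono) auto
  also have "\<dots> \<le> (lam * real n)\<^sup>2" using 1 by (simp add: power_mult_distrib)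
  finally have "real m * (2 * real T * lam) \<le> lam * real n"
    using lam by (simp add: abs_le_square_iff[symmetric])
  then have "lam * real (2 * m * T) \<le> lam * real n" by (simp add: mult_ac)
  then have "real (2 * m * T) \<le> real n" using lam by (rule mult_left_le_imp_le)
  then show False using m(2) by linarith
qed

text \<open>All d |U| edge ends from U fall into its neighbourhood, which holds at most half of the
  vertices and so should receive at most half of them. Cauchy-Schwarz over the neighbourhood N gives
  (d |U| / 2)^2 <= |N| lam^2 |U|, impossible for |N| < (K + 1) |U|.\<close>

lemma ndl_expands:
  assumes ndl: "ndl_graph n d lam E" and n: "n \<ge> 2" and lam: "lam > 0"
    and K: "real d \<ge> 2 * real (K + 1) * lam" and m: "4 * (K + 1) * m \<le> n"
    and U: "U \<subseteq> {..<n}" "U \<noteq> {}" "card U \<le> 2 * m"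
  shows "(K + 1) * card U \<le> card (nbh n E U)"
proof (rule ccontr)
  assume no: "\<not> ?thesis"
  have reg: "regular_graph n d E" using ndl by (simp add: ndl_graph_def)
  have finU: "finite U" using finite_subset[OF U(1)] by simp
  define u where "u = real (card U)"
  define w where "w = real (card (nbh n E U))"
  define g where "g v = real (card {u \<in> U. {u, v} \<in> E})" for v
  have u: "u \<ge> 1" using U(2) finU by (simp add: u_def Suc_le_eq card_gt_0_iff)
  have "card (nbh n E U) < (K + 1) * card U" using no by simp
  then have "real (card (nbh n E U)) < real ((K + 1) * card U)" by (simp only: of_nat_less_iff)
  then have w: "w < real (K + 1) * u" by (simp add: w_def u_def algebra_simps)
  have "2 * card (nbh n E U) \<le> n"
  proof -
    have "2 * card (nbh n E U) \<le> 2 * ((K + 1) * card U)" using no by linarith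
    also have "\<dots> \<le> 2 * ((K + 1) * (2 * m))" using U(3) by (intro mult_left_mono) auto
    finally show ?thesis using m by (simp add: algebra_simps)
  qed
  then have "real (2 * card (nbh n E U)) \<le> real n" by (simp only: of_nat_le_iff)
  then have w2: "2 * w \<le> real n" by (simp add: w_def)
  have sub: "nbh n E U \<subseteq> {..<n}" by (auto simp: nbh_def)
  have "g v = 0" if "v \<in> {..<n} - nbh n E U" for v
  proof -
    have empty: "{u \<in> U. {u, v} \<in> E} = {}" using that by (auto simp: nbh_def)
    show ?thesis unfolding g_def empty by simp
  qed
  then have "(\<Sum>v\<in>nbh n E U. g v) = (\<Sum>v<n. g v)" using sub by (intro sum.mono_neutral_left) auto
  also have "\<dots> = real d * u" unfolding g_def u_def by (rule sum_degrees[OF reg U(1)])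
  finally have "(\<Sum>v\<in>nbh n E U. g v - real d * u / real n) = real d * u - w * (real d * u / real n)"
    by (simp add: sum_subtractf w_def)
  also have "\<dots> = real d * u * (1 - w / real n)" by (simp add: algebra_simps)
  finally have sum: "(\<Sum>v\<in>nbh n E U. g v - real d * u / real n) = real d * u * (1 - w / real n)" .
  have "1/2 \<le> 1 - w / real n" using w2 n by (simp add: field_simps)
  then have "real d * u * (1/2) \<le> real d * u * (1 - w / real n)" using u by (intro mult_left_mono) auto
  then have "(real d * u * (1/2))\<^sup>2 \<le> (real d * u * (1 - w / real n))\<^sup>2" using u by (intro power_mono) auto
  also have "\<dots> = (\<Sum>v\<in>nbh n E U. 1 * (g v - real d * u / real n))\<^sup>2" by (simp add: sum)
  also have "\<dots> \<le> (\<Sum>v\<in>nbh n E U. 1\<^sup>2) * (\<Sum>v\<in>nbh n E U. (g v - real d * u / real n)\<^sup>2)"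
    by (rule Cauchy_Schwarz_ineq_sum)
  also have "\<dots> \<le> w * (lam\<^sup>2 * u)"
  proof (rule mult_mono)
    have "(\<Sum>v\<in>nbh n E U. (g v - real d * u / real n)\<^sup>2) \<le> (\<Sum>v<n. (g v - real d * u / real n)\<^sup>2)"
      using sub by (intro sum_mono2) auto
    also have "\<dots> \<le> lam\<^sup>2 * u"
      unfolding g_def u_def by (rule expander_mixing[OF ndl n lam U(1)])
    finally show "(\<Sum>v\<in>nbh n E U. (g v - real d * u / real n)\<^sup>2) \<le> lam\<^sup>2 * u" .
  qed (auto simp: w_def intro: sum_nonneg)
  also have "\<dots> < (real (K + 1) * u) * (lam\<^sup>2 * u)"
    using w u lam by (intro mult_strict_right_mono) auto
  finally have "((real d)\<^sup>2) * u\<^sup>2 < (4 * real (K + 1) * lam\<^sup>2) * u\<^sup>2"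
    by (simp add: power2_eq_square algebra_simps)
  then have 1: "(real d)\<^sup>2 < 4 * real (K + 1) * lam\<^sup>2" using u by simp
  have "4 * real (K + 1) * lam\<^sup>2 \<le> 4 * (real (K + 1) * real (K + 1)) * lam\<^sup>2"
    by (intro mult_right_mono mult_left_mono) (auto simp: algebra_simps)
  also have "\<dots> = (2 * real (K + 1) * lam)\<^sup>2" by (simp add: power2_eq_square algebra_simps)
  also have "\<dots> \<le> (real d)\<^sup>2" using K lam by (intro power_mono) auto
  finally show False using 1 by simp
qed

text \<open>A nonempty set closed under neighbours cannot expand, so it has more than
  \<open>2 * m\<close> vertices. In a cut without edges both sides would be that large, and then
  \<open>joined\<close> provides an edge.\<close>

lemma expanding_connected:
  assumes joined: "joined n m E" and K: "K \<ge> 1"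
    and expand: "\<And>U. U \<subseteq> {..<n} \<Longrightarrow> U \<noteq> {} \<Longrightarrow> card U \<le> 2 * m \<Longrightarrow> (K + 1) * card U \<le> card (nbh n E U)"
    and X: "X \<noteq> {}" "X \<subset> {..<n}"
  shows "\<exists>x\<in>X. \<exists>y\<in>{..<n} - X. {x, y} \<in> E"
proof (rule ccontr)
  assume no: "\<not> ?thesis"
  have large: "2 * m < card S" if S: "S \<subseteq> {..<n}" "S \<noteq> {}" "nbh n E S \<subseteq> S" for S
  proof (rule ccontr)
    assume "\<not> 2 * m < card S"
    then have "(K + 1) * card S \<le> card (nbh n E S)" using S by (intro expand) auto
    also have "\<dots> \<le> card S" using S finite_subset by (intro card_mono) auto
    finally have "card S = 0" using K by simp
    then show False using S finite_subset[OF S(1)] by simp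
  qed
  have "nbh n E X \<subseteq> X" using no by (auto simp: nbh_def)
  then have "2 * m < card X" using X by (intro large) auto
  moreover have "nbh n E ({..<n} - X) \<subseteq> {..<n} - X" using no by (auto simp: nbh_def insert_commute)
  then have "2 * m < card ({..<n} - X)" using X by (intro large) auto
  ultimately have "m \<le> card X" "m \<le> card ({..<n} - X)" by simp_all
  then show False using joined no X unfolding joined_def by (metis Diff_subset psubset_imp_subset)
qed

lemma finite_spanning_trees:
  assumes "simple_graph_on n E"
  shows "finite {T. spanning_tree n E T}"
proof -
  have "E \<subseteq> Pow {..<n}" using assms unfolding simple_graph_on_def by auto
  then have "finite E" by (rule finite_subset) simp
  then show ?thesis by (rule finite_subset[rotated, OF finite_Pow_iff[THEN iffD2]]) (auto simp: spanning_tree_def)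
qed

text \<open>A tree in TT is recovered from the class of a spanning tree containing it, its vertex set and its
  root inside the chosen representative of the class.\<close>
lemma card_embedded_trees_le:
  assumes simple: "simple_graph_on n E"
    and emb: "\<And>t. t \<in> TT \<Longrightarrow> sz t = s \<and> (\<exists>T W w. spanning_tree n E T \<and> W \<subseteq> {..<n} \<and> rep W {e \<in> T. e \<subseteq> W} w t)"
  shows "card TT \<le> num_unlabelled_spanning_trees n E * ((n choose s) * n)"
proof -
  define Q where "Q = {T. spanning_tree n E T} // iso_rel n"
  have "Q = (\<lambda>T. iso_rel n `` {T}) ` {T. spanning_tree n E T}" by (auto simp: Q_def quotient_def)
  then have finQ: "finite Q" using finite_spanning_trees[OF simple] by simp
  \<comment> \<open>A class also contains edge sets that are not subgraphs of the given graph, so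
    the representative is chosen among its spanning trees.\<close>
  define rp where "rp X = (SOME T. T \<in> X \<and> spanning_tree n E T)" for X
  have ex: "\<exists>X W w. X \<in> Q \<and> W \<subseteq> {..<n} \<and> card W = s \<and> w < n \<and> rep W {e \<in> rp X. e \<subseteq> W} w t" if t: "t \<in> TT" for t
  proof -
    obtain T W w where T: "spanning_tree n E T" "W \<subseteq> {..<n}" "rep W {e \<in> T. e \<subseteq> W} w t"
      using emb[OF t] by blast
    define X where "X = iso_rel n `` {T}"
    have "X \<in> Q" using T(1) by (simp add: X_def Q_def quotientI)
    have "T \<in> X" by (simp add: X_def iso_rel_def graph_iso_refl)
    then have "rp X \<in> X \<and> spanning_tree n E (rp X)"
      unfolding rp_def using T(1) by (intro someI[of "\<lambda>T. T \<in> X \<and> spanning_tree n E T"]) simp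
    then have iso: "graph_iso n T (rp X)" and sp: "spanning_tree n E (rp X)" by (auto simp: X_def iso_rel_def)
    have simp_T: "simple_graph_on n T" "simple_graph_on n (rp X)"
      using T(1) sp by (auto simp: spanning_tree_def is_tree_on_def)
    \<comment> \<open>The isomorphism carries the embedded tree into the representative without
      changing its shape, so vertex set and root are recorded there.\<close>
    obtain f where f: "bij_betw f {..<n} {..<n}" "rp X = (`) f ` T"
      using graph_iso_imageD[OF iso simp_T] by blast
    have inj: "inj_on f {..<n}" using f(1) by (rule bij_betw_imp_inj_on)
    have rep': "rep (f ` W) ((`) f ` {e \<in> T. e \<subseteq> W}) (f w) t"
      by (rule rep_image[OF T(3) inj_on_subset[OF inj T(2)]])
    have eT: "e \<subseteq> {..<n}" if "e \<in> T" for e using simp_T(1) that unfolding simple_graph_on_def by auto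
    have "(`) f ` {e \<in> T. e \<subseteq> W} = {e \<in> rp X. e \<subseteq> f ` W}"
    proof (intro equalityI subsetI)
      fix e assume "e \<in> {e \<in> rp X. e \<subseteq> f ` W}"
      then obtain e' where e': "e' \<in> T" "e = f ` e'" "f ` e' \<subseteq> f ` W" unfolding f(2) by auto
      then have "e' \<subseteq> W" using inj_on_image_subset_iff[OF inj eT[OF e'(1)] T(2)] by simp
      then show "e \<in> (`) f ` {e \<in> T. e \<subseteq> W}" using e' by auto
    qed (auto simp: f(2))
    then have "rep (f ` W) {e \<in> rp X. e \<subseteq> f ` W} (f w) t" using rep' by simp
    moreover have fW: "f ` W \<subseteq> {..<n}" using f(1) T(2) by (auto simp: bij_betw_def)
    moreover have "card (f ` W) = s" using rep_card[OF rep'] emb[OF t] by simp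
    moreover have "f w < n" using rep_root[OF rep'] fW by auto
    ultimately show ?thesis using \<open>X \<in> Q\<close> by blast
  qed
  define P where "P t z \<longleftrightarrow> (case z of (X, W, w) \<Rightarrow>
    X \<in> Q \<and> W \<subseteq> {..<n} \<and> card W = s \<and> w < n \<and> rep W {e \<in> rp X. e \<subseteq> W} w t)" for t z
  define Z where "Z t = (SOME z. P t z)" for t
  have Z: "P t (Z t)" if t: "t \<in> TT" for t
  proof -
    obtain X W w where "P t (X, W, w)" using ex[OF t] by (auto simp: P_def)
    then show ?thesis unfolding Z_def by (rule someI)
  qed
  have "inj_on Z TT"
  proof (rule inj_onI)
    fix t t' assume t: "t \<in> TT" "t' \<in> TT" "Z t = Z t'"
    obtain X W w where "Z t = (X, W, w)" by (cases "Z t")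
    then have "rep W {e \<in> rp X. e \<subseteq> W} w t" "rep W {e \<in> rp X. e \<subseteq> W} w t'"
      using Z[OF t(1)] Z[OF t(2)] t(3) by (simp_all add: P_def)
    then show "t = t'" by (rule rep_unique)
  qed
  moreover have "Z ` TT \<subseteq> Q \<times> {W. W \<subseteq> {..<n} \<and> card W = s} \<times> {..<n}"
  proof
    fix z assume "z \<in> Z ` TT"
    then obtain t where "P t z" using Z by blast
    then show "z \<in> Q \<times> {W. W \<subseteq> {..<n} \<and> card W = s} \<times> {..<n}" by (cases z) (simp add: P_def)
  qed
  moreover have "finite (Q \<times> {W. W \<subseteq> {..<n} \<and> card W = s} \<times> {..<n})" using finQ by auto
  ultimately have "card TT \<le> card (Q \<times> {W. W \<subseteq> {..<n} \<and> card W = s} \<times> {..<n})"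
    by (rule card_inj_on_le)
  also have "\<dots> = card Q * ((n choose s) * n)"
    using n_subsets[of "{..<n}" s] by (simp add: card_cartesian_product)
  finally show ?thesis by (simp add: Q_def num_unlabelled_spanning_trees_def)
qed

lemma spanning_trees_lower_bound:
  assumes ndl: "ndl_graph n d lam E" and n: "n \<ge> 2" and lam: "lam > 0" and k: "k \<ge> 1" "q \<ge> 1"
    and T: "real d \<ge> 2 * real T * lam" "T \<ge> k + 1" and m: "m \<ge> 1" "n < 2 * m * T" "4 * (k + 1) * m \<le> n"
    and size: "Suc (k * q) + m + 2 * m * k \<le> n"
  shows "rcount k ^ q \<le> num_unlabelled_spanning_trees n E * ((n choose (k * q)) * n)"
proof -
  have simple: "simple_graph_on n E" using ndl by (simp add: ndl_graph_def)
  have joined: "joined n m E" by (rule ndl_joined[OF ndl n lam T(1) m(1,2)])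
  have "2 * real (k + 1) * lam \<le> 2 * real T * lam" using T(2) lam by (intro mult_right_mono) auto
  then have dk: "real d \<ge> 2 * real (k + 1) * lam" using T(1) by linarith
  have expand: "(k + 1) * card U \<le> card (nbh n E U)" if "U \<subseteq> {..<n}" "U \<noteq> {}" "card U \<le> 2 * m" for U
    by (rule ndl_expands[OF ndl n lam dk m(3) that])
  have "card {t \<in> rtrees (k * q). bounded_kids k t} \<le> num_unlabelled_spanning_trees n E * ((n choose (k * q)) * n)"
  proof (rule card_embedded_trees_le[OF simple])
    fix t assume "t \<in> {t \<in> rtrees (k * q). bounded_kids k t}"
    then have t: "sz t = k * q" "bounded_kids k t" by (auto simp: rtrees_def)
    have "Suc (sz t) + m + 2 * m * k \<le> n" using size t by simp
    from embed_tree[OF joined m(1) k(1) t(2) this expand]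
    obtain W F w where W: "W \<subseteq> {..<n}" "rep W F w t" "F \<subseteq> E" by blast
    \<comment> \<open>The embedded tree is extended along arbitrary edges of the graph, which exist
      across every cut.\<close>
    have "\<exists>F' t'. rep {..<n} F' w t' \<and> F' \<subseteq> F \<union> E \<and> {e \<in> F'. e \<subseteq> W} = F"
    proof (rule rep_grow[OF W(2,1)])
      fix X assume "w \<in> X" "X \<subset> {..<n}"
      then show "\<exists>x\<in>X. \<exists>y\<in>{..<n} - X. {x, y} \<in> E"
        by (intro expanding_connected[OF joined k(1) expand]) auto
    qed simp
    then obtain F' t' where F': "rep {..<n} F' w t'" "F' \<subseteq> E" "{e \<in> F'. e \<subseteq> W} = F" using W(3) by blast
    have "spanning_tree n E F'" using rep_tree[OF F'(1)] F'(2) by (simp add: spanning_tree_def)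
    then show "sz t = k * q \<and> (\<exists>T W w. spanning_tree n E T \<and> W \<subseteq> {..<n} \<and> rep W {e \<in> T. e \<subseteq> W} w t)"
      using t(1) W F'(3) by auto
  qed
  then show ?thesis using many_bounded_trees[OF k(2), of k] by linarith
qed

text \<open>A single term of the binomial expansion of (1 + x)^n. With small x it plays the part of
  an entropy bound for the choice of the few vertices left out.\<close>

lemma binomial_power_le:
  fixes x :: real
  assumes "0 \<le> x" "j \<le> n"
  shows "real (n choose j) * x ^ (n - j) \<le> (1 + x) ^ n"
proof -
  have "real (n choose j) * x ^ (n - j) = real (n choose j) * 1 ^ j * x ^ (n - j)" by simp
  also have "\<dots> \<le> (\<Sum>i\<le>n. real (n choose i) * 1 ^ i * x ^ (n - i))"
    using assms by (intro member_le_sum[of j "{..n}" "\<lambda>i. real (n choose i) * 1 ^ i * x ^ (n - i)"]) auto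
  also have "\<dots> = (1 + x) ^ n" by (rule binomial_ring[symmetric])
  finally show ?thesis .
qed

text \<open>Divided by b^n the inequality reads n gamma^n <= theta^s with gamma = beta (1 + x) / b
  and theta = x / b. First x is taken so small that gamma < 1; then s <= n / M makes the right side
  at least theta^(n / M), whose base tends to 1 as M grows.\<close>

lemma growth_parameters:
  fixes \<beta> b :: real
  assumes "0 < \<beta>" "\<beta> < b" "1 \<le> b"
  obtains x :: real and M N :: nat where "0 < x" "x \<le> 1" "M \<ge> 2"
    "\<And>n s. N \<le> n \<Longrightarrow> s \<le> n \<Longrightarrow> s * M \<le> n \<Longrightarrow> \<beta> ^ n * real n * (1 + x) ^ n \<le> b ^ (n - s) * x ^ s"
proof -
  define y where "y = b / \<beta>"
  define x where "x = min 1 ((y - 1) / 2)"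
  have y: "y > 1" using assms by (simp add: y_def)
  have "x \<le> (y - 1) / 2" unfolding x_def by (rule min.cobounded2)
  then have "1 + x \<le> (y + 1) / 2" by (simp add: field_simps)
  also have "\<dots> < y" using y by simp
  finally have x: "0 < x" "x \<le> 1" "1 + x < b / \<beta>" using y by (simp_all add: x_def y_def)
  define \<theta> where "\<theta> = x / b"
  have \<theta>: "0 < \<theta>" "\<theta> \<le> 1" using x assms by (auto simp: \<theta>_def)
  define \<gamma> where "\<gamma> = \<beta> * (1 + x) / b"
  have "0 < \<gamma>" unfolding \<gamma>_def using x assms by (intro divide_pos_pos mult_pos_pos) auto
  moreover have "\<gamma> < 1" using x(3) assms by (simp add: \<gamma>_def field_simps)
  ultimately have \<gamma>: "0 < \<gamma>" "\<gamma> < 1" by simp_all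
  \<comment> \<open>\<open>M\<close> is chosen so that theta^(1/M) exceeds gamma; the gap then also
    absorbs the factor n.\<close>
  have "(\<lambda>M. \<theta> powr (1 / real M)) \<longlonglongrightarrow> \<theta> powr 0"
    using \<theta>(1) by (intro tendsto_powr tendsto_const lim_1_over_n) auto
  then have "(\<lambda>M. \<theta> powr (1 / real M)) \<longlonglongrightarrow> 1" using \<theta>(1) by simp
  then have "\<forall>\<^sub>F M in sequentially. \<gamma> < \<theta> powr (1 / real M)" using \<gamma>(2) by (rule order_tendstoD)
  then have "\<forall>\<^sub>F M in sequentially. \<gamma> < \<theta> powr (1 / real M) \<and> 2 \<le> M"
    by (intro eventually_conj eventually_ge_at_top)
  from eventually_happens'[OF sequentially_bot this]
  obtain M where M: "\<gamma> < \<theta> powr (1 / real M)" "2 \<le> M" by auto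
  define \<rho> where "\<rho> = \<gamma> / \<theta> powr (1 / real M)"
  have \<rho>: "0 < \<rho>" "\<rho> < 1" using M \<gamma> \<theta> by (auto simp: \<rho>_def)
  have "(\<lambda>n. real n * \<rho> ^ n) \<longlonglongrightarrow> 0" using \<rho> by real_asymp
  then have "\<forall>\<^sub>F n in sequentially. real n * \<rho> ^ n < 1" by (rule order_tendstoD) simp
  then obtain N where N: "\<And>n. n \<ge> N \<Longrightarrow> real n * \<rho> ^ n < 1" by (auto simp: eventually_sequentially)
  have "\<beta> ^ n * real n * (1 + x) ^ n \<le> b ^ (n - s) * x ^ s" if n: "N \<le> n" "s \<le> n" "s * M \<le> n" for n s
  proof -
    have "real (s * M) \<le> real n" using n(3) by (simp only: of_nat_le_iff)
    then have sM: "real s \<le> 1 / real M * real n" using M(2) by (simp add: field_simps)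
    have "real n * \<gamma> ^ n = (real n * \<rho> ^ n) * (\<theta> powr (1 / real M)) ^ n"
      using \<theta>(1) by (simp add: \<rho>_def power_divide)
    also have "\<dots> \<le> 1 * (\<theta> powr (1 / real M)) ^ n"
      using N[OF n(1)] by (intro mult_right_mono) auto
    also have "\<dots> = \<theta> powr (1 / real M * real n)"
      using \<theta>(1) by (subst powr_realpow[symmetric]) (simp_all add: powr_powr)
    also have "\<dots> \<le> \<theta> powr real s"
      using sM \<theta> by (intro powr_mono') auto
    also have "\<dots> = \<theta> ^ s" using \<theta>(1) by (rule powr_realpow)
    finally have *: "real n * \<gamma> ^ n \<le> \<theta> ^ s" .
    have "\<beta> ^ n * real n * (1 + x) ^ n = b ^ n * (real n * \<gamma> ^ n)"
      using assms by (simp add: \<gamma>_def power_divide power_mult_distrib)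
    also have "\<dots> \<le> b ^ n * \<theta> ^ s" using * assms by (intro mult_left_mono) auto
    also have "b ^ n = b ^ (n - s) * b ^ s" using n(2) by (simp add: power_add[symmetric])
    also have "b ^ (n - s) * b ^ s * \<theta> ^ s = b ^ (n - s) * x ^ s"
      using assms by (simp add: \<theta>_def power_divide)
    finally show ?thesis .
  qed
  then show ?thesis using that[of x M N] x M(2) by blast
qed

theorem theorem1p3:
  fixes \<epsilon> :: real
  assumes "0 < \<epsilon>" and "\<epsilon> < otter_alpha"
  shows "\<exists>d0 C :: real. \<exists>N :: nat. \<forall>n\<ge>N. \<forall>(d :: nat) (lam :: real) E.
           ndl_graph n d lam E \<and> real d \<ge> d0 \<and> real d / lam \<ge> C \<longrightarrow>
           real (num_unlabelled_spanning_trees n E) \<ge> (otter_alpha - \<epsilon>) ^ n"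
proof -
  define \<beta> where "\<beta> = otter_alpha - \<epsilon>"
  have \<beta>: "\<beta> > 0" using assms by (simp add: \<beta>_def)
  \<comment> \<open>A base above beta that is attained by rooted trees of some fixed size
    \<open>k\<close>. To have b >= 1 in every case, the one-vertex tree with b = 1 is used when
    alpha - epsilon / 2 is below 1.\<close>
  obtain b k where b: "\<beta> < b" "1 \<le> b" "k \<ge> 1" "b ^ k \<le> real (rcount k)"
  proof (cases "otter_alpha - \<epsilon> / 2 \<ge> 1")
    case True
    have "\<forall>\<^sub>F k in sequentially. (otter_alpha - \<epsilon> / 2) ^ k \<le> real (rcount k)"
      using assms by (intro rcount_ge_power) auto
    then have "\<forall>\<^sub>F k in sequentially. (otter_alpha - \<epsilon> / 2) ^ k \<le> real (rcount k) \<and> 1 \<le> k"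
      by (intro eventually_conj eventually_ge_at_top)
    from eventually_happens'[OF sequentially_bot this]
    obtain k where "(otter_alpha - \<epsilon> / 2) ^ k \<le> real (rcount k)" "1 \<le> k" by auto
    moreover have "\<beta> < otter_alpha - \<epsilon> / 2" using assms by (simp add: \<beta>_def)
    ultimately show ?thesis using that True by blast
  next
    case False
    then have "\<beta> < 1" using assms by (simp add: \<beta>_def)
    then show ?thesis by (intro that[of 1 1]) auto
  qed
  obtain x :: real and M N0 :: nat where x: "0 < x" "x \<le> 1" "M \<ge> 2"
    "\<And>n s. N0 \<le> n \<Longrightarrow> s \<le> n \<Longrightarrow> s * M \<le> n \<Longrightarrow> \<beta> ^ n * real n * (1 + x) ^ n \<le> b ^ (n - s) * x ^ s"
    using growth_parameters[OF \<beta> b(1,2)] by blast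
  \<comment> \<open>With m about n / T, the first summand keeps the room m (2 k + 1) of the
    embedding below n / (2 M), and the second provides the expansion factor k + 1 up to sets of size
    \<open>2 * m\<close>.\<close>
  define T where "T = 2 * M * (2 * k + 1) + 4 * (k + 1)"
  define N where "N = N0 + 2 * M * (k + 1) + T + 2"
  have bound: "\<beta> ^ n \<le> real (num_unlabelled_spanning_trees n E)"
    if n: "n \<ge> N" and ndl: "ndl_graph n d lam E" and dl: "real d / lam \<ge> 2 * real T" for n d lam E
  proof -
    have T: "T \<ge> 1" "T \<ge> k + 1" "T \<ge> 4 * (k + 1)" "T \<ge> 2 * M * (2 * k + 1)" by (simp_all add: T_def)
    \<comment> \<open>For lam = 0 the quotient is 0 by convention, and for negative lam it is at
      most 0; both contradict the lower bound 2 T.\<close>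
    have lam: "lam > 0"
    proof (rule ccontr)
      assume "\<not> lam > 0"
      then have "real d / lam \<le> 0" by (simp add: divide_nonneg_nonpos)
      then show False using dl T(1) by simp
    qed
    then have d: "real d \<ge> 2 * real T * lam" using dl by (simp add: field_simps)
    \<comment> \<open>Rounding down loses at most a factor 2, as T <= n: both m T <= n and n < 2 m T
      hold.\<close>
    define m where "m = n div T"
    have nT: "T \<le> n" "n \<ge> 2" using n by (simp_all add: N_def)
    have "m \<ge> 1" using nT T(1) by (simp add: m_def Suc_le_eq div_greater_zero_iff)
    have mT: "m * T \<le> n" by (simp add: m_def)
    have "n < (m + 1) * T" using T(1) by (simp add: m_def dividend_less_div_times)
    also have "\<dots> \<le> (2 * m) * T" using \<open>m \<ge> 1\<close> by (intro mult_right_mono) auto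
    finally have n2: "n < 2 * m * T" .
    have "m * (4 * (k + 1)) \<le> m * T" using T(3) by (rule mult_left_mono) simp
    moreover have "4 * (k + 1) * m = m * (4 * (k + 1))" by (rule mult.commute)
    ultimately have m4: "4 * (k + 1) * m \<le> n" using mT by linarith
    have "m * (2 * M * (2 * k + 1)) \<le> m * T" using T(4) by (rule mult_left_mono) simp
    moreover have "2 * M * (m * (2 * k + 1)) = m * (2 * M * (2 * k + 1))" by (simp only: mult_ac)
    ultimately have mM: "2 * M * (m * (2 * k + 1)) \<le> n" using mT by linarith
    \<comment> \<open>\<open>r\<close> is the room reserved for the embedding, including the
      auxiliary vertex; \<open>q\<close> blocks of size \<open>k\<close> fit beside it. The number
      \<open>s\<close> of vertices outside the prescribed tree is then at most r + k, hence at most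
      n / M.\<close>
    define r where "r = 1 + m * (2 * k + 1)"
    define q where "q = (n - r) div k"
    define s where "s = n - k * q"
    have kM: "2 * M * (k + 1) \<le> n" using n by (simp add: N_def)
    have "2 * M * (r + k) \<le> 2 * n"
    proof -
      have "2 * M * (r + k) = 2 * M * (m * (2 * k + 1)) + 2 * M * (k + 1)" by (simp add: r_def algebra_simps)
      then show ?thesis using mM kM by linarith
    qed
    moreover have "2 * M * (r + k) = 2 * ((r + k) * M)" by (simp only: mult_ac)
    ultimately have rM: "(r + k) * M \<le> n" by linarith
    moreover have "(r + k) * 2 \<le> (r + k) * M" using x(3) by (rule mult_left_mono) simp
    moreover have "(r + k) * 2 = 2 * r + 2 * k" by simp
    ultimately have r2: "2 * r + 2 * k \<le> n" by linarith
    have rn: "r \<le> n" using r2 by linarith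
    have q1: "k * q \<le> n - r" by (simp add: q_def)
    have "n - r < k * q + k"
    proof -
      have "n - r = k * q + (n - r) mod k" by (simp add: q_def)
      moreover have "(n - r) mod k < k" using b(3) by simp
      ultimately show ?thesis by linarith
    qed
    then have sr: "s \<le> r + k" unfolding s_def using rn by linarith
    have "q \<noteq> 0"
    proof
      assume "q = 0"
      then have "n \<le> r + k" using sr by (simp add: s_def)
      moreover have "r \<ge> 1" by (simp add: r_def)
      ultimately show False using r2 by linarith
    qed
    then have q: "q \<ge> 1" by simp
    have kqn: "k * q \<le> n" using q1 by linarith
    have size: "Suc (k * q) + m + 2 * m * k \<le> n"
      using q1 rn by (simp add: r_def algebra_simps)
    have main: "rcount k ^ q \<le> num_unlabelled_spanning_trees n E * ((n choose (k * q)) * n)"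
      by (rule spanning_trees_lower_bound[OF ndl nT(2) lam b(3) q d T(2) \<open>m \<ge> 1\<close> n2 m4 size])
    have "s * M \<le> (r + k) * M" using sr by (rule mult_right_mono) simp
    then have sM: "s * M \<le> n" using rM by linarith
    define R where "R = real (num_unlabelled_spanning_trees n E)"
    have "\<beta> ^ n * real n * (1 + x) ^ n \<le> b ^ (n - s) * x ^ s"
      using n sM by (intro x(4)) (auto simp: N_def s_def)
    also have "n - s = k * q" using kqn by (simp add: s_def)
    also have "b ^ (k * q) * x ^ s \<le> real (rcount k) ^ q * x ^ s"
      unfolding power_mult using b x by (intro mult_right_mono power_mono) auto
    also have "\<dots> \<le> (R * (real (n choose (k * q)) * real n)) * x ^ s"
    proof (rule mult_right_mono)
      have "real (rcount k ^ q) \<le> real (num_unlabelled_spanning_trees n E * ((n choose (k * q)) * n))"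
        using main by (simp only: of_nat_le_iff)
      then show "real (rcount k) ^ q \<le> R * (real (n choose (k * q)) * real n)" by (simp add: R_def)
    qed (use x in simp)
    also have "\<dots> = R * real n * (real (n choose (k * q)) * x ^ (n - k * q))" by (simp add: s_def mult_ac)
    also have "\<dots> \<le> R * real n * (1 + x) ^ n"
      using x kqn by (intro mult_left_mono binomial_power_le) (auto simp: R_def)
    finally have "\<beta> ^ n * (real n * (1 + x) ^ n) \<le> R * (real n * (1 + x) ^ n)" by (simp add: mult_ac)
    moreover have "real n * (1 + x) ^ n > 0" using nT x by simp
    ultimately show ?thesis unfolding R_def by (rule mult_right_le_imp_le)
  qed
  show ?thesis
    by (intro exI[of _ 0] exI[of _ "2 * real T"] exI[of _ N]) (use bound in \<open>auto simp: \<beta>_def\<close>)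
qed

end
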